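(* Let $q$ be an odd prime and let $m,n\ge 1$ be integers. Then (a) $\displaystyle \Omega^\perp(q;m,(q-1)n)\ \ge\ \min\Big\{\rho\big(q;\mathbb{C},\tfrac{(q-1)n}{2}\big),\ \Big\lfloor\frac{n}{m}\Big\rfloor\Big\}$; and (b) $\displaystyle \Omega(q;m,(q-1)n)\ \ge\ \Big\lceil \tfrac12\min\Big\{\rho\big(q;\mathbb{R},(q-1)n\big),\ \Big\lfloor\frac{n}{m}\Big\rfloor\Big\}\Big\rceil .$
   Context: A mass distribution on $\mathbb{R}^N$ is a finite (nonnegative) measure that is absolutely continuous with respect to Lebesgue measure. For $q\ge 3$, a regular $q$-fan $F_q$ in $\mathbb{R}^N$ is a union of $q$ half-hyperplanes with a common boundary $(N-2)$-dimensional affine subspace such that the angle between successive half-hyperplanes is always $2\pi/q$; the $q$ closed regions $S_0,\dots,S_{q-1}$ between successive half-hyperplanes are its regular $q$-sectors. It equipartitions a mass distribution $\mu$ if $\mu(S_i)=\frac1q\mu(\mathbb{R}^N)$ for all $0\le i<q$. Let $F_q^\perp$ denote the linear span of the normal vectors of the half-hyperplanes of $F_q$ (a 2-dimensional subspace). Regular $q$-fans $F_q^1,\dots,F_q^k$ are linearly independent (respectively pairwise orthogonal) if the subspaces $F_q^{1\perp},\dots,F_q^{k\perp}$ are linearly independent, i.e. their sum is direct (respectively pairwise orthogonal). $\Omega(q;m,N)$ (respectively $\Omega^\perp(q;m,N)$) is the maximum $k\ge 0$ such that for any $m$ mass distributions $\mu_1,\dots,\mu_m$ on $\mathbb{R}^N$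 there exist $k$ linearly independent (respectively pairwise orthogonal) regular $q$-fans in $\mathbb{R}^N$, each of which equipartitions each $\mu_j$. For $\mathbb{F}=\mathbb{R}$ or $\mathbb{C}$, $V_k(\mathbb{F}^d)$ is the Stiefel manifold of $k$-tuples of vectors of $\mathbb{F}^d$ that are orthonormal for the standard (Euclidean, resp. Hermitian) inner product. Let $\zeta_q=e^{2\pi i/q}$ and identify $\mathbb{R}^{2t}=\mathbb{C}^t$. For $1\le r<q$ relatively prime to $q$, $\mathbb{Z}_q$ acts freely on $V_k(\mathbb{R}^{2t})$ and on $V_k(\mathbb{C}^t)$ by $\zeta_q\cdot(v_1,v_2,\dots,v_k)=(\zeta_qv_1,\zeta_q^rv_2,\dots,\zeta_q^rv_k)$. Then $\rho(q;\mathbb{R},2t)$ (respectively $\rho(q;\mathbb{C},t)$) is the maximum $k$ such that, for some such $r$, the bundle $V_k(\mathbb{R}^{2t})/\mathbb{Z}_q\to L^{2t-1}(q)=S^{2t-1}/\mathbb{Z}_q$ (respectively $V_k(\mathbb{C}^t)/\mathbb{Z}_q\to L^{2t-1}(q)$), induced by $(v_1,\dots,v_k)\mapsto v_1$, admits a section; equivalently, there is a continuous map $s=(s_1,\dots,s_k)$ from $S^{2t-1}$ to $V_k(\mathbb{R}^{2t})$ (respectively to $V_k(\mathbb{C}^t)$) with $s_1(x)=x$ and $s_i(\zeta_qx)=\zeta_q^rs_i(x)$ for all $x$ and $2\le i\le k$. *)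

theory Defs
  imports "HOL-Analysis.Analysis"
begin

section \<open>Mass distributions and regular fans\<close>

definition mass_distribution :: "(real^'n) measure \<Rightarrow> bool" where
  "mass_distribution M \<longleftrightarrow>
     sets M = sets borel \<and> finite_measure M \<and> absolutely_continuous lborel M"

text \<open>A regular fan is given by its common boundary \<open>A\<close> and by the unit directions \<open>d 0\<close>,
  \<open>d 1\<close>, \dots, taken orthogonal to \<open>A\<close>, of its half-hyperplanes in cyclic order; \<open>d\<close> has
  period \<open>q\<close>.  The vectors \<open>u\<close>, \<open>v\<close> form an orthonormal basis of the plane orthogonal
  to \<open>A\<close>, with \<open>u = d 0\<close>.\<close>

definition regular_fan :: "nat \<Rightarrow> (real^'n) set \<Rightarrow> (nat \<Rightarrow> real^'n) \<Rightarrow> bool" where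
  "regular_fan q A d \<longleftrightarrow>
     3 \<le> q \<and> affine A \<and> aff_dim A = int CARD('n) - 2 \<and>
     (\<exists>u v. norm u = 1 \<and> norm v = 1 \<and> orthogonal u v \<and>
        (\<forall>a\<in>A. \<forall>b\<in>A. orthogonal (a - b) u \<and> orthogonal (a - b) v) \<and>
        (\<forall>i. d i = cos (2 * pi * real i / real q) *\<^sub>R u + sin (2 * pi * real i / real q) *\<^sub>R v))"

definition half_hyperplane :: "(real^'n) set \<Rightarrow> (nat \<Rightarrow> real^'n) \<Rightarrow> nat \<Rightarrow> (real^'n) set" where
  "half_hyperplane A d i = {a + s *\<^sub>R d i | a s. a \<in> A \<and> 0 \<le> s}"

text \<open>Since \<open>2 * pi / q < pi\<close>, the closed region between two successive half-hyperplanes is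
  the boundary plus the convex cone generated by their two directions.\<close>

definition regular_sector :: "(real^'n) set \<Rightarrow> (nat \<Rightarrow> real^'n) \<Rightarrow> nat \<Rightarrow> (real^'n) set" where
  "regular_sector A d i =
     {a + s *\<^sub>R d i + t *\<^sub>R d (Suc i) | a s t. a \<in> A \<and> 0 \<le> s \<and> 0 \<le> t}"

definition equipartitions ::
    "nat \<Rightarrow> (real^'n) set \<Rightarrow> (nat \<Rightarrow> real^'n) \<Rightarrow> (real^'n) measure \<Rightarrow> bool" where
  "equipartitions q A d M \<longleftrightarrow>
     (\<forall>i<q. measure M (regular_sector A d i) = measure M UNIV / real q)"

definition fan_perp :: "nat \<Rightarrow> (real^'n) set \<Rightarrow> (nat \<Rightarrow> real^'n) \<Rightarrow> (real^'n) set" where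
  "fan_perp q A d =
     span (\<Union>i<q. {w. \<forall>x\<in>half_hyperplane A d i. \<forall>y\<in>half_hyperplane A d i. orthogonal w (x - y)})"

definition independent_subspaces :: "nat \<Rightarrow> (nat \<Rightarrow> (real^'n) set) \<Rightarrow> bool" where
  "independent_subspaces k W \<longleftrightarrow>
     (\<forall>w. (\<forall>i<k. w i \<in> W i) \<and> (\<Sum>i<k. w i) = 0 \<longrightarrow> (\<forall>i<k. w i = 0))"

definition orthogonal_subspaces :: "nat \<Rightarrow> (nat \<Rightarrow> (real^'n) set) \<Rightarrow> bool" where
  "orthogonal_subspaces k W \<longleftrightarrow>
     (\<forall>i<k. \<forall>j<k. i \<noteq> j \<longrightarrow> (\<forall>x\<in>W i. \<forall>y\<in>W j. orthogonal x y))"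

text \<open>The dimension \<open>N\<close> is the cardinality of the index type \<open>'n\<close>.  In both sets below \<open>k = 0\<close>
  occurs and \<open>2 * k \<le> N\<close>, so the greatest element exists.\<close>

definition Omega :: "'n::finite itself \<Rightarrow> nat \<Rightarrow> nat \<Rightarrow> nat" where
  "Omega _ q m = (GREATEST k.
     \<forall>\<mu> :: nat \<Rightarrow> (real^'n) measure. (\<forall>j<m. mass_distribution (\<mu> j)) \<longrightarrow>
       (\<exists>A d. (\<forall>i<k. regular_fan q (A i) (d i)) \<and>
              independent_subspaces k (\<lambda>i. fan_perp q (A i) (d i)) \<and>
              (\<forall>i<k. \<forall>j<m. equipartitions q (A i) (d i) (\<mu> j))))"

definition Omega_perp :: "'n::finite itself \<Rightarrow> nat \<Rightarrow> nat \<Rightarrow> nat" where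
  "Omega_perp _ q m = (GREATEST k.
     \<forall>\<mu> :: nat \<Rightarrow> (real^'n) measure. (\<forall>j<m. mass_distribution (\<mu> j)) \<longrightarrow>
       (\<exists>A d. (\<forall>i<k. regular_fan q (A i) (d i)) \<and>
              orthogonal_subspaces k (\<lambda>i. fan_perp q (A i) (d i)) \<and>
              (\<forall>i<k. \<forall>j<m. equipartitions q (A i) (d i) (\<mu> j))))"

section \<open>Stiefel manifolds over lens spaces\<close>

text \<open>For a map \<open>g\<close> of finite order, \<open>orbit g x\<close> is the orbit of \<open>x\<close> under the cyclic group
  generated by \<open>g\<close>, and \<open>orbit_space X g\<close> is the set of orbits with the quotient topology.\<close>

definition orbit :: "('a \<Rightarrow> 'a) \<Rightarrow> 'a \<Rightarrow> 'a set" where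
  "orbit g x = {(g ^^ j) x | j. True}"

definition orbit_space :: "'a topology \<Rightarrow> ('a \<Rightarrow> 'a) \<Rightarrow> 'a set topology" where
  "orbit_space X g = topology (\<lambda>U. U \<subseteq> orbit g ` topspace X \<and>
     openin X {x \<in> topspace X. orbit g x \<in> U})"

lemma openin_orbit_space:
  "openin (orbit_space X g) U \<longleftrightarrow>
     U \<subseteq> orbit g ` topspace X \<and> openin X {x \<in> topspace X. orbit g x \<in> U}"
proof -
  have "istopology (\<lambda>U. U \<subseteq> orbit g ` topspace X \<and> openin X {x \<in> topspace X. orbit g x \<in> U})"
    (is "istopology ?P")
    unfolding istopology_def
  proof (intro conjI allI impI)
    fix S T assume "?P S" "?P T"
    moreover have "{x \<in> topspace X. orbit g x \<in> S \<inter> T} =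
        {x \<in> topspace X. orbit g x \<in> S} \<inter> {x \<in> topspace X. orbit g x \<in> T}" by blast
    ultimately show "S \<inter> T \<subseteq> orbit g ` topspace X"
      "openin X {x \<in> topspace X. orbit g x \<in> S \<inter> T}" by auto
  next
    fix \<K> assume K: "\<forall>S\<in>\<K>. ?P S"
    then show "\<Union>\<K> \<subseteq> orbit g ` topspace X" by blast
    have "{x \<in> topspace X. orbit g x \<in> \<Union>\<K>} = (\<Union>S\<in>\<K>. {x \<in> topspace X. orbit g x \<in> S})"
      by blast
    then show "openin X {x \<in> topspace X. orbit g x \<in> \<Union>\<K>}" using K by auto
  qed
  then show ?thesis by (simp add: orbit_space_def topology_inverse')
qed

lemma quotient_map_orbit_space: "quotient_map X (orbit_space X g) (orbit g)"
proof -
  have "openin (orbit_space X g) (orbit g ` topspace X)"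
    by (auto simp: openin_orbit_space intro: openin_subopen[THEN iffD2])
  then have "topspace (orbit_space X g) = orbit g ` topspace X"
    by (metis openin_orbit_space openin_subset openin_topspace subset_antisym)
  then show ?thesis by (auto simp: quotient_map_def openin_orbit_space)
qed

definition zeta :: "nat \<Rightarrow> complex" where
  "zeta q = cis (2 * pi / real q)"

definition hermitian :: "complex^'t \<Rightarrow> complex^'t \<Rightarrow> complex" where
  "hermitian x y = (\<Sum>i\<in>UNIV. x $ i * cnj (y $ i))"

text \<open>The real vector space \<open>\<real>\<^sup>2\<^sup>t\<close> is \<open>\<complex>\<^sup>t\<close>, represented by \<open>complex^'t\<close>, whose inner product \<open>\<bullet>\<close>
  is the real Euclidean one.  Frames are functions with domain \<open>{1..k}\<close>.\<close>

definition stiefel_real :: "nat \<Rightarrow> (nat \<Rightarrow> complex^'t) set" where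
  "stiefel_real k = {v \<in> {1..k} \<rightarrow>\<^sub>E UNIV.
     \<forall>i\<in>{1..k}. \<forall>j\<in>{1..k}. v i \<bullet> v j = (if i = j then 1 else 0)}"

definition stiefel_complex :: "nat \<Rightarrow> (nat \<Rightarrow> complex^'t) set" where
  "stiefel_complex k = {v \<in> {1..k} \<rightarrow>\<^sub>E UNIV.
     \<forall>i\<in>{1..k}. \<forall>j\<in>{1..k}. hermitian (v i) (v j) = (if i = j then 1 else 0)}"

definition frame_topology ::
    "nat \<Rightarrow> (nat \<Rightarrow> complex^'t) set \<Rightarrow> (nat \<Rightarrow> complex^'t) topology" where
  "frame_topology k V = subtopology (product_topology (\<lambda>_. euclidean) {1..k}) V"

definition frame_rot :: "nat \<Rightarrow> nat \<Rightarrow> nat \<Rightarrow> (nat \<Rightarrow> complex^'t) \<Rightarrow> (nat \<Rightarrow> complex^'t)" where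
  "frame_rot q r k v = (\<lambda>i\<in>{1..k}. if i = 1 then zeta q *s v i else zeta q ^ r *s v i)"

definition lens_space :: "nat \<Rightarrow> (complex^'t) set topology" where
  "lens_space q = orbit_space (top_of_set (sphere 0 1)) (\<lambda>x. zeta q *s x)"

text \<open>The projection induced by \<open>v \<mapsto> v 1\<close> sends an orbit of frames to its image under \<open>v \<mapsto> v 1\<close>,
  which is an orbit in the sphere.\<close>

definition admits_section :: "nat \<Rightarrow> nat \<Rightarrow> nat \<Rightarrow> (nat \<Rightarrow> complex^'t) set \<Rightarrow> bool" where
  "admits_section q r k V \<longleftrightarrow>
     (\<exists>\<sigma>. continuous_map (lens_space q) (orbit_space (frame_topology k V) (frame_rot q r k)) \<sigma> \<and>
          (\<forall>y\<in>topspace (lens_space q). (\<lambda>v. v 1) ` \<sigma> y = y))"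

text \<open>With \<open>t\<close> the cardinality of \<open>'t\<close>, these are \<open>\<rho>(q; \<real>, 2t)\<close> and \<open>\<rho>(q; \<complex>, t)\<close>.  For \<open>q \<ge> 2\<close>
  the value \<open>k = 1\<close> is always attained, and \<open>k \<le> 2t\<close>, respectively \<open>k \<le> t\<close>.\<close>

definition rho_real :: "'t::finite itself \<Rightarrow> nat \<Rightarrow> nat" where
  "rho_real _ q = (GREATEST k. 1 \<le> k \<and>
     (\<exists>r. 1 \<le> r \<and> r < q \<and> coprime r q \<and>
          admits_section q r k (stiefel_real k :: (nat \<Rightarrow> complex^'t) set)))"

definition rho_complex :: "'t::finite itself \<Rightarrow> nat \<Rightarrow> nat" where
  "rho_complex _ q = (GREATEST k. 1 \<le> k \<and>
     (\<exists>r. 1 \<le> r \<and> r < q \<and> coprime r q \<and>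
          admits_section q r k (stiefel_complex k :: (nat \<Rightarrow> complex^'t) set)))"

end

theory Submission
  imports Defs "HOL-Homology.Homology"
begin

text \<open>A complex structure on \<open>\<real>\<^sup>N\<close> turns a unit vector \<open>y\<close> and a number \<open>\<beta>\<close> into a regular
  fan: the sectors are the preimages of the \<open>q\<close> standard cones under \<open>z \<mapsto> \<langle>z, y\<rangle> - \<beta>\<close>, and
  multiplying \<open>y\<close> by a root of unity permutes them cyclically.  A mass is equipartitioned iff the
  first \<open>(q - 1) / 2\<close> Fourier coefficients of its sector masses vanish.  A section over the lens
  space gives equivariant directions \<open>s\<^sub>1(x) = x, s\<^sub>2(x), \<dots>, s\<^sub>k(x)\<close>; only the fan of \<open>s\<^sub>1\<close> gets a
  free centre \<open>b\<close>.  The \<open>k m (q - 1) / 2 \<le> t\<close> coefficients, suitably extended and raised to powers, are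
  equivariant complex functions on the unit sphere of \<open>\<complex>\<^sup>t \<times> \<complex>\<close>, and more than \<open>t\<close> of them are
  needed to avoid a common zero: \<open>t\<close> functions without one would cover the sphere by \<open>2 t\<close> open
  sets, each the disjoint union of the translates of one piece, which the length of a
  \<open>\<int>\<^sub>q\<close>-resolution by singular chains rules out.\<close>

section \<open>Cyclic resolutions in chain complexes\<close>

text \<open>The coordinates show that \<open>t\<close> equivariant functions on the unit sphere of
  C^t need not have a common zero. One more complex variable is required, and the centre of the
  first fan supplies it: its conjugate rotates like \<open>x\<close> itself. Allowing
  \<open>z = 0\<close> creates spurious zeros. They are removed by adding to one coefficient a
  nonnegative multiple of \<open>- cis (pi / q) * b\<close>; this cannot cancel the coefficient,
  since for a far centre the coefficient lies in the open half plane around that same direction. The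
  coefficient of index \<open>p\<close> of fan \<open>i\<close> is multiplied by
  \<open>zeta q\<close> to the power \<open>p\<close> or \<open>p * r\<close>. As \<open>q\<close>
  is prime and \<open>r\<close> is coprime to \<open>q\<close>, this exponent is invertible modulo
  \<open>q\<close>; a power with the inverse exponent has weight one and the same zeros. The planes
  of the fans are complex lines. Hermitian orthonormal frames give orthogonal planes, whence (a).
  Real orthonormal vectors may span the same complex line, but at least half of them are independent
  over the complex numbers; this is the factor 1/2 in (b).\<close>

definition resolution_op :: "nat \<Rightarrow> ('c::ab_group_add \<Rightarrow> 'c) \<Rightarrow> nat \<Rightarrow> 'c \<Rightarrow> 'c" where
  "resolution_op q f p c = (if odd p then f c - c else (\<Sum>j<q. (f ^^ j) c))"

lemma additive_funpow:
  assumes "Modules.additive (f :: 'c::ab_group_add \<Rightarrow> 'c)"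
  shows "Modules.additive (f ^^ n)"
proof -
  interpret Modules.additive f by fact
  show ?thesis
    by (induction n) (simp_all add: Modules.additive_def add)
qed

lemma additive_resolution_op:
  assumes "Modules.additive f" shows "Modules.additive (resolution_op q f p)"
proof -
  interpret Modules.additive f by fact
  show ?thesis
    using additive_funpow[OF assms]
    by (auto simp: Modules.additive_def resolution_op_def add sum.distrib)
qed

lemma sum_funpow_shift:
  fixes f :: "'c::ab_group_add \<Rightarrow> 'c"
  assumes "(f ^^ q) c = c"
  shows "(\<Sum>j<q. (f ^^ Suc j) c) = (\<Sum>j<q. (f ^^ j) c)"
proof -
  have "(\<Sum>j<Suc q. (f ^^ j) c) = (\<Sum>j<q. (f ^^ j) c) + c"
    using assms by simp
  moreover have "(\<Sum>j<Suc q. (f ^^ j) c) = c + (\<Sum>j<q. (f ^^ Suc j) c)"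
    by (subst sum.lessThan_Suc_shift) simp
  ultimately show ?thesis by (simp add: algebra_simps)
qed

text \<open>\<open>resolution_op\<close> lists the differentials of the periodic free resolution of
  the integers over the group ring of the cyclic group: f - 1 in odd degrees and the norm 1 + f +
  ... + f^(q-1) in even ones. Their product in either order is f^q - 1, which kills
  \<open>c\<close>.\<close>

lemma resolution_op_resolution_op:
  assumes "Modules.additive f" and "(f ^^ q) c = c"
  shows "resolution_op q f (Suc p) (resolution_op q f p c) = 0"
proof -
  interpret Modules.additive f by fact
  show ?thesis
  proof (cases "odd p")
    case True
    have "(\<Sum>j<q. (f ^^ j) (f c - c)) = (\<Sum>j<q. (f ^^ Suc j) c) - (\<Sum>j<q. (f ^^ j) c)"
      by (simp add: Modules.additive.diff[OF additive_funpow[OF assms(1)]] sum_subtractf funpow_swap1)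
    then show ?thesis
      using True sum_funpow_shift[OF assms(2)] by (simp add: resolution_op_def)
  next
    case False
    then show ?thesis
      using sum_funpow_shift[OF assms(2)] by (simp add: resolution_op_def sum)
  qed
qed

text \<open>The chains \<open>k p\<close> come from the standard contracting homotopy of the periodic resolution of
  \<open>\<int>\<close> over the group ring of the cyclic group, transported along the splitting given by \<open>P\<close>.\<close>

lemma contraction_of_split_resolution:
  fixes T B P :: "nat \<Rightarrow> 'c::ab_group_add \<Rightarrow> 'c" and S :: "nat \<Rightarrow> 'c set" and e :: "nat \<Rightarrow> 'c"
  assumes addT: "\<And>p. Modules.additive (T p)" and addB: "\<And>p. Modules.additive (B p)" and addP: "\<And>p. Modules.additive (P p)"
    and S0: "\<And>p. 0 \<in> S p" and Sadd: "\<And>p x y. x \<in> S p \<Longrightarrow> y \<in> S p \<Longrightarrow> x + y \<in> S p"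
    and ST: "\<And>p x. x \<in> S p \<Longrightarrow> T p x \<in> S p" and SP: "\<And>p x. x \<in> S p \<Longrightarrow> P p x \<in> S p"
    and Tq: "\<And>p x. x \<in> S p \<Longrightarrow> (T p ^^ q) x = x"
    and BT: "\<And>p x. x \<in> S (Suc p) \<Longrightarrow> B (Suc p) (T (Suc p) x) = T p (B (Suc p) x)"
    and BP: "\<And>p x. x \<in> S (Suc p) \<Longrightarrow> B (Suc p) (P (Suc p) x) = P p (B (Suc p) x)"
    and split: "\<And>p x. x \<in> S p \<Longrightarrow> (\<Sum>j<q. (T p ^^ j) (P p ((T p ^^ (q - j)) x))) = x"
    and q: "2 \<le> q"
    and e: "\<And>p. p \<le> n \<Longrightarrow> e p \<in> S p"
    and Be: "\<And>p. p < n \<Longrightarrow> B (Suc p) (e (Suc p)) = - resolution_op q (T p) (Suc (Suc p)) (e p)"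
  shows "\<exists>k. (\<forall>p\<le>n. k p \<in> S p) \<and>
    (\<forall>p<n. B (Suc p) (k (Suc p)) = resolution_op q (T p) (Suc p) (k p) - e p)"
proof -
  \<comment> \<open>With the partial norms \<open>Q\<close> the equations are solved by telescoping.
    Write N for the norm. For even \<open>p\<close> one gets T k - k = e - T (P (N e)), and the
    boundary of the next \<open>k\<close> is exactly - T (P (N e)); for odd \<open>p\<close> the
    norms of \<open>k p\<close> and of \<open>P p (e p)\<close> agree.\<close>
  define Q where "Q p m = (\<Sum>i<m. (T p ^^ i) (e p))" for p m
  define k where "k p = (if odd p then T p (P p (e p))
      else (\<Sum>j\<in>{1..<q}. (T p ^^ j) (P p (Q p (q - j)))))" for p
  have STn: "(T p ^^ i) x \<in> S p" if "x \<in> S p" for p i x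
    using that by (induction i) (auto intro: ST)
  have Ssum: "(\<Sum>i\<in>I. g i) \<in> S p" if "\<And>i. i \<in> I \<Longrightarrow> g i \<in> S p" for I :: "nat set" and g p
    using that by (induction I rule: infinite_finite_induct) (auto intro: S0 Sadd)
  have QS: "Q p m \<in> S p" if "p \<le> n" for p m
    unfolding Q_def using that by (intro Ssum STn e)
  have kS: "k p \<in> S p" if "p \<le> n" for p
    unfolding k_def using that by (auto intro!: Ssum STn ST SP QS e)
  have arith: "tk - kk = E - tq"
    if "s1 - s2 = s3" "E = a + c + s3" "tq = b + c" "tk = s1 + a" "kk = b + s2"
    for tk kk E tq s1 s2 s3 a b c :: 'c
    using that by (simp add: algebra_simps)
  note addTn = additive_funpow[OF addT]
  have BTn: "B (Suc p) ((T (Suc p) ^^ i) x) = (T p ^^ i) (B (Suc p) x)" if "x \<in> S (Suc p)" for p i x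
    using that by (induction i) (simp_all add: BT STn)
  have "B (Suc p) (k (Suc p)) = resolution_op q (T p) (Suc p) (k p) - e p" if p: "p < n" for p
  proof (cases "even p")
    case True
    let ?E = "e p" and ?E' = "e (Suc p)"
    have E: "?E \<in> S p" "?E' \<in> S (Suc p)" using p e by auto
    have 1: "B (Suc p) (k (Suc p)) = - T p (P p (Q p q))"
      using True E p by (simp add: k_def BT BP SP Be resolution_op_def Modules.additive.minus[OF addT]
          Modules.additive.minus[OF addP] Q_def)
    have kp: "k p = (\<Sum>j\<in>{1..<q}. (T p ^^ j) (P p (Q p (q - j))))"
      using True by (simp add: k_def)
    have "T p (k p) = (\<Sum>j\<in>{1..<q}. (T p ^^ Suc j) (P p (Q p (q - j))))"
      unfolding kp by (simp add: Modules.additive.sum[OF addT])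
    also have "\<dots> = (\<Sum>j\<in>{2..<Suc q}. (T p ^^ j) (P p (Q p (Suc q - j))))"
      by (subst sum.atLeast_Suc_lessThan_Suc_shift[where m=1, simplified numeral_2_eq_2[symmetric] One_nat_def[symmetric] Suc_1]) 
         (simp add: o_def)
    also have "\<dots> = (\<Sum>j\<in>{2..<q}. (T p ^^ j) (P p (Q p (Suc q - j)))) + (T p ^^ q) (P p (Q p 1))"
      using q by (subst sum.atLeastLessThan_Suc) auto
    also have "(T p ^^ q) (P p (Q p 1)) = P p ?E"
      using E by (simp add: Q_def Tq SP)
    finally have Tk: "T p (k p) = (\<Sum>j\<in>{2..<q}. (T p ^^ j) (P p (Q p (Suc q - j)))) + P p ?E" .
    have k2: "k p = T p (P p (Q p (q - 1))) + (\<Sum>j\<in>{2..<q}. (T p ^^ j) (P p (Q p (q - j))))"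
      unfolding kp using q by (subst sum.atLeast_Suc_lessThan) (auto simp: numeral_2_eq_2)
    have Qd: "Q p (Suc q - j) - Q p (q - j) = (T p ^^ (q - j)) ?E" if "j < q" for j
      using that by (simp add: Q_def Suc_diff_le)
    have "(\<Sum>j\<in>{2..<q}. (T p ^^ j) (P p (Q p (Suc q - j)))) - (\<Sum>j\<in>{2..<q}. (T p ^^ j) (P p (Q p (q - j))))
        = (\<Sum>j\<in>{2..<q}. (T p ^^ j) (P p ((T p ^^ (q - j)) ?E)))"
      unfolding sum_subtractf[symmetric] Modules.additive.diff[OF addTn, symmetric]
        Modules.additive.diff[OF addP, symmetric]
      by (intro sum.cong) (auto simp: Qd)
    \<comment> \<open>This is \<open>split\<close> with the summands for \<open>j = 0\<close> and
      \<open>j = 1\<close> taken out; they are the end terms of the telescoping.\<close>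
    moreover have "?E = P p ?E + T p (P p ((T p ^^ (q - 1)) ?E))
        + (\<Sum>j\<in>{2..<q}. (T p ^^ j) (P p ((T p ^^ (q - j)) ?E)))"
    proof -
      have "{..<q} = insert 0 (insert 1 {2..<q})" using q by auto
      then show ?thesis
        using split[OF E(1)] Tq[OF E(1)] by (simp add: algebra_simps)
    qed
    moreover have "Q p q = Q p (q - 1) + (T p ^^ (q - 1)) ?E"
      using q unfolding Q_def by (cases q) auto
    then have "T p (P p (Q p q)) = T p (P p (Q p (q - 1))) + T p (P p ((T p ^^ (q - 1)) ?E))"
      by (simp add: Modules.additive.add[OF addT] Modules.additive.add[OF addP])
    ultimately have "T p (k p) - k p = ?E - T p (P p (Q p q))"
      using Tk k2 arith by blast
    then show ?thesis
      using 1 True by (simp add: resolution_op_def)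
  next
    case False
    let ?E = "e p" and ?E' = "e (Suc p)"
    have E: "?E \<in> S p" "?E' \<in> S (Suc p)" using p e by auto
    have BE': "B (Suc p) ?E' = ?E - T p ?E"
      using Be[OF p] False by (simp add: resolution_op_def)
    \<comment> \<open>Partial norms turn 1 - T into 1 - T^m.\<close>
    have BQ: "B (Suc p) (Q (Suc p) m) = ?E - (T p ^^ m) ?E" for m
      unfolding Q_def
      by (induction m)
         (simp_all add: Modules.additive.sum[OF addB] Modules.additive.zero[OF addB] BTn E BE'
           Modules.additive.diff[OF addTn] Modules.additive.add[OF addB] funpow_swap1)
    have "B (Suc p) (k (Suc p)) = (\<Sum>j\<in>{1..<q}. (T p ^^ j) (P p (?E - (T p ^^ (q - j)) ?E)))"
      using False p
      by (simp add: k_def Modules.additive.sum[OF addB] BTn BP SP QS BQ)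
    \<comment> \<open>The summand for \<open>j = 0\<close> vanishes, because T^q fixes
      \<open>e p\<close>; adding it completes the sum that occurs in \<open>split\<close>.\<close>
    also have "\<dots> = (\<Sum>j<q. (T p ^^ j) (P p (?E - (T p ^^ (q - j)) ?E)))"
      by (rule sum.mono_neutral_left) (auto simp: Tq E Modules.additive.zero[OF addP] not_le less_Suc_eq)
    also have "\<dots> = (\<Sum>j<q. (T p ^^ j) (P p ?E)) - ?E"
      by (simp add: Modules.additive.diff[OF addTn] Modules.additive.diff[OF addP] sum_subtractf split E)
    also have "(\<Sum>j<q. (T p ^^ j) (P p ?E)) = (\<Sum>j<q. (T p ^^ j) (k p))"
      using sum_funpow_shift[OF Tq, OF SP, OF E(1)] False by (simp add: k_def funpow_swap1)
    finally show ?thesis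
      using False by (simp add: resolution_op_def)
  qed
  with kS show ?thesis by blast
qed

lemma additive_eq_on_frag:
  assumes F: "Modules.additive F" and G: "Modules.additive G"
    and eq: "\<And>\<sigma>. \<sigma> \<in> Poly_Mapping.keys c \<Longrightarrow> F (frag_of \<sigma>) = G (frag_of \<sigma>)"
  shows "F c = G c"
  using order_refl[of "Poly_Mapping.keys c"]
  by (induction c rule: frag_induction)
     (simp_all add: Modules.additive.zero[OF F] Modules.additive.zero[OF G] eq Modules.additive.diff[OF F] Modules.additive.diff[OF G])

section \<open>Singular chains: augmentation and smallness with respect to a family of sets\<close>

lemma additive_chain_map: "Modules.additive (chain_map p g)"
  by (simp add: Modules.additive_def chain_map_add)

lemma additive_chain_boundary: "Modules.additive (chain_boundary p)"
  by (simp add: Modules.additive_def chain_boundary_add)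

lemma additive_frag_extend: "Modules.additive (frag_extend f)"
  by (simp add: Modules.additive_def frag_extend_add)

text \<open>The sum of the coefficients of a chain: every generator is sent to the one generator of
  the free group over \<open>unit\<close>, and its coefficient is read off.\<close>

definition augmentation :: "('a \<Rightarrow>\<^sub>0 int) \<Rightarrow> int" where
  "augmentation c = Poly_Mapping.lookup (frag_extend (\<lambda>_. frag_of ()) c) ()"

lemma additive_augmentation: "Modules.additive augmentation"
  by (simp add: Modules.additive_def augmentation_def frag_extend_add lookup_add)

lemma augmentation_of [simp]: "augmentation (frag_of \<sigma>) = 1"
  by (simp add: augmentation_def)

lemma augmentation_chain_map [simp]: "augmentation (chain_map p g c) = augmentation c"
  using additive_eq_on_frag[of "augmentation \<circ> chain_map p g" augmentation c]
  by (simp add: Modules.additive_def additive_augmentation[unfolded Modules.additive_def] chain_map_add)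

text \<open>The boundary of a 1-simplex is the difference of its two end points.\<close>

lemma augmentation_chain_boundary [simp]: "augmentation (chain_boundary (Suc 0) c) = 0"
proof -
  have "Modules.additive (\<lambda>c. augmentation (chain_boundary (Suc 0) c))" "Modules.additive (\<lambda>c. 0::int)"
    by (simp_all add: Modules.additive_def additive_augmentation[unfolded Modules.additive_def] chain_boundary_add)
  then show ?thesis
    by (rule additive_eq_on_frag)
       (simp add: chain_boundary_of Modules.additive.diff[OF additive_augmentation])
qed

text \<open>Chains each of whose simplices lies in some member of \<open>F\<close>. A singleton
  \<open>F\<close> gives the chains of a subspace, so one notion covers the pieces, their families
  of translates and the intersections of both.\<close>

definition fine_chain :: "'a topology \<Rightarrow> 'a set set \<Rightarrow> nat \<Rightarrow> 'a chain \<Rightarrow> bool" where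
  "fine_chain X F p c \<longleftrightarrow> singular_chain p X c \<and>
     (\<forall>\<sigma>\<in>Poly_Mapping.keys c. \<exists>V\<in>F. \<sigma> ` standard_simplex p \<subseteq> V)"

lemma fine_chain_singleton: "fine_chain X {V} p c \<longleftrightarrow> singular_chain p (subtopology X V) c"
  by (auto simp: fine_chain_def singular_chain_subtopology)

lemma fine_chain_0 [simp]: "fine_chain X F p 0"
  by (simp add: fine_chain_def)

lemma fine_chain_add: "fine_chain X F p a \<Longrightarrow> fine_chain X F p b \<Longrightarrow> fine_chain X F p (a + b)"
  using keys_add[of a b] by (auto simp: fine_chain_def singular_chain_add)

lemma fine_chain_diff: "fine_chain X F p a \<Longrightarrow> fine_chain X F p b \<Longrightarrow> fine_chain X F p (a - b)"
  using keys_diff[of a b] by (auto simp: fine_chain_def singular_chain_diff)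

lemma fine_chain_minus: "fine_chain X F p a \<Longrightarrow> fine_chain X F p (- a)"
  by (simp add: fine_chain_def singular_chain_minus)

lemma fine_chain_sum:
  "(\<And>i. i \<in> I \<Longrightarrow> fine_chain X F p (f i)) \<Longrightarrow> fine_chain X F p (\<Sum>i\<in>I. f i)"
  by (induction I rule: infinite_finite_induct) (auto simp: fine_chain_add)

lemma singular_face_image:
  assumes "k \<le> Suc p"
  shows "singular_face (Suc p) k \<sigma> ` standard_simplex p \<subseteq> \<sigma> ` standard_simplex (Suc p)"
  using assms simplical_face_in_standard_simplex[of "Suc p" k] by (auto simp: singular_face_def)

lemma fine_chain_boundary:
  assumes "fine_chain X F (Suc p) c"
  shows "fine_chain X F p (chain_boundary (Suc p) c)"
  unfolding fine_chain_def
proof (intro conjI ballI)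
  show "singular_chain p X (chain_boundary (Suc p) c)"
    using assms by (auto simp: fine_chain_def intro: singular_chain_boundary_alt)
  fix \<tau> assume "\<tau> \<in> Poly_Mapping.keys (chain_boundary (Suc p) c)"
  then obtain \<sigma> where \<sigma>: "\<sigma> \<in> Poly_Mapping.keys c"
    "\<tau> \<in> Poly_Mapping.keys (\<Sum>k\<le>Suc p. frag_cmul ((- 1) ^ k) (frag_of (singular_face (Suc p) k \<sigma>)))"
    using keys_frag_extend by (fastforce simp: chain_boundary_def)
  then obtain k where "k \<le> Suc p" "\<tau> = singular_face (Suc p) k \<sigma>"
    using keys_sum[of "\<lambda>k. frag_cmul ((- 1) ^ k) (frag_of (singular_face (Suc p) k \<sigma>))" "{..Suc p}"]
    by (auto split: if_splits)
  then show "\<exists>V\<in>F. \<tau> ` standard_simplex p \<subseteq> V"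
    using assms \<sigma>(1) singular_face_image[of k p \<sigma>] unfolding fine_chain_def by (meson order_trans)
qed

lemma fine_chain_map:
  assumes "fine_chain X F p c" "continuous_map X X g" "\<And>V. V \<in> F \<Longrightarrow> \<exists>W\<in>F. g ` (V \<inter> topspace X) \<subseteq> W"
  shows "fine_chain X F p (chain_map p g c)"
  unfolding fine_chain_def
proof (intro conjI ballI)
  show "singular_chain p X (chain_map p g c)"
    using assms by (auto simp: fine_chain_def intro: singular_chain_chain_map)
  fix \<tau> assume "\<tau> \<in> Poly_Mapping.keys (chain_map p g c)"
  then obtain \<sigma> where \<sigma>: "\<sigma> \<in> Poly_Mapping.keys c" "\<tau> = simplex_map p g \<sigma>"
    using keys_frag_extend[of "frag_of \<circ> simplex_map p g" c] by (auto simp: chain_map_def)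
  then obtain V where V: "V \<in> F" "\<sigma> ` standard_simplex p \<subseteq> V"
    using assms(1) by (auto simp: fine_chain_def)
  have "singular_simplex p X \<sigma>"
    using \<sigma>(1) assms(1) by (auto simp: fine_chain_def singular_chain_def)
  then have "\<sigma> ` standard_simplex p \<subseteq> topspace X"
    by (auto simp: singular_simplex_def continuous_map_def topspace_standard_simplex Pi_iff)
  moreover obtain W where "W \<in> F" "g ` (V \<inter> topspace X) \<subseteq> W"
    using assms(3)[OF V(1)] by blast
  ultimately show "\<exists>V\<in>F. \<tau> ` standard_simplex p \<subseteq> V"
    using V(2) by (intro bexI[of _ W]) (auto simp: \<sigma> simplex_map_def image_subset_iff)
qed

lemma funpow_chain_map_of:
  fixes g :: "'a \<Rightarrow> 'a"
  shows   "(chain_map p g ^^ i) (frag_of \<sigma>) = frag_of ((simplex_map p g ^^ i) \<sigma>)"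
  by (induction i) simp_all

lemma funpow_simplex_map:
  fixes g :: "'a \<Rightarrow> 'a"
  shows   "x \<in> standard_simplex p \<Longrightarrow> (simplex_map p g ^^ i) \<sigma> x = (g ^^ i) (\<sigma> x)"
  by (induction i) (simp_all add: simplex_map_def)

lemma funpow_simplex_map_periodic:
  assumes "singular_simplex p X \<sigma>" "\<And>x. x \<in> topspace X \<Longrightarrow> (g ^^ q) x = x"
  shows "(simplex_map p g ^^ q) \<sigma> = \<sigma>"
proof
  fix x show "(simplex_map p g ^^ q) \<sigma> x = \<sigma> x"
  proof (cases "x \<in> standard_simplex p")
    case True
    with assms show ?thesis
      by (auto simp: funpow_simplex_map singular_simplex_def continuous_map_def topspace_standard_simplex Pi_iff)
  next
    \<comment> \<open>Singular simplices are extensional, so off the standard simplex both sides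
      take the same default value.\<close>
    case False
    have "(simplex_map p g ^^ q) \<sigma> \<in> extensional (standard_simplex p)"
      using assms(1) by (cases q) (auto simp: simplex_map_def singular_simplex_def)
    with False assms(1) show ?thesis
      by (auto simp: extensional_def singular_simplex_def)
  qed
qed

lemma funpow_chain_map_periodic:
  assumes "singular_chain p X c" "\<And>x. x \<in> topspace X \<Longrightarrow> (g ^^ q) x = x"
  shows "(chain_map p g ^^ q) c = c"
proof -
  have "(chain_map p g ^^ q) c = id c"
  proof (rule additive_eq_on_frag[OF additive_funpow[OF additive_chain_map]])
    fix \<sigma> assume "\<sigma> \<in> Poly_Mapping.keys c"
    then have "singular_simplex p X \<sigma>"
      using assms(1) by (auto simp: singular_chain_def)
    then show "(chain_map p g ^^ q) (frag_of \<sigma>) = id (frag_of \<sigma>)"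
      using funpow_simplex_map_periodic[OF _ assms(2)] by (simp add: funpow_chain_map_of)
  qed (simp add: Modules.additive_def)
  then show ?thesis by simp
qed

lemma singular_chain_funpow_chain_map:
  "singular_chain p X c \<Longrightarrow> continuous_map X X g \<Longrightarrow> singular_chain p X ((chain_map p g ^^ i) c)"
  by (induction i) (auto intro: singular_chain_chain_map)

lemma chain_boundary_funpow_chain_map:
  assumes "singular_chain (Suc p) X c" "continuous_map X X g"
  shows "chain_boundary (Suc p) ((chain_map (Suc p) g ^^ i) c) = (chain_map p g ^^ i) (chain_boundary (Suc p) c)"
proof (induction i)
  case (Suc i)
  have "chain_boundary (Suc p) (chain_map (Suc p) g ((chain_map (Suc p) g ^^ i) c)) =
      chain_map p g (chain_boundary (Suc p) ((chain_map (Suc p) g ^^ i) c))"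
    using chain_boundary_chain_map[OF singular_chain_funpow_chain_map[OF assms]] by (metis diff_Suc_1 One_nat_def)
  with Suc show ?case by simp
qed simp

lemma chain_boundary_resolution_op:
  assumes "singular_chain (Suc p) X c" "continuous_map X X g"
  shows "chain_boundary (Suc p) (resolution_op q (chain_map (Suc p) g) r c) =
     resolution_op q (chain_map p g) r (chain_boundary (Suc p) c)"
  using assms
  by (simp add: resolution_op_def Modules.additive.diff[OF additive_chain_boundary] chain_boundary_chain_map
      Modules.additive.sum[OF additive_chain_boundary] chain_boundary_funpow_chain_map)

lemma fine_chain_resolution_op:
  assumes "fine_chain X F p c" "continuous_map X X g" "\<And>V. V \<in> F \<Longrightarrow> \<exists>W\<in>F. g ` (V \<inter> topspace X) \<subseteq> W"
  shows "fine_chain X F p (resolution_op q (chain_map p g) r c)"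
proof -
  have "fine_chain X F p ((chain_map p g ^^ i) c)" for i
    by (induction i) (auto intro: fine_chain_map assms)
  then show ?thesis
    using assms by (auto simp: resolution_op_def intro!: fine_chain_diff fine_chain_sum fine_chain_map)
qed

section \<open>Subdivision commutes with the boundary and with the cyclic operators\<close>

lemma iterated_subdivision_chain:
  assumes "singular_chain p X c"
  shows "singular_chain p X ((singular_subdivision p ^^ m) c)"
  using assms by (induction m) (auto intro: singular_chain_singular_subdivision)

lemma additive_iterated_subdivision: "Modules.additive (singular_subdivision p ^^ m)"
  by (rule additive_funpow) (simp add: Modules.additive_def singular_subdivision_add)

lemma chain_boundary_iterated_subdivision:
  assumes "singular_chain (Suc p) X c"
  shows "chain_boundary (Suc p) ((singular_subdivision (Suc p) ^^ m) c) =
     (singular_subdivision p ^^ m) (chain_boundary (Suc p) c)"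
proof (induction m)
  case (Suc m)
  then show ?case
    using chain_boundary_singular_subdivision[OF iterated_subdivision_chain[OF assms, of m]] by simp
qed simp

lemma iterated_subdivision_chain_map:
  assumes "singular_chain p X c"
  shows "(singular_subdivision p ^^ m) (chain_map p g c) = chain_map p g ((singular_subdivision p ^^ m) c)"
proof (induction m)
  case (Suc m)
  then show ?case
    using naturality_singular_subdivision[OF iterated_subdivision_chain[OF assms, of m]] by simp
qed simp

lemma iterated_subdivision_resolution_op:
  assumes "singular_chain p X c" "continuous_map X X g"
  shows "(singular_subdivision p ^^ m) (resolution_op q (chain_map p g) r c) =
     resolution_op q (chain_map p g) r ((singular_subdivision p ^^ m) c)"
proof -
  have "(singular_subdivision p ^^ m) ((chain_map p g ^^ i) c) = (chain_map p g ^^ i) ((singular_subdivision p ^^ m) c)" for i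
  proof (induction i)
    case (Suc i)
    show ?case
      using iterated_subdivision_chain_map[OF singular_chain_funpow_chain_map[OF assms, of i], where m=m and g=g] Suc by simp
  qed simp
  then show ?thesis
    using assms
    by (simp add: resolution_op_def Modules.additive.diff[OF additive_iterated_subdivision]
        Modules.additive.sum[OF additive_iterated_subdivision] iterated_subdivision_chain_map)
qed

text \<open>Subdividing a resolution therefore leaves its bottom chain, and with it the
  augmentation, unchanged.\<close>

lemma iterated_subdivision_0:
  assumes "singular_chain 0 X c"
  shows "(singular_subdivision 0 ^^ m) c = c"
  by (induction m) (simp_all add: singular_subdivision_zero[OF assms])

section \<open>Resolutions on covered spaces\<close>

lemma funpow_pred: "0 < j \<Longrightarrow> (f ^^ (j - 1)) (f x) = (f ^^ j) x"
  by (cases j) (simp_all add: funpow_swap1)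

text \<open>Applied to one of several disjoint translates, this is the projection onto a fundamental
  domain of the chain module, the map \<open>P\<close> of the split resolution.\<close>

definition chain_restrict :: "nat \<Rightarrow> 'a set \<Rightarrow> 'a chain \<Rightarrow> 'a chain" where
  "chain_restrict p A = frag_extend (\<lambda>\<sigma>. if \<sigma> ` standard_simplex p \<subseteq> A then frag_of \<sigma> else 0)"

lemma additive_chain_restrict: "Modules.additive (chain_restrict p A)"
  unfolding chain_restrict_def by (rule additive_frag_extend)

lemma keys_chain_restrict:
  "Poly_Mapping.keys (chain_restrict p A c) \<subseteq> {\<sigma> \<in> Poly_Mapping.keys c. \<sigma> ` standard_simplex p \<subseteq> A}"
  unfolding chain_restrict_def
  by (rule order_trans[OF keys_frag_extend]) (force split: if_splits)

lemma keys_diff_chain_restrict: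
  "Poly_Mapping.keys (c - chain_restrict p A c) \<subseteq> {\<sigma> \<in> Poly_Mapping.keys c. \<not> \<sigma> ` standard_simplex p \<subseteq> A}"
proof -
  let ?F = "frag_extend (\<lambda>\<sigma>. if \<sigma> ` standard_simplex p \<subseteq> A then 0 else frag_of \<sigma>)"
  have "(\<lambda>c. c - chain_restrict p A c) c = ?F c"
  proof (rule additive_eq_on_frag[OF _ additive_frag_extend])
    show "Modules.additive (\<lambda>c. c - chain_restrict p A c)"
      by (simp add: Modules.additive_def Modules.additive.add[OF additive_chain_restrict])
  qed (simp add: chain_restrict_def)
  moreover have "Poly_Mapping.keys (?F c) \<subseteq> {\<sigma> \<in> Poly_Mapping.keys c. \<not> \<sigma> ` standard_simplex p \<subseteq> A}"
    by (rule order_trans[OF keys_frag_extend]) (auto split: if_splits)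
  ultimately show ?thesis by simp
qed

lemma fine_chain_restrict: "fine_chain X F p c \<Longrightarrow> fine_chain X F p (chain_restrict p A c)"
  using keys_chain_restrict[of p A c] by (auto simp: fine_chain_def singular_chain_def)

text \<open>Faces are nonempty. Hence, if no simplex of \<open>c\<close> straddles \<open>A\<close>,
  a face lies in \<open>A\<close> exactly when its simplex does, and cutting commutes with taking
  faces.\<close>

lemma chain_boundary_restrict:
  assumes "\<And>\<sigma>. \<sigma> \<in> Poly_Mapping.keys c \<Longrightarrow>
      \<sigma> ` standard_simplex (Suc p) \<subseteq> A \<or> \<sigma> ` standard_simplex (Suc p) \<inter> A = {}"
  shows "chain_boundary (Suc p) (chain_restrict (Suc p) A c) = chain_restrict p A (chain_boundary (Suc p) c)"
proof -
  have "(chain_boundary (Suc p) \<circ> chain_restrict (Suc p) A) c = (chain_restrict p A \<circ> chain_boundary (Suc p)) c"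
  proof (rule additive_eq_on_frag[where c = c])
    show "Modules.additive (chain_boundary (Suc p) \<circ> chain_restrict (Suc p) A)"
      "Modules.additive (chain_restrict p A \<circ> chain_boundary (Suc p))"
      by (simp_all add: Modules.additive_def Modules.additive.add[OF additive_chain_restrict] chain_boundary_add)
    fix \<sigma> assume \<sigma>: "\<sigma> \<in> Poly_Mapping.keys c"
    have cmul: "chain_restrict p A (frag_cmul k d) = frag_cmul k (chain_restrict p A d)" for k d
      by (simp add: chain_restrict_def frag_extend_cmul)
    have of_: "chain_restrict p' A (frag_of \<rho>) = (if \<rho> ` standard_simplex p' \<subseteq> A then frag_of \<rho> else 0)" for \<rho> p'
      by (simp add: chain_restrict_def)
    have face: "singular_face (Suc p) k \<sigma> ` standard_simplex p \<subseteq> A \<longleftrightarrow> \<sigma> ` standard_simplex (Suc p) \<subseteq> A"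
      if "k \<le> Suc p" for k
      using assms[OF \<sigma>] singular_face_image[OF that, of \<sigma>] nonempty_standard_simplex[of p] by blast
    show "(chain_boundary (Suc p) \<circ> chain_restrict (Suc p) A) (frag_of \<sigma>) =
        (chain_restrict p A \<circ> chain_boundary (Suc p)) (frag_of \<sigma>)"
      by (auto simp: of_ chain_boundary_of Modules.additive.sum[OF additive_chain_restrict] cmul face
          Modules.additive.zero[OF additive_chain_restrict] simp del: sum.atMost_Suc)
  qed
  then show ?thesis by simp
qed

text \<open>Induction on the number of pieces: on the last piece the resolution splits off the
  translates of \<open>A n\<close>, and the obstruction to cutting it there is null-homotopic.\<close>

lemma augmentation_of_resolution_on_cover:
  fixes \<tau> :: "'a \<Rightarrow> 'a" and A :: "nat \<Rightarrow> 'a set" and X :: "'a topology" and q :: nat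
  defines "U \<equiv> \<lambda>n. {x \<in> topspace X. \<exists>i<n. \<exists>j<q. (\<tau> ^^ j) x \<in> A i}"
  assumes \<tau>: "continuous_map X X \<tau>" and \<tau>q: "\<And>x. x \<in> topspace X \<Longrightarrow> (\<tau> ^^ q) x = x" and q: "2 \<le> q"
    and A: "\<And>i. i < n \<Longrightarrow> openin X (A i)"
    and disj: "\<And>i j x. i < n \<Longrightarrow> x \<in> A i \<Longrightarrow> 0 < j \<Longrightarrow> j < q \<Longrightarrow> (\<tau> ^^ j) x \<notin> A i"
    and y: "\<And>p. p \<le> Suc n \<Longrightarrow> singular_chain p (subtopology X (U n)) (y p)"
    and By: "\<And>p. p \<le> n \<Longrightarrow> chain_boundary (Suc p) (y (Suc p)) = resolution_op q (chain_map p \<tau>) (Suc p) (y p)"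
  shows "int q dvd augmentation (y 0)"
  using A disj y By
proof (induction n arbitrary: y)
  case 0
  have "y 0 = 0"
    using "0.prems"(3)[of 0] by (simp add: U_def singular_chain_empty)
  then show ?case
    by (simp add: Modules.additive.zero[OF additive_augmentation])
next
  case (Suc n)
  have \<tau>X: "(\<tau> ^^ j) x \<in> topspace X" if "x \<in> topspace X" for j x
    using that \<tau> by (induction j) (auto simp: continuous_map_def)
  have \<tau>j: "continuous_map X X (\<tau> ^^ j)" for j
    by (induction j) (auto simp: id_def[symmetric] intro: continuous_map_compose[OF _ \<tau>, unfolded o_def])
  \<comment> \<open>The preimages of \<open>A n\<close> under the powers of \<open>\<tau>\<close>.
    For \<open>j < q\<close> they are disjoint by \<open>disj\<close>, and \<open>\<tau>\<close>
    lowers their index by one modulo \<open>q\<close>.\<close>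
  define sat where "sat j = {x \<in> topspace X. (\<tau> ^^ j) x \<in> A n}" for j
  have \<tau>U: "\<tau> x \<in> U i" if x: "x \<in> U i" for x i
  proof -
    obtain l j where lj: "l < i" "j < q" "(\<tau> ^^ j) x \<in> A l" and xX: "x \<in> topspace X"
      using x by (auto simp: U_def)
    have "(\<tau> ^^ (if j = 0 then q - 1 else j - 1)) (\<tau> x) = (\<tau> ^^ j) x"
      using \<tau>q[OF xX] q funpow_pred[of q \<tau> x] funpow_pred[of j \<tau> x] by auto
    then show ?thesis
      unfolding U_def using lj \<tau>X[OF xX, of 1] q
      by (intro CollectI conjI exI[of _ l] exI[of _ "if j = 0 then q - 1 else j - 1"]) auto
  qed
  have \<tau>sat: "\<tau> ` sat j \<subseteq> sat (if j = 0 then q - 1 else j - 1)" for j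
  proof
    fix z assume "z \<in> \<tau> ` sat j"
    then obtain x where x: "x \<in> topspace X" "(\<tau> ^^ j) x \<in> A n" "z = \<tau> x" by (auto simp: sat_def)
    have "(\<tau> ^^ (if j = 0 then q - 1 else j - 1)) (\<tau> x) = (\<tau> ^^ j) x"
      using \<tau>q[OF x(1)] q funpow_pred[of q \<tau> x] funpow_pred[of j \<tau> x] by auto
    then show "z \<in> sat (if j = 0 then q - 1 else j - 1)"
      using x \<tau>X[OF x(1), of 1] by (simp add: sat_def)
  qed
  have Usat: "U (Suc n) = U n \<union> (\<Union>j<q. sat j)"
    by (auto simp: U_def sat_def less_Suc_eq)
  have satdisj: "sat j \<inter> sat 0 = {}" if "0 < j" "j < q" for j
    using Suc.prems(2)[of n _ j] that by (auto simp: sat_def)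
  have opensat: "openin X (sat j)" for j
    unfolding sat_def using Suc.prems(1)[of n] by (intro openin_continuous_map_preimage[OF \<tau>j]) auto
  have "U n = (\<Union>i<n. \<Union>j<q. {x \<in> topspace X. (\<tau> ^^ j) x \<in> A i})"
    by (auto simp: U_def)
  moreover have "openin X (\<Union>i<n. \<Union>j<q. {x \<in> topspace X. (\<tau> ^^ j) x \<in> A i})"
    using Suc.prems(1) by (intro openin_Union ballI) (auto intro!: openin_Union openin_continuous_map_preimage[OF \<tau>j])
  ultimately have openU: "openin X (U n)" by simp
  \<comment> \<open>An open cover of \<open>U (Suc n)\<close>; subdivision makes every simplex lie
    in \<open>U n\<close> or in a single translate.\<close>
  define C where "C = insert (U n) (sat ` {..<q})"
  let ?Y = "subtopology X (U (Suc n))"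
  have "openin ?Y V" if "V \<in> C" for V
  proof -
    have "openin X V" "V \<subseteq> U (Suc n)"
      using that opensat openU Usat by (auto simp: C_def)
    then show ?thesis by (metis inf.absorb1 openin_subtopology)
  qed
  moreover have "topspace ?Y \<subseteq> \<Union>C"
    using Usat by (auto simp: C_def)
  ultimately have "\<exists>N. p \<le> Suc (Suc n) \<longrightarrow> (\<forall>m\<ge>N. \<forall>\<sigma>\<in>Poly_Mapping.keys ((singular_subdivision p ^^ m) (y p)).
      \<exists>V\<in>C. \<sigma> \<in> standard_simplex p \<rightarrow> V)" for p
    using sufficient_iterated_singular_subdivision_exists[of C ?Y p "y p"] Suc.prems(3)[of p] by metis
  then obtain N where N: "\<And>p m \<sigma>. p \<le> Suc (Suc n) \<Longrightarrow> N p \<le> m \<Longrightarrow>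
      \<sigma> \<in> Poly_Mapping.keys ((singular_subdivision p ^^ m) (y p)) \<Longrightarrow> \<exists>V\<in>C. \<sigma> \<in> standard_simplex p \<rightarrow> V"
    by metis
  \<comment> \<open>One number of subdivisions for all degrees that occur, so that the subdivided
    chains again satisfy the resolution equations.\<close>
  define m where "m = Max (N ` {..Suc (Suc n)})"
  have mN: "N p \<le> m" if "p \<le> Suc (Suc n)" for p
    using that by (auto simp: m_def)
  define z where "z p = (singular_subdivision p ^^ m) (y p)" for p
  have yX: "singular_chain p X (y p)" if "p \<le> Suc (Suc n)" for p
    using Suc.prems(3)[OF that] by (simp add: singular_chain_subtopology)
  have zfine: "fine_chain X C p (z p)" if "p \<le> Suc (Suc n)" for p
    unfolding fine_chain_def z_def
    using iterated_subdivision_chain[OF yX[OF that]] N[OF that mN[OF that]]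
    by (fastforce simp: image_subset_iff_funcset)
  define R where "R p = resolution_op q (chain_map p \<tau>) (Suc p)" for p
  have addR: "Modules.additive (R p)" for p
    unfolding R_def by (rule additive_resolution_op[OF additive_chain_map])
  have Bz: "chain_boundary (Suc p) (z (Suc p)) = R p (z p)" if "p \<le> Suc n" for p
    using that by (simp add: z_def R_def chain_boundary_iterated_subdivision[OF yX] Suc.prems(4)
        iterated_subdivision_resolution_op[OF yX \<tau>])
  have z0: "z 0 = y 0"
    unfolding z_def by (rule iterated_subdivision_0[OF yX]) simp
  \<comment> \<open>A simplex of \<open>z\<close> that is not in \<open>U n\<close> lies in one
    translate of \<open>A n\<close>. So \<open>b\<close> is supported in \<open>U n\<close> and the
    remainder \<open>a\<close> in the translates.\<close>
  define b where "b p = chain_restrict p (U n) (z p)" for p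
  define a where "a p = z p - b p" for p
  let ?S = "sat ` {..<q}" and ?US = "(\<lambda>j. U n \<inter> sat j) ` {..<q}"
  have bfine: "fine_chain X {U n} p (b p)" if "p \<le> Suc (Suc n)" for p
    using zfine[OF that] keys_chain_restrict[of p "U n" "z p"]
    by (auto simp: fine_chain_def b_def singular_chain_def)
  have afine: "fine_chain X ?S p (a p)" if "p \<le> Suc (Suc n)" for p
    using zfine[OF that] keys_diff_chain_restrict[of "z p" p "U n"]
    unfolding fine_chain_def a_def b_def singular_chain_def C_def by fastforce
  have invU: "\<exists>W\<in>{U n}. \<tau> ` (V \<inter> topspace X) \<subseteq> W" if "V \<in> {U n}" for V
    using that \<tau>U by auto
  have invS: "\<exists>W\<in>?S. \<tau> ` (V \<inter> topspace X) \<subseteq> W" if V: "V \<in> ?S" for V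
  proof -
    obtain j where j: "j < q" "V = sat j" using V by auto
    show ?thesis
      using \<tau>sat[of j] j by (intro bexI[of _ "sat (if j = 0 then q - 1 else j - 1)"]) (auto split: if_splits)
  qed
  have invUS: "\<exists>W\<in>?US. \<tau> ` (V \<inter> topspace X) \<subseteq> W" if V: "V \<in> ?US" for V
  proof -
    obtain j where j: "j < q" "V = U n \<inter> sat j" using V by auto
    show ?thesis
      using \<tau>sat[of j] \<tau>U j by (intro bexI[of _ "U n \<inter> sat (if j = 0 then q - 1 else j - 1)"]) (auto split: if_splits)
  qed
  have fineUS: "fine_chain X ?US p c \<longleftrightarrow> fine_chain X {U n} p c \<and> fine_chain X ?S p c" for p c
    by (simp add: fine_chain_def image_subset_iff) blast
  \<comment> \<open>The defect of \<open>a\<close> in the resolution equations. As \<open>z\<close>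
    has no defect, it is minus the defect of \<open>b\<close>; being supported in \<open>U n\<close>
    and in the translates, it lives on their intersections.\<close>
  define e where "e p = chain_boundary (Suc p) (a (Suc p)) - R p (a p)" for p
  have e2: "e p = - (chain_boundary (Suc p) (b (Suc p)) - R p (b p))" if "p \<le> Suc n" for p
    using Bz[OF that] by (simp add: e_def a_def chain_boundary_diff Modules.additive.diff[OF addR])
  have efine: "fine_chain X ?US p (e p)" if "p \<le> Suc n" for p
    unfolding fineUS
  proof
    show "fine_chain X {U n} p (e p)"
      unfolding e2[OF that] R_def using that
      by (intro fine_chain_minus fine_chain_diff fine_chain_boundary bfine
          fine_chain_resolution_op[OF _ \<tau> invU]) auto
    show "fine_chain X ?S p (e p)"
      unfolding e_def R_def using that
      by (intro fine_chain_diff fine_chain_boundary afine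
          fine_chain_resolution_op[OF _ \<tau> invS]) auto
  qed
  \<comment> \<open>The square of the boundary vanishes, and so does the product of consecutive
    cyclic operators; what remains is the hypothesis on \<open>e\<close> in the contraction
    lemma.\<close>
  have Be: "chain_boundary (Suc p) (e (Suc p)) = - resolution_op q (chain_map p \<tau>) (Suc (Suc p)) (e p)"
    if "p < Suc n" for p
  proof -
    have aX: "singular_chain (Suc (Suc p)) X (a (Suc (Suc p)))" "singular_chain (Suc p) X (a (Suc p))"
      "singular_chain p X (a p)"
      using afine that by (auto simp: fine_chain_def)
    let ?R = "resolution_op q (chain_map p \<tau>) (Suc (Suc p))"
    have addR': "Modules.additive ?R"
      by (rule additive_resolution_op[OF additive_chain_map])
    have "chain_boundary (Suc p) (e (Suc p)) = - ?R (chain_boundary (Suc p) (a (Suc p)))"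
      using chain_boundary_boundary_alt[OF aX(1)]
      by (simp add: e_def R_def chain_boundary_diff chain_boundary_resolution_op[OF aX(2) \<tau>])
    also have "chain_boundary (Suc p) (a (Suc p)) = e p + R p (a p)"
      by (simp add: e_def)
    also have "?R (e p + R p (a p)) = ?R (e p)"
      unfolding R_def Modules.additive.add[OF addR']
      using resolution_op_resolution_op[OF additive_chain_map funpow_chain_map_periodic[OF aX(3) \<tau>q]]
      by simp
    finally show ?thesis .
  qed
  let ?P = "\<lambda>p. chain_restrict p (sat 0)"
  have BP: "chain_boundary (Suc p) (?P (Suc p) c) = ?P p (chain_boundary (Suc p) c)"
    if fc: "fine_chain X ?S (Suc p) c" for p c
  proof (rule chain_boundary_restrict)
    fix \<sigma> assume "\<sigma> \<in> Poly_Mapping.keys c"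
    then obtain j where "j < q" "\<sigma> ` standard_simplex (Suc p) \<subseteq> sat j"
      using fc by (auto simp: fine_chain_def)
    then show "\<sigma> ` standard_simplex (Suc p) \<subseteq> sat 0 \<or> \<sigma> ` standard_simplex (Suc p) \<inter> sat 0 = {}"
      using satdisj[of j] by (cases "j = 0") auto
  qed
  let ?T = "\<lambda>p. chain_map p \<tau>"
  have split: "(\<Sum>j<q. (?T p ^^ j) (?P p ((?T p ^^ (q - j)) c))) = c"
    if c: "fine_chain X ?S p c" for p c
  proof -
    have "(\<lambda>c. \<Sum>j<q. (?T p ^^ j) (?P p ((?T p ^^ (q - j)) c))) c = id c"
    proof (rule additive_eq_on_frag[where c = c])
      show "Modules.additive (\<lambda>c. \<Sum>j<q. (?T p ^^ j) (?P p ((?T p ^^ (q - j)) c)))"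
        by (simp add: Modules.additive_def Modules.additive.add[OF additive_funpow[OF additive_chain_map]]
            Modules.additive.add[OF additive_chain_restrict] sum.distrib)
      show "Modules.additive (id :: 'a chain \<Rightarrow> _)" by (simp add: Modules.additive_def)
      fix \<sigma> assume "\<sigma> \<in> Poly_Mapping.keys c"
      then obtain l where l: "l < q" "\<sigma> ` standard_simplex p \<subseteq> sat l" and \<sigma>: "singular_simplex p X \<sigma>"
        using c by (simp add: fine_chain_def singular_chain_def) blast
      \<comment> \<open>Exactly one power of \<open>\<tau>\<close> up to multiples of
        \<open>q\<close>, namely the \<open>l\<close>-th, carries \<open>\<sigma>\<close> into
        \<open>sat 0\<close>; \<open>j0\<close> is the index below \<open>q\<close> for which
        \<open>q - j0\<close> is congruent to \<open>l\<close> modulo \<open>q\<close>. For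
        \<open>l = 0\<close> the full turn takes its place.\<close>
      define j0 where "j0 = (if l = 0 then 0 else q - l)"
      have \<sigma>l: "\<sigma> x \<in> topspace X" "(\<tau> ^^ l) (\<sigma> x) \<in> A n" if "x \<in> standard_simplex p" for x
        using l(2) that by (auto simp: sat_def)
      have "(simplex_map p \<tau> ^^ (q - j)) \<sigma> ` standard_simplex p \<subseteq> sat 0 \<longleftrightarrow> j = j0" if j: "j < q" for j
      proof
        assume "j = j0"
        then have "(\<tau> ^^ (q - j)) (\<sigma> x) \<in> sat 0" if "x \<in> standard_simplex p" for x
          using \<sigma>l[OF that] l(1) \<tau>X \<tau>q by (auto simp: j0_def sat_def)
        then show "(simplex_map p \<tau> ^^ (q - j)) \<sigma> ` standard_simplex p \<subseteq> sat 0"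
          by (auto simp: funpow_simplex_map)
      next
        assume sub: "(simplex_map p \<tau> ^^ (q - j)) \<sigma> ` standard_simplex p \<subseteq> sat 0"
        obtain x where x: "x \<in> standard_simplex p"
          using nonempty_standard_simplex by blast
        then have x1: "(\<tau> ^^ (q - j)) (\<sigma> x) \<in> A n"
          using sub by (auto simp: funpow_simplex_map sat_def)
        note x2 = \<sigma>l[OF x]
        show "j = j0"
        proof (rule ccontr)
          assume "j \<noteq> j0"
          then have "q - j < l \<or> (l < q - j \<and> q - j - l < q)"
            using j l(1) by (cases "l = 0") (simp_all add: j0_def, linarith+)
          then consider "q - j < l" | "l < q - j" "q - j - l < q" by blast
          then show False
          proof cases
            case 1
            have "(\<tau> ^^ (l - (q - j))) ((\<tau> ^^ (q - j)) (\<sigma> x)) = (\<tau> ^^ l) (\<sigma> x)"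
              using 1 by (simp flip: funpow_add[THEN fun_cong, unfolded o_def])
            then show False
              using Suc.prems(2)[OF lessI x1, of "l - (q - j)"] x2 1 l(1)
              by (simp add: less_imp_diff_less)
          next
            case 2
            have "(\<tau> ^^ (q - j - l)) ((\<tau> ^^ l) (\<sigma> x)) = (\<tau> ^^ (q - j)) (\<sigma> x)"
              using 2 by (simp flip: funpow_add[THEN fun_cong, unfolded o_def])
            then show False
              using Suc.prems(2)[OF lessI x2(2), of "q - j - l"] x1 2
              by (simp add: less_diff_conv add.commute)
          qed
        qed
      qed
      then have "(\<Sum>j<q. (?T p ^^ j) (?P p ((?T p ^^ (q - j)) (frag_of \<sigma>)))) =
          (\<Sum>j<q. if j = j0 then (?T p ^^ j) ((?T p ^^ (q - j)) (frag_of \<sigma>)) else 0)"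
        by (intro sum.cong) (auto simp: funpow_chain_map_of chain_restrict_def
            Modules.additive.zero[OF additive_funpow[OF additive_chain_map]])
      also have "\<dots> = (?T p ^^ q) (frag_of \<sigma>)"
        using l(1) by (simp add: j0_def flip: funpow_add[THEN fun_cong, unfolded o_def])
      also have "\<dots> = frag_of \<sigma>"
        using funpow_simplex_map_periodic[OF \<sigma> \<tau>q] by (simp add: funpow_chain_map_of)
      finally show "(\<Sum>j<q. (?T p ^^ j) (?P p ((?T p ^^ (q - j)) (frag_of \<sigma>)))) = id (frag_of \<sigma>)"
        by simp
    qed
    then show ?thesis by simp
  qed
  have "\<exists>k. (\<forall>p\<le>Suc n. k p \<in> Collect (fine_chain X ?US p)) \<and>
    (\<forall>p<Suc n. chain_boundary (Suc p) (k (Suc p)) = resolution_op q (?T p) (Suc p) (k p) - e p)"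
  proof (rule contraction_of_split_resolution[of ?T chain_boundary ?P "\<lambda>p. Collect (fine_chain X ?US p)" q "Suc n" e])
    show "(chain_map p \<tau> ^^ q) x = x" if "x \<in> Collect (fine_chain X ?US p)" for p x
      using that funpow_chain_map_periodic[OF _ \<tau>q] by (auto simp: fine_chain_def)
    show "chain_boundary (Suc p) (chain_map (Suc p) \<tau> x) = chain_map p \<tau> (chain_boundary (Suc p) x)"
      if "x \<in> Collect (fine_chain X ?US (Suc p))" for p x
      using that chain_boundary_chain_map[of "Suc p" X x \<tau>] by (auto simp: fine_chain_def)
    show "chain_map p \<tau> x \<in> Collect (fine_chain X ?US p)" if "x \<in> Collect (fine_chain X ?US p)" for p x
      using that fine_chain_map[OF _ \<tau> invUS] by simp
    show "?P p x \<in> Collect (fine_chain X ?US p)" if "x \<in> Collect (fine_chain X ?US p)" for p x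
      using that fine_chain_restrict by simp
    show "chain_boundary (Suc p) (?P (Suc p) x) = ?P p (chain_boundary (Suc p) x)"
      if "x \<in> Collect (fine_chain X ?US (Suc p))" for p x
      using that BP by (simp add: fineUS)
    show "(\<Sum>j<q. (?T p ^^ j) (?P p ((?T p ^^ (q - j)) x))) = x"
      if "x \<in> Collect (fine_chain X ?US p)" for p x
      using that split by (simp add: fineUS)
  qed (simp_all add: q efine Be additive_chain_map additive_chain_boundary
      additive_chain_restrict fine_chain_add)
  then obtain k where k: "\<And>p. p \<le> Suc n \<Longrightarrow> k p \<in> Collect (fine_chain X ?US p)"
    and Bk: "\<And>p. p < Suc n \<Longrightarrow> chain_boundary (Suc p) (k (Suc p)) = resolution_op q (?T p) (Suc p) (k p) - e p"
    by blast
  have kfine: "fine_chain X {U n} p (k p)" "fine_chain X ?S p (k p)" if "p \<le> Suc n" for p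
    using k[OF that] fineUS by auto
  \<comment> \<open>Moving \<open>k\<close> from \<open>b\<close> to \<open>a\<close> cancels the
    defect on both sides. The equations for \<open>k\<close> reach one degree less far than those
    for \<open>y\<close>, so each piece costs one degree; this is why \<open>n\<close> pieces
    require chains up to degree \<open>n + 1\<close>.\<close>
  define b' where "b' p = b p - k p" for p
  define a' where "a' p = a p + k p" for p
  have "int q dvd augmentation (b' 0)"
  proof (rule Suc.IH)
    show "singular_chain p (subtopology X (U n)) (b' p)" if "p \<le> Suc n" for p
      unfolding b'_def fine_chain_singleton[symmetric] using bfine[of p] kfine[of p] that
      by (simp add: fine_chain_diff)
    show "chain_boundary (Suc p) (b' (Suc p)) = resolution_op q (chain_map p \<tau>) (Suc p) (b' p)" if "p \<le> n" for p
    proof -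
      have "chain_boundary (Suc p) (b (Suc p)) = R p (b p) - e p"
        using e2[of p] that by simp
      then show ?thesis
        using Bk[of p] that
        by (simp add: b'_def R_def[symmetric] chain_boundary_diff Modules.additive.diff[OF addR])
    qed
  qed (use Suc.prems in auto)
  moreover have "int q dvd augmentation (a' 0)"
  proof -
    have a'fine: "fine_chain X ?S 0 (a' 0)" "fine_chain X ?S (Suc 0) (a' (Suc 0))"
      unfolding a'_def using afine kfine by (auto intro!: fine_chain_add)
    have "chain_boundary (Suc 0) (a' (Suc 0)) = R 0 (a' 0)"
      using Bk[of 0] by (simp add: a'_def e_def R_def[symmetric] chain_boundary_add Modules.additive.add[OF addR])
    then have Ba': "chain_boundary (Suc 0) (a' (Suc 0)) = ?T 0 (a' 0) - a' 0"
      by (simp add: R_def resolution_op_def)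
    \<comment> \<open>The difference of consecutive translates of \<open>a' 0\<close> is a boundary,
      and it remains one after restriction to \<open>sat 0\<close>. So all \<open>q\<close> summands
      of the splitting of \<open>a' 0\<close> have the same augmentation.\<close>
    have "augmentation (?P 0 ((?T 0 ^^ i) (a' 0))) = augmentation (?P 0 (a' 0))" for i
    proof (induction i)
      case (Suc i)
      let ?c = "(?T (Suc 0) ^^ i) (a' (Suc 0))"
      have "fine_chain X ?S (Suc 0) ?c"
        by (induction i) (auto intro: a'fine fine_chain_map[OF _ \<tau> invS])
      then have "0 = augmentation (?P 0 (chain_boundary (Suc 0) ?c))"
        using augmentation_chain_boundary[of "?P (Suc 0) ?c"] by (simp add: BP)
      also have "chain_boundary (Suc 0) ?c = (?T 0 ^^ i) (?T 0 (a' 0)) - (?T 0 ^^ i) (a' 0)"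
        using a'fine by (simp add: chain_boundary_funpow_chain_map[OF _ \<tau>] fine_chain_def Ba'
            Modules.additive.diff[OF additive_funpow[OF additive_chain_map]])
      finally show ?case
        using Suc by (simp add: funpow_swap1 Modules.additive.diff[OF additive_augmentation]
            Modules.additive.diff[OF additive_chain_restrict])
    qed simp
    moreover have "augmentation ((?T 0 ^^ i) c) = augmentation c" for i c
      by (induction i) auto
    ultimately have "augmentation (\<Sum>j<q. (?T 0 ^^ j) (?P 0 ((?T 0 ^^ (q - j)) (a' 0)))) =
        int q * augmentation (?P 0 (a' 0))"
      by (simp add: Modules.additive.sum[OF additive_augmentation])
    then show ?thesis
      using split[OF a'fine(1)] by simp
  qed
  moreover have "y 0 = a' 0 + b' 0"
    by (simp add: a'_def b'_def a_def z0)
  ultimately show ?case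
    by (simp add: Modules.additive.add[OF additive_augmentation])
qed

section \<open>Roots of unity and sectors of the plane\<close>

lemma zeta_power: "zeta q ^ j = cis (2 * pi * real j / real q)"
  by (simp add: zeta_def Complex.DeMoivre mult_ac)

lemma zeta_power_self [simp]: "0 < q \<Longrightarrow> zeta q ^ q = 1"
  by (simp add: zeta_power)

lemma norm_zeta [simp]: "norm (zeta q) = 1"
  by (simp add: zeta_def)

lemma zeta_cnj_power: "zeta q ^ j * cnj (zeta q ^ j) = 1"
  by (metis complex_norm_square norm_zeta norm_power power_one of_real_1)

lemma zeta_power_mod:
  assumes "0 < q" shows "zeta q ^ (j mod q) = zeta q ^ j"
proof -
  have "zeta q ^ j = zeta q ^ (q * (j div q) + j mod q)" by simp
  then show ?thesis
    unfolding power_add power_mult using assms by simp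
qed

lemma polar_mod_zeta:
  assumes "w \<noteq> 0" "0 < q"
  obtains l \<phi> where "l < q" "0 \<le> \<phi>" "\<phi> < 2 * pi / q" "w = rcis (norm w) \<phi> * zeta q ^ l"
proof -
  define \<psi> where "\<psi> = Arg2pi w"
  have \<psi>: "0 \<le> \<psi>" "\<psi> < 2 * pi" "w = rcis (norm w) \<psi>"
    using Arg2pi[of w] by (auto simp: \<psi>_def rcis_def cis_conv_exp is_Arg_def)
  define l where "l = nat \<lfloor>real q * \<psi> / (2 * pi)\<rfloor>"
  have l: "real l \<le> real q * \<psi> / (2 * pi)" "real q * \<psi> / (2 * pi) < real l + 1"
    using \<psi>(1) by (simp_all add: l_def)
  have "real q * \<psi> / (2 * pi) < real q"
    using \<psi>(2) assms(2) by (simp add: field_simps)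
  then have "l < q" using l(1) by linarith
  moreover have "w = rcis (norm w) (\<psi> - 2 * pi * l / q) * zeta q ^ l"
    using \<psi>(3) by (simp add: zeta_power rcis_def cis_mult mult.assoc)
  moreover have \<delta>: "\<psi> - 2 * pi * l / q = (2 * pi / q) * (real q * \<psi> / (2 * pi) - l)"
    using assms(2) by (simp add: field_simps)
  moreover have "(2 * pi / q) * (real q * \<psi> / (2 * pi) - l) < (2 * pi / q) * 1"
    using l assms(2) by (intro mult_strict_left_mono) auto
  moreover have "0 \<le> (2 * pi / q) * (real q * \<psi> / (2 * pi) - l)"
    using l by (intro mult_nonneg_nonneg) auto
  ultimately show ?thesis
    by (intro that[of l "\<psi> - 2 * pi * l / q"]) (simp_all only: mult_1_right)
qed

text \<open>The interior of a fundamental domain for rotation by \<open>zeta q\<close>. The origin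
  is excluded since \<open>Arg2pi 0 = 0\<close>.\<close>

definition open_sector :: "nat \<Rightarrow> complex set" where
  "open_sector q = {w. 0 < Arg2pi w} \<inter> {w. Arg2pi w < 2 * pi / real q}"

lemma open_open_sector: "2 \<le> q \<Longrightarrow> open (open_sector q)"
  unfolding open_sector_def by (rule open_Arg2pi2pi_less_Int) (simp_all add: field_simps)

lemma Arg2pi_rcis:
  assumes "0 < r" "0 \<le> \<psi>" "\<psi> < 2 * pi" shows "Arg2pi (rcis r \<psi>) = \<psi>"
  using assms by (intro Arg2pi_unique[of r]) (auto simp: rcis_def cis_conv_exp)

lemma open_sector_polar:
  assumes "w \<in> open_sector q"
  obtains r \<psi> where "0 < r" "0 < \<psi>" "\<psi> < 2 * pi / real q" "w = rcis r \<psi>"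
proof
  have "w \<noteq> 0" using assms by (auto simp: open_sector_def)
  then show "0 < norm w" by simp
  show "w = rcis (norm w) (Arg2pi w)"
    using Arg2pi[of w] by (auto simp: rcis_def cis_conv_exp is_Arg_def)
qed (use assms in \<open>auto simp: open_sector_def\<close>)

lemma open_sector_rotate_disjoint:
  assumes "w \<in> open_sector q" "0 < j" "j < q"
  shows "zeta q ^ j * w \<notin> open_sector q"
proof
  assume *: "zeta q ^ j * w \<in> open_sector q"
  obtain r \<psi> where r: "0 < r" "0 < \<psi>" "\<psi> < 2 * pi / real q" "w = rcis r \<psi>"
    using open_sector_polar[OF assms(1)] .
  have q: "0 < real q" using assms by simp
  have "2 * pi * real j / real q + 2 * pi / real q = 2 * pi * real (Suc j) / real q"
    by (simp add: add_divide_distrib algebra_simps)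
  also have "\<dots> \<le> 2 * pi * real q / real q"
    using assms by (intro divide_right_mono mult_left_mono) auto
  finally have b: "\<psi> + 2 * pi * real j / real q < 2 * pi"
    using r(3) q by simp
  have "zeta q ^ j * w = rcis r (\<psi> + 2 * pi * real j / real q)"
    by (simp add: r(4) zeta_power rcis_def cis_mult add.commute)
  then have "Arg2pi (zeta q ^ j * w) = \<psi> + 2 * pi * real j / real q"
    using r b q by (simp add: Arg2pi_rcis)
  moreover have "2 * pi / real q \<le> 2 * pi * real j / real q"
    using assms by (intro divide_right_mono) auto
  ultimately show False
    using * r by (simp add: open_sector_def)
qed

lemma rcis_in_open_sector:
  assumes "0 < r" "0 < \<psi>" "\<psi> < 2 * pi / real q" "1 \<le> q"
  shows "rcis r \<psi> \<in> open_sector q"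
proof -
  have "2 * pi / real q \<le> 2 * pi"
    using assms(4) by (simp add: field_simps)
  then show ?thesis
    using assms by (simp add: open_sector_def Arg2pi_rcis)
qed

text \<open>The rotated copies of the open sector miss, besides the origin, only the rays through
  the roots of unity; copies turned by half the angle cover those. Hence two open sets for each
  complex function.\<close>

lemma open_sectors_cover:
  assumes "w \<noteq> 0" "1 \<le> q"
  shows "\<exists>j<q. zeta q ^ j * w \<in> open_sector q \<or> cis (- (pi / real q)) * (zeta q ^ j * w) \<in> open_sector q"
proof -
  obtain l \<phi> where l: "l < q" "0 \<le> \<phi>" "\<phi> < 2 * pi / q" "w = rcis (norm w) \<phi> * zeta q ^ l"
    using polar_mod_zeta[of w q] assms by auto
  have zl: "zeta q ^ (q - l) * zeta q ^ l = 1"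
    using l(1) assms by (simp flip: power_add)
  have rot: "zeta q ^ (q - l) * w = rcis (norm w) \<phi>"
    using zl by (subst l(4)) (simp add: mult_ac)
  show ?thesis
  proof (cases "\<phi> = 0")
    case False
    then have "zeta q ^ (q - l) * w \<in> open_sector q"
      using assms l rot by (simp add: rcis_in_open_sector)
    then show ?thesis
      using assms by (intro exI[of _ "(q - l) mod q"]) (simp add: zeta_power_mod)
  next
    case True
    \<comment> \<open>One rotation more than in the other case puts the point on the ray of angle 2
      pi / q; turning back by pi / q moves it to the bisector of the sector.\<close>
    have "cis (- (pi / real q)) * (zeta q ^ Suc (q - l) * w) = rcis (norm w) (pi / real q)"
    proof -
      have "cis (- (pi / real q)) * (zeta q ^ Suc (q - l) * w) =
          (cis (- (pi / real q)) * zeta q) * (zeta q ^ (q - l) * w)"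
        by (simp add: mult_ac)
      also have "cis (- (pi / real q)) * zeta q = cis (pi / real q)"
        by (simp add: zeta_def cis_mult)
      finally show ?thesis
        unfolding rot True by (simp add: rcis_def)
    qed
    also have "\<dots> \<in> open_sector q"
      using assms by (intro rcis_in_open_sector) (auto simp: field_simps)
    finally show ?thesis
      using assms by (intro exI[of _ "Suc (q - l) mod q"]) (simp add: zeta_power_mod del: power_Suc)
  qed
qed

section \<open>Equivariant functions on odd spheres\<close>

text \<open>Degree 0 is a point and degree 1 a path from it to its image. Above that, the operator
  applied to \<open>y m\<close> gives a cycle, since consecutive operators compose to zero, and
  acyclicity provides \<open>y (Suc m)\<close>.\<close>

lemma resolution_exists:
  fixes \<tau> :: "'a \<Rightarrow> 'a"
  assumes \<tau>: "continuous_map X X \<tau>" and \<tau>q: "\<And>x. x \<in> topspace X \<Longrightarrow> (\<tau> ^^ q) x = x"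
    and g: "pathin X g" "g 1 = \<tau> (g 0)"
    and acyclic: "\<And>p c. 0 < p \<Longrightarrow> p < n \<Longrightarrow> singular_chain p X c \<Longrightarrow> chain_boundary p c = 0 \<Longrightarrow>
        \<exists>d. singular_chain (Suc p) X d \<and> chain_boundary (Suc p) d = c"
  shows "\<exists>y. (\<forall>p\<le>n. singular_chain p X (y p)) \<and> augmentation (y 0) = 1 \<and>
      (\<forall>p<n. chain_boundary (Suc p) (y (Suc p)) = resolution_op q (chain_map p \<tau>) (Suc p) (y p))"
proof -
  have "\<exists>y. (\<forall>p\<le>m. singular_chain p X (y p)) \<and> augmentation (y 0) = 1 \<and>
      (\<forall>p<m. chain_boundary (Suc p) (y (Suc p)) = resolution_op q (chain_map p \<tau>) (Suc p) (y p))"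
    if "m \<le> n" for m
    using that
  proof (induction m)
    case 0
    define \<sigma> where "\<sigma> = restrict (\<lambda>_. g 0) (standard_simplex 0)"
    have "g 0 \<in> topspace X"
      using g(1) by (auto simp: pathin_def continuous_map_def)
    then have "singular_simplex 0 X \<sigma>"
      by (simp add: \<sigma>_def singular_simplex_def)
    then show ?case
      by (intro exI[of _ "\<lambda>_. frag_of \<sigma>"]) (simp add: singular_chain_of)
  next
    case (Suc m)
    then obtain y where y: "\<And>p. p \<le> m \<Longrightarrow> singular_chain p X (y p)" "augmentation (y 0) = 1"
      and By: "\<And>p. p < m \<Longrightarrow> chain_boundary (Suc p) (y (Suc p)) = resolution_op q (chain_map p \<tau>) (Suc p) (y p)"
      by auto
    show ?case
    proof (cases m)
      case 0
      define \<sigma> where "\<sigma> z = restrict (\<lambda>_. g z) (standard_simplex 0)" for z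
      \<comment> \<open>The image of the path is path connected, so its two end points are
        homologous in it.\<close>
      let ?Z = "subtopology X (g ` {0..1})"
      have gX: "g ` {0..1} \<subseteq> topspace X"
        using g(1) by (auto simp: pathin_def continuous_map_def)
      have "path_connectedin X (g ` {0..1})"
        using g(1) by (simp add: path_connectedin_path_image)
      then have "path_connected_space ?Z"
        by (simp add: path_connectedin_def)
      moreover have \<sigma>: "singular_simplex 0 ?Z (\<sigma> z)" if "z \<in> {0..1}" for z
      proof -
        have "g z \<in> topspace X" using that gX by blast
        then show ?thesis using that by (simp add: \<sigma>_def singular_simplex_def)
      qed
      ultimately have "homologous_rel 0 ?Z {} (frag_of (\<sigma> 1)) (frag_of (\<sigma> 0))"
        by (intro iso_integer_zeroth_homology_group_aux) auto
      then obtain d where d: "singular_chain (Suc 0) ?Z d" "chain_boundary (Suc 0) d = frag_of (\<sigma> 1) - frag_of (\<sigma> 0)"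
        by (auto simp: homologous_rel_def singular_boundary)
      have \<sigma>1: "\<sigma> 1 = simplex_map 0 \<tau> (\<sigma> 0)"
        using g(2) by (auto simp: \<sigma>_def simplex_map_def)
      have "singular_simplex 0 X (\<sigma> 0)"
        using \<sigma>[of 0] by (simp add: singular_simplex_subtopology)
      moreover have "singular_chain (Suc 0) X d"
        using d(1) by (simp add: singular_chain_subtopology)
      ultimately show ?thesis
        unfolding 0 using d(2)
        by (intro exI[of _ "\<lambda>p. if p = 0 then frag_of (\<sigma> 0) else d"])
           (auto simp: \<sigma>1 singular_chain_of resolution_op_def le_Suc_eq)
    next
      case (Suc l)
      let ?R = "resolution_op q (chain_map m \<tau>) (Suc m)"
      have "chain_boundary m (?R (y m)) = 
          resolution_op q (chain_map l \<tau>) (Suc m) (chain_boundary m (y m))"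
        unfolding Suc using y(1)[of m] Suc by (intro chain_boundary_resolution_op[OF _ \<tau>]) auto
      also have "\<dots> = 0"
        using By[of l] Suc y(1)[of l]
          resolution_op_resolution_op[OF additive_chain_map funpow_chain_map_periodic[OF _ \<tau>q], of l X "y l" "Suc l"]
        by simp
      finally have "chain_boundary m (?R (y m)) = 0" .
      moreover have "singular_chain m X (?R (y m))"
        using fine_chain_resolution_op[of X "{topspace X}" m "y m" \<tau> q "Suc m"] y(1)[of m] \<tau>
        by (auto simp: fine_chain_singleton continuous_map_def)
      ultimately obtain d where d: "singular_chain (Suc m) X d" "chain_boundary (Suc m) d = ?R (y m)"
        using acyclic[of m] Suc Suc.prems by auto
      show ?thesis
        using y By d by (intro exI[of _ "y(Suc m := d)"]) (auto simp: le_Suc_eq less_Suc_eq)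
    qed
  qed
  then show ?thesis by blast
qed

section \<open>Acyclicity and complex coordinates of odd-dimensional spheres\<close>

lemma nsphere_cycle_bounds:
  assumes "0 < p" "p < n" "singular_chain p (nsphere n) c" "chain_boundary p c = 0"
  shows "\<exists>d. singular_chain (Suc p) (nsphere n) d \<and> chain_boundary (Suc p) d = c"
proof -
  let ?H = "homology_group (int p) (nsphere n)"
  have "trivial_group ?H"
    using assms trivial_reduced_homology_group_nsphere[of "int p" n] by (simp add: un_reduced_homology_group)
  then have "carrier ?H = {singular_relboundary_set p (nsphere n) {}}"
    by (simp add: trivial_group_def)
  moreover have "homologous_rel_set p (nsphere n) {} c \<in> carrier ?H"
    using assms by (auto simp: carrier_relative_homology_group singular_cycle)
  ultimately have "homologous_rel_set p (nsphere n) {} c = singular_relboundary_set p (nsphere n) {}"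
    by simp
  moreover have "c \<in> homologous_rel_set p (nsphere n) {} c"
    by simp
  ultimately show ?thesis
    by (auto simp: singular_boundary)
qed

text \<open>Points of \<open>nsphere n\<close> are real sequences. Pairing the entries
  \<open>2 * i\<close> and \<open>Suc (2 * i)\<close> identifies
  \<open>nsphere (Suc (2 * t))\<close> with the unit sphere of C^(t+1).\<close>

definition complex_coord :: "(nat \<Rightarrow> real) \<Rightarrow> nat \<Rightarrow> complex" where
  "complex_coord x i = Complex (x (2 * i)) (x (Suc (2 * i)))"

definition sphere_rot :: "nat \<Rightarrow> (nat \<Rightarrow> real) \<Rightarrow> nat \<Rightarrow> real" where
  "sphere_rot q x = (\<lambda>k. if even k then Re (zeta q * complex_coord x (k div 2))
     else Im (zeta q * complex_coord x (k div 2)))"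

lemma complex_coord_sphere_rot [simp]: "complex_coord (sphere_rot q x) i = zeta q * complex_coord x i"
  unfolding complex_coord_def[of "sphere_rot q x"] by (simp add: sphere_rot_def complex_eq_iff)

lemma complex_coord_eqI: "(\<And>i. complex_coord x i = complex_coord y i) \<Longrightarrow> x = y"
proof
  fix k assume *: "\<And>i. complex_coord x i = complex_coord y i"
  show "x k = y k"
    using *[of "k div 2"] by (cases "even k") (auto simp: complex_coord_def elim: evenE oddE)
qed

lemma complex_coord_funpow_sphere_rot [simp]:
  "complex_coord ((sphere_rot q ^^ j) x) i = zeta q ^ j * complex_coord x i"
  by (induction j) (simp_all add: mult_ac)

lemma sphere_rot_funpow_self: "0 < q \<Longrightarrow> (sphere_rot q ^^ q) x = x"
  by (rule complex_coord_eqI) simp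

lemma topspace_odd_nsphere:
  "x \<in> topspace (nsphere (Suc (2 * t))) \<longleftrightarrow>
     (\<Sum>i\<le>t. (norm (complex_coord x i))\<^sup>2) = 1 \<and> (\<forall>i>t. complex_coord x i = 0)"
proof -
  have "(\<Sum>i\<le>Suc (2 * t). (x i)\<^sup>2) = (\<Sum>i\<le>t. (norm (complex_coord x i))\<^sup>2)"
    by (induction t) (simp_all add: complex_coord_def cmod_power2 algebra_simps)
  moreover have "(\<forall>i>Suc (2 * t). x i = 0) \<longleftrightarrow> (\<forall>i>t. complex_coord x i = 0)"
  proof
    assume *: "\<forall>i>t. complex_coord x i = 0"
    show "\<forall>i>Suc (2 * t). x i = 0"
    proof (intro allI impI)
      fix k assume "Suc (2 * t) < k"
      then have "t < k div 2" by linarith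
      then have "complex_coord x (k div 2) = 0" using * by blast
      then show "x k = 0"
        by (cases "even k") (auto simp: complex_coord_def complex_eq_iff elim: evenE oddE)
    qed
  qed (auto simp: complex_coord_def complex_eq_iff)
  ultimately show ?thesis
    by (simp add: nsphere)
qed

lemma continuous_map_complex_coord: "continuous_map (nsphere n) euclidean (\<lambda>x. complex_coord x i)"
proof -
  have "continuous_map (nsphere n) euclidean ((\<lambda>r. c * complex_of_real r) \<circ> (\<lambda>x. x k))" for c k
    by (intro continuous_map_compose[OF continuous_map_nsphere_projection]) (auto intro!: continuous_intros)
  from continuous_map_add[OF this[of 1 "2 * i"] this[of \<i> "Suc (2 * i)"]]
  show ?thesis
    by (simp add: complex_coord_def Complex_eq o_def)
qed

lemma continuous_map_sphere_rot:
  "continuous_map (nsphere (Suc (2 * t))) (nsphere (Suc (2 * t))) (sphere_rot q)"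
proof -
  let ?X = "nsphere (Suc (2 * t))"
  have lin: "continuous_map ?X euclideanreal (\<lambda>x. a * x i + b * x j)" for a b :: real and i j
    by (intro continuous_intros continuous_map_nsphere_projection)
  have "continuous_map ?X euclideanreal (\<lambda>x. sphere_rot q x k)" for k
  proof (cases "even k")
    case True
    then show ?thesis
      using lin[of "Re (zeta q)" "2 * (k div 2)" "- Im (zeta q)" "Suc (2 * (k div 2))"]
      by (simp add: sphere_rot_def complex_coord_def)
  next
    case False
    then show ?thesis
      using lin[of "Re (zeta q)" "Suc (2 * (k div 2))" "Im (zeta q)" "2 * (k div 2)"]
      by (simp add: sphere_rot_def complex_coord_def)
  qed
  moreover have "sphere_rot q x \<in> topspace ?X" if "x \<in> topspace ?X" for x
    using that by (simp add: topspace_odd_nsphere norm_mult)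
  ultimately show ?thesis
    by (subst (2) nsphere) (auto simp: continuous_map_in_subtopology continuous_map_componentwise_UNIV nsphere)
qed

text \<open>A Borsuk-Ulam theorem for the cyclic group. The degrees match exactly: at most
  \<open>2 * t\<close> pieces call for chains up to degree \<open>2 * t + 1\<close>, the dimension
  up to which the sphere supplies a resolution. Its augmentation is 1, which \<open>q\<close> does
  not divide.\<close>

theorem common_zero_of_equivariant_functions:
  fixes h :: "'c \<Rightarrow> (nat \<Rightarrow> real) \<Rightarrow> complex"
  assumes "2 \<le> q" "finite I" "card I \<le> t"
    and h: "\<And>c. c \<in> I \<Longrightarrow> continuous_map (nsphere (Suc (2 * t))) euclidean (h c)"
    and equiv: "\<And>c x. c \<in> I \<Longrightarrow> x \<in> topspace (nsphere (Suc (2 * t))) \<Longrightarrow> h c (sphere_rot q x) = zeta q * h c x"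
  shows "\<exists>x\<in>topspace (nsphere (Suc (2 * t))). \<forall>c\<in>I. h c x = 0"
proof (rule ccontr)
  let ?X = "nsphere (Suc (2 * t))" and ?\<tau> = "sphere_rot q"
  assume no_zero: "\<not> ?thesis"
  note \<tau> = continuous_map_sphere_rot[of t q]
  have \<tau>q: "(?\<tau> ^^ q) x = x" for x
    using assms(1) by (simp add: sphere_rot_funpow_self)
  have \<tau>X: "(?\<tau> ^^ j) x \<in> topspace ?X" if "x \<in> topspace ?X" for j x
    using that \<tau> by (induction j) (auto simp: continuous_map_def)
  have hj: "h c ((?\<tau> ^^ j) x) = zeta q ^ j * h c x" if "c \<in> I" "x \<in> topspace ?X" for c j x
    by (induction j) (simp_all add: equiv[OF that(1) \<tau>X[OF that(2)]] mult_ac)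
  obtain f where f: "bij_betw f {..<card I} I"
    using ex_bij_betw_nat_finite[OF assms(2)] by (auto simp: lessThan_atLeast0)
  \<comment> \<open>Each function gives two pieces: even indices use the open sector itself, odd
    ones the sector turned by half its angle.\<close>
  define \<gamma> where "\<gamma> i = (if even i then 1 else cis (- (pi / real q)))" for i :: nat
  define A where "A i = {x \<in> topspace ?X. \<gamma> i * h (f (i div 2)) x \<in> open_sector q}" for i
  define n where "n = 2 * card I"
  have fI: "f (i div 2) \<in> I" if "i < n" for i
    using that f by (auto simp: n_def bij_betw_def)
  have A: "openin ?X (A i)" if "i < n" for i
    unfolding A_def
  proof (rule openin_continuous_map_preimage[where Y = euclidean])
    show "continuous_map ?X euclidean (\<lambda>x. \<gamma> i * h (f (i div 2)) x)"
      using continuous_map_compose[OF h[OF fI[OF that]], of euclidean "\<lambda>w. \<gamma> i * w"]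
      by (simp add: o_def continuous_intros)
    show "openin euclidean (open_sector q)"
      using open_open_sector[OF assms(1)] by simp
  qed
  have disj: "(?\<tau> ^^ j) x \<notin> A i" if "i < n" "x \<in> A i" "0 < j" "j < q" for i j x
    using open_sector_rotate_disjoint[of "\<gamma> i * h (f (i div 2)) x" q j] that
    by (simp add: A_def hj fI mult_ac)
  have cover: "{x \<in> topspace ?X. \<exists>i<n. \<exists>j<q. (?\<tau> ^^ j) x \<in> A i} = topspace ?X"
  proof (intro equalityI subsetI CollectI conjI)
    fix x assume x: "x \<in> topspace ?X"
    then obtain c where c: "c \<in> I" "h c x \<noteq> 0" using no_zero by blast
    moreover have "f ` {..<card I} = I" using f by (simp add: bij_betw_def)
    ultimately obtain l where l: "l < card I" "f l = c"
      by (metis imageE lessThan_iff)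
    from open_sectors_cover[OF c(2), of q] assms(1) obtain j where j: "j < q"
      "zeta q ^ j * h c x \<in> open_sector q \<or> cis (- (pi / real q)) * (zeta q ^ j * h c x) \<in> open_sector q"
      by auto
    then have "(?\<tau> ^^ j) x \<in> A (2 * l) \<or> (?\<tau> ^^ j) x \<in> A (Suc (2 * l))"
      using x \<tau>X hj[OF c(1) x] l by (auto simp: A_def \<gamma>_def)
    moreover have "2 * l < n" "Suc (2 * l) < n" using l by (auto simp: n_def)
    ultimately show "\<exists>i<n. \<exists>j<q. (?\<tau> ^^ j) x \<in> A i" using j(1) by blast
  qed auto
  \<comment> \<open>The arc from 1 to \<open>zeta q\<close> in the first complex coordinate, which
    joins a point to its image under the rotation.\<close>
  define g where "g s = (\<lambda>k::nat. if k = 0 then cos (2 * pi * s / real q)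
      else if k = 1 then sin (2 * pi * s / real q) else 0)" for s :: real
  have cg: "complex_coord (g s) i = (if i = 0 then cis (2 * pi * s / real q) else 0)" for s i
    by (auto simp: g_def complex_coord_def complex_eq_iff)
  have "g s \<in> topspace ?X" for s
    by (simp add: topspace_odd_nsphere cg if_distrib[of norm] if_distrib[of "\<lambda>x. x\<^sup>2"] cong: if_cong)
  moreover have "continuous_map (top_of_set {0..1}) euclideanreal (\<lambda>s. g s k)" for k
    using assms(1) by (cases "k = 0"; cases "k = 1") (auto simp: g_def intro!: continuous_intros)
  ultimately have g: "pathin ?X g"
    unfolding pathin_def
    by (subst nsphere) (auto simp: continuous_map_in_subtopology continuous_map_componentwise_UNIV nsphere)
  have g1: "g 1 = ?\<tau> (g 0)"
    by (rule complex_coord_eqI) (simp add: cg zeta_def)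
  have "\<exists>y. (\<forall>p\<le>Suc (2 * t). singular_chain p ?X (y p)) \<and> augmentation (y 0) = 1 \<and>
      (\<forall>p<Suc (2 * t). chain_boundary (Suc p) (y (Suc p)) = resolution_op q (chain_map p ?\<tau>) (Suc p) (y p))"
    using nsphere_cycle_bounds by (rule resolution_exists[OF \<tau> \<tau>q g g1])
  then obtain y where
    y: "\<And>p. p \<le> Suc (2 * t) \<Longrightarrow> singular_chain p ?X (y p)" "augmentation (y 0) = 1"
    "\<And>p. p < Suc (2 * t) \<Longrightarrow> chain_boundary (Suc p) (y (Suc p)) = resolution_op q (chain_map p ?\<tau>) (Suc p) (y p)"
    by blast
  have "int q dvd augmentation (y 0)"
  proof (rule augmentation_of_resolution_on_cover[OF \<tau> \<tau>q assms(1) A disj])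
    show "singular_chain p (subtopology ?X {x \<in> topspace ?X. \<exists>i<n. \<exists>j<q. (?\<tau> ^^ j) x \<in> A i}) (y p)"
      if "p \<le> Suc n" for p
      unfolding cover using y(1)[of p] that assms(3) by (simp add: n_def)
    show "chain_boundary (Suc p) (y (Suc p)) = resolution_op q (chain_map p ?\<tau>) (Suc p) (y p)"
      if "p \<le> n" for p
      using y(3)[of p] that assms(3) by (simp add: n_def)
  qed
  then show False
    using y(2) assms(1) by simp
qed

section \<open>Sections of Stiefel bundles\<close>

lemma norm_vector_smult [simp]: "norm (c *s (x :: complex^'n)) = norm c * norm x"
  by (simp add: norm_vec_def L2_set_right_distrib norm_mult)

text \<open>Only finitely many values occur among the powers. In the continuity proof for lifted
  frames, this turns closeness of two points of one orbit into equality.\<close>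

lemma zeta_powers_isolated:
  obtains \<delta> where "0 < \<delta>" "\<And>j. norm (zeta q ^ j - 1) < \<delta> \<Longrightarrow> 0 < q \<Longrightarrow> zeta q ^ j = 1"
proof -
  let ?Z = "insert 1 ((\<lambda>j. norm (zeta q ^ j - 1)) ` {j. j < q \<and> zeta q ^ j \<noteq> 1})"
  show ?thesis
  proof (rule that[of "Min ?Z"])
    show "0 < Min ?Z" by (subst Min_gr_iff) auto
    fix j assume j: "norm (zeta q ^ j - 1) < Min ?Z" and "0 < q"
    show "zeta q ^ j = 1"
    proof (rule ccontr)
      assume "zeta q ^ j \<noteq> 1"
      then have "norm (zeta q ^ (j mod q) - 1) \<in> ?Z"
        using \<open>0 < q\<close> by (auto simp: zeta_power_mod intro!: image_eqI[of _ _ "j mod q"])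
      then have "Min ?Z \<le> norm (zeta q ^ (j mod q) - 1)"
        by (intro Min_le) auto
      with j show False unfolding zeta_power_mod[OF \<open>0 < q\<close>] by linarith
    qed
  qed
qed

lemma orbit_funpow:
  assumes "(f ^^ q) x = x" "0 < q"
  shows "Defs.orbit f ((f ^^ j) x) = Defs.orbit f x"
proof -
  have mod: "(f ^^ (i mod q)) x = (f ^^ i) x" for i
    using assms(1) by (rule funpow_mod_eq)
  show ?thesis
  proof
    show "Defs.orbit f ((f ^^ j) x) \<subseteq> Defs.orbit f x"
      by (auto simp: Defs.orbit_def simp flip: funpow_add[THEN fun_cong, unfolded o_def])
    show "Defs.orbit f x \<subseteq> Defs.orbit f ((f ^^ j) x)"
    proof
      fix y assume "y \<in> Defs.orbit f x"
      then obtain i where i: "y = (f ^^ i) x" by (auto simp: Defs.orbit_def)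
      \<comment> \<open>A further \<open>j * (q - 1)\<close> steps complete the \<open>j\<close>
        steps to \<open>j\<close> full turns, which act trivially.\<close>
      have "(i + j * (q - 1) + j) mod q = (i + j * q) mod q"
        using assms(2) by (cases q) (simp_all add: algebra_simps)
      then have "(f ^^ (i + j * (q - 1))) ((f ^^ j) x) = y"
        using mod[of "i + j * (q - 1) + j"] mod[of "i + j * q"] mod[of i] i
        by (simp flip: funpow_add[THEN fun_cong, unfolded o_def])
      then show "y \<in> Defs.orbit f ((f ^^ j) x)"
        unfolding Defs.orbit_def by (auto intro!: exI[of _ "i + j * (q - 1)"])
    qed
  qed
qed

lemma mem_orbit: "x \<in> Defs.orbit f x"
  by (auto simp: Defs.orbit_def intro: exI[of _ 0])

lemma topspace_orbit_space: "topspace (orbit_space X g) = Defs.orbit g ` topspace X"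
  using quotient_imp_surjective_map[OF quotient_map_orbit_space] by metis

lemma smult_funpow: "((\<lambda>x. c *s x) ^^ j) (x :: complex^'n) = c ^ j *s x"
  by (induction j) simp_all

lemma frame_rot_funpow:
  assumes "i \<in> {1..k}"
  shows "(frame_rot q r k ^^ j) v i = (if i = 1 then zeta q ^ j *s v i else zeta q ^ (r * j) *s v i)"
  using assms
  by (cases "i = 1"; induction j) (auto simp: frame_rot_def power_add vector_smult_assoc)

lemma frame_rot_funpow_extensional:
  assumes "v \<in> extensional {1..k}" shows "(frame_rot q r k ^^ j) v \<in> extensional {1..k}"
  using assms by (cases j) (auto simp: frame_rot_def)

lemma frame_rot_funpow_eqI:
  assumes "v \<in> extensional {1..k}" "zeta q ^ a = zeta q ^ b"
  shows "(frame_rot q r k ^^ a) v = (frame_rot q r k ^^ b) v"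
proof (rule extensionalityI[of _ "{1..k}"])
  fix i assume "i \<in> {1..k}"
  moreover have "zeta q ^ (r * a) = zeta q ^ (r * b)"
    using assms(2) by (metis mult.commute power_mult)
  ultimately show "(frame_rot q r k ^^ a) v i = (frame_rot q r k ^^ b) v i"
    using assms(2) by (simp only: frame_rot_funpow)
qed (use assms frame_rot_funpow_extensional in auto)

lemma continuous_map_frame_coord:
  "i \<in> {1..k} \<Longrightarrow> continuous_map (frame_topology k V) euclidean (\<lambda>v. v i)"
  unfolding frame_topology_def
  by (intro continuous_map_from_subtopology continuous_map_product_projection)

lemma topspace_frame_topology: "V \<subseteq> {1..k} \<rightarrow>\<^sub>E UNIV \<Longrightarrow> topspace (frame_topology k V) = V"
  by (auto simp: frame_topology_def)

lemma continuous_on_smult [continuous_intros]: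
  "continuous_on S f \<Longrightarrow> continuous_on S (\<lambda>x. c *s (f x :: complex^'n))"
  unfolding vector_scalar_mult_def by (intro continuous_intros) auto

lemma continuous_map_frame_rot_funpow:
  fixes V :: "(nat \<Rightarrow> complex^'t) set"
  assumes "i \<in> {1..k}"
  shows "continuous_map (frame_topology k V) euclidean (\<lambda>v. (frame_rot q r k ^^ j) v i)"
proof -
  define c where "c = (if i = 1 then zeta q ^ j else zeta q ^ (r * j))"
  have "continuous_map (frame_topology k V) euclidean ((\<lambda>x. c *s x) \<circ> (\<lambda>v. v i))"
    by (rule continuous_map_compose[OF continuous_map_frame_coord[OF assms]])
       (simp add: continuous_on_smult)
  moreover have "(\<lambda>v :: nat \<Rightarrow> complex^'t. (frame_rot q r k ^^ j) v i) = (\<lambda>x. c *s x) \<circ> (\<lambda>v. v i)"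
    using frame_rot_funpow[OF assms] by (auto simp: c_def fun_eq_iff)
  ultimately show ?thesis by simp
qed

text \<open>The set \<open>V\<close> of frames need not be invariant under \<open>frame_rot q r k\<close>: for real frames and
  \<open>r > 1\<close> the rotated first vector may fail to be orthogonal to the other ones.  Hence only some
  rotation of the lifted frame lies in \<open>V\<close>.\<close>

lemma equivariant_frame_of_section:
  fixes V :: "(nat \<Rightarrow> complex^'t) set"
  assumes sec: "admits_section q r k V" and k: "1 \<le> k" and q: "2 \<le> q"
    and V: "V \<subseteq> {1..k} \<rightarrow>\<^sub>E UNIV"
  obtains s where "\<And>x. norm x = 1 \<Longrightarrow> s x 1 = x"
    "\<And>x j. norm x = 1 \<Longrightarrow> s (zeta q ^ j *s x) = (frame_rot q r k ^^ j) (s x)"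
    "\<And>x. norm x = 1 \<Longrightarrow> \<exists>j. s (zeta q ^ j *s x) \<in> V"
    "\<And>i. i \<in> {1..k} \<Longrightarrow> continuous_on (sphere 0 1) (\<lambda>x. s x i)"
proof -
  let ?S = "top_of_set (sphere 0 1 :: (complex^'t) set)" and ?F = "frame_topology k V"
  let ?g = "\<lambda>x :: complex^'t. zeta q *s x" and ?G = "frame_rot q r k"
  let ?E = "extensional {1..k} :: (nat \<Rightarrow> complex^'t) set"
  obtain \<sigma> where \<sigma>: "continuous_map (lens_space q) (orbit_space ?F ?G) \<sigma>"
    and sec1: "\<And>y. y \<in> topspace (lens_space q) \<Longrightarrow> (\<lambda>v. v 1) ` \<sigma> y = y"
    using sec unfolding admits_section_def by metis
  have lens: "topspace (lens_space q) = Defs.orbit ?g ` sphere 0 1"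
    by (simp add: lens_space_def topspace_orbit_space)
  have gq: "(?g ^^ q) x = x" for x
    using q by (simp add: smult_funpow)
  have Vext: "v \<in> ?E" if "v \<in> V" for v
    using V that by (auto simp: PiE_def)
  note F = topspace_frame_topology[OF V]
  have Gq: "(?G ^^ q) v = v" if "v \<in> ?E" for v
    using frame_rot_funpow_eqI[OF that, of q q 0] q by simp
  have GE: "(?G ^^ j) v \<in> ?E" if "v \<in> ?E" for v j
    using that by (rule frame_rot_funpow_extensional)
  have G1: "(?G ^^ j) v 1 = zeta q ^ j *s v 1" for v j
    using frame_rot_funpow[where i = 1 and k = k and q = q and r = r and j = j and v = v] k by simp
  have orbG: "Defs.orbit ?G ((?G ^^ j) v) = Defs.orbit ?G v" if "v \<in> ?E" for v j
    using orbit_funpow[OF Gq[OF that]] q by simp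
  have \<sigma>_orbit: "\<exists>v0\<in>V. \<sigma> (Defs.orbit ?g x) = Defs.orbit ?G v0" if "norm x = 1" for x
  proof -
    have "\<sigma> (Defs.orbit ?g x) \<in> topspace (orbit_space ?F ?G)"
      using \<sigma> that by (auto simp: continuous_map_def lens)
    then show ?thesis
      by (auto simp: topspace_orbit_space F)
  qed
  have ex: "\<exists>v\<in>?E. \<sigma> (Defs.orbit ?g x) = Defs.orbit ?G v \<and> v 1 = x" if x: "norm x = 1" for x
  proof -
    obtain v0 where v0: "v0 \<in> V" "\<sigma> (Defs.orbit ?g x) = Defs.orbit ?G v0"
      using \<sigma>_orbit[OF x] by blast
    have "Defs.orbit ?g x \<in> topspace (lens_space q)"
      using x by (simp add: lens)
    then have "x \<in> (\<lambda>v. v 1) ` Defs.orbit ?G v0"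
      using sec1 v0(2) mem_orbit[of x ?g] by metis
    then obtain j where "x = (?G ^^ j) v0 1" by (auto simp: Defs.orbit_def)
    then show ?thesis
      using v0 orbG[OF Vext[OF v0(1)]] GE[OF Vext[OF v0(1)]] by (intro bexI[of _ "(?G ^^ j) v0"]) auto
  qed
  \<comment> \<open>The choice is canonical: by \<open>uniq\<close> below, an orbit contains just
    one frame with first vector \<open>x\<close>, because the rotation acts freely on unit
    vectors.\<close>
  define s where "s x = (SOME v. v \<in> ?E \<and> \<sigma> (Defs.orbit ?g x) = Defs.orbit ?G v \<and> v 1 = x)" for x
  have s: "s x \<in> ?E" "\<sigma> (Defs.orbit ?g x) = Defs.orbit ?G (s x)" "s x 1 = x" if "norm x = 1" for x
    using someI_ex[of "\<lambda>v. v \<in> ?E \<and> \<sigma> (Defs.orbit ?g x) = Defs.orbit ?G v \<and> v 1 = x"] ex[OF that]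
    unfolding s_def by blast+
  have uniq: "u = s x" if x: "norm x = 1" and u: "u \<in> Defs.orbit ?G (s x)" "u 1 = x" for u x
  proof -
    obtain j where j: "u = (?G ^^ j) (s x)" using u(1) by (auto simp: Defs.orbit_def)
    then have "zeta q ^ j *s x = x"
      using G1[of j "s x"] s(3)[OF x] u(2) by simp
    then have "(zeta q ^ j - 1) *s x = 0"
      by (simp add: vec_eq_iff algebra_simps)
    then have "norm ((zeta q ^ j - 1) *s x) = 0"
      by (simp only: norm_zero)
    then have "norm (zeta q ^ j - 1) = 0"
      by (simp only: norm_vector_smult x mult_1_right)
    then have "zeta q ^ j = zeta q ^ 0"
      by simp
    then show ?thesis
      using frame_rot_funpow_eqI[OF s(1)[OF x], of q j 0] j by simp
  qed
  have equiv: "s (zeta q ^ j *s x) = (?G ^^ j) (s x)" if x: "norm x = 1" for x j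
  proof -
    have gx: "norm (zeta q ^ j *s x) = 1" using x by (simp add: norm_power)
    have "Defs.orbit ?g (zeta q ^ j *s x) = Defs.orbit ?g x"
      using orbit_funpow[OF gq, where x = x and j = j] q by (simp add: smult_funpow)
    then have "Defs.orbit ?G (s (zeta q ^ j *s x)) = Defs.orbit ?G (s x)"
      using s(2)[OF gx] s(2)[OF x] by metis
    then have "(?G ^^ j) (s x) \<in> Defs.orbit ?G (s (zeta q ^ j *s x))"
      by (auto simp: Defs.orbit_def)
    then show ?thesis
      using uniq[OF gx] G1 s(3)[OF x] by metis
  qed
  have inV: "\<exists>j. s (zeta q ^ j *s x) \<in> V" if x: "norm x = 1" for x
  proof -
    obtain v0 where v0: "v0 \<in> V" "\<sigma> (Defs.orbit ?g x) = Defs.orbit ?G v0"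
      using \<sigma>_orbit[OF x] by blast
    then have "v0 \<in> Defs.orbit ?G (s x)"
      using s(2)[OF x] mem_orbit by metis
    then obtain j where "v0 = (?G ^^ j) (s x)" by (auto simp: Defs.orbit_def)
    then show ?thesis
      using v0(1) equiv[OF x] by metis
  qed
  have cont: "continuous_on (sphere 0 1) (\<lambda>x. s x i)" if i: "i \<in> {1..k}" for i
    unfolding continuous_on_topological
  proof (intro ballI allI impI)
    fix x W assume "x \<in> sphere 0 1" and W: "open W" "s x i \<in> W"
    then have x: "norm x = 1" by simp
    obtain \<delta> where \<delta>: "0 < \<delta>" "\<And>j. norm (zeta q ^ j - 1) < \<delta> \<Longrightarrow> 0 < q \<Longrightarrow> zeta q ^ j = 1"
      using zeta_powers_isolated[of q] by blast
    \<comment> \<open>Frames that after \<open>j\<close> rotations have their \<open>i\<close>-th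
      vector in \<open>W\<close> and their first vector near \<open>x\<close>. The union over all
      \<open>j\<close> is saturated, so it descends to an open set of orbits.\<close>
    define U where "U j = {v \<in> V. (?G ^^ j) v i \<in> W} \<inter> {v \<in> V. (?G ^^ j) v 1 \<in> ball x (\<delta> / 2)}" for j
    have "openin ?F {v \<in> topspace ?F. (?G ^^ j) v i \<in> W}"
      "openin ?F {v \<in> topspace ?F. (?G ^^ j) v 1 \<in> ball x (\<delta> / 2)}" for j
      using i k W(1)
      by (auto intro!: openin_continuous_map_preimage[OF continuous_map_frame_rot_funpow] simp del: mem_ball)
    then have U: "openin ?F (\<Union>j. U j)"
      unfolding U_def F by (intro openin_Union) auto
    define O' where "O' = Defs.orbit ?G ` (\<Union>j. U j)"
    have UV: "U j \<subseteq> V" for j by (auto simp: U_def)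
    have "{v \<in> topspace ?F. Defs.orbit ?G v \<in> O'} = (\<Union>j. U j)"
    proof (intro equalityI subsetI)
      fix v assume "v \<in> {v \<in> topspace ?F. Defs.orbit ?G v \<in> O'}"
      then obtain u j where u: "v \<in> V" "u \<in> U j" "Defs.orbit ?G v = Defs.orbit ?G u"
        by (auto simp: F O'_def)
      then have "(?G ^^ j) u \<in> Defs.orbit ?G v" by (auto simp: Defs.orbit_def)
      then obtain l where "(?G ^^ j) u = (?G ^^ l) v" by (auto simp: Defs.orbit_def)
      then have "v \<in> U l" using u by (simp add: U_def)
      then show "v \<in> (\<Union>j. U j)" by blast
    qed (use UV in \<open>auto simp: F O'_def\<close>)
    then have "openin (orbit_space ?F ?G) O'"
      unfolding openin_orbit_space using U openin_subset[OF U] by (auto simp: O'_def)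
    then have "openin (lens_space q) {y \<in> topspace (lens_space q). \<sigma> y \<in> O'}"
      by (rule openin_continuous_map_preimage[OF \<sigma>])
    then have "openin ?S {x \<in> sphere 0 1. Defs.orbit ?g x \<in> {y \<in> topspace (lens_space q). \<sigma> y \<in> O'}}"
      unfolding lens_space_def openin_orbit_space by simp
    moreover have "{x \<in> sphere 0 1. Defs.orbit ?g x \<in> {y \<in> topspace (lens_space q). \<sigma> y \<in> O'}} =
        {x \<in> sphere 0 1. \<sigma> (Defs.orbit ?g x) \<in> O'}"
      unfolding lens by blast
    ultimately obtain A where A: "open A" "{x \<in> sphere 0 1. \<sigma> (Defs.orbit ?g x) \<in> O'} = sphere 0 1 \<inter> A"
      unfolding openin_open by metis
    show "\<exists>A. open A \<and> x \<in> A \<and> (\<forall>y\<in>sphere 0 1. y \<in> A \<longrightarrow> s y i \<in> W)"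
    proof (intro exI[of _ "A \<inter> ball x (\<delta> / 2)"] conjI ballI impI)
      show "open (A \<inter> ball x (\<delta> / 2))" using A(1) by auto
      obtain v0 where v0: "v0 \<in> V" "\<sigma> (Defs.orbit ?g x) = Defs.orbit ?G v0"
        using \<sigma>_orbit[OF x] by blast
      then have "s x \<in> Defs.orbit ?G v0"
        using s(2)[OF x] mem_orbit by metis
      then obtain j where "s x = (?G ^^ j) v0" by (auto simp: Defs.orbit_def)
      then have "v0 \<in> U j"
        using v0(1) W(2) \<delta>(1) s(3)[OF x] by (simp add: U_def)
      then have "\<sigma> (Defs.orbit ?g x) \<in> O'"
        unfolding v0(2) O'_def by blast
      then show "x \<in> A \<inter> ball x (\<delta> / 2)"
        using A(2) x \<delta>(1) by auto
      fix y assume y: "y \<in> sphere 0 1" "y \<in> A \<inter> ball x (\<delta> / 2)"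
      then have y1: "norm y = 1" by simp
      have "\<sigma> (Defs.orbit ?g y) \<in> O'"
        using A(2) y by blast
      then obtain v l where u: "v \<in> U l" "Defs.orbit ?G (s y) = Defs.orbit ?G v"
        using s(2)[OF y1] by (auto simp: O'_def)
      then have "(?G ^^ l) v \<in> Defs.orbit ?G (s y)" by (auto simp: Defs.orbit_def)
      then obtain j where j: "(?G ^^ l) v = (?G ^^ j) (s y)" by (auto simp: Defs.orbit_def)
      \<comment> \<open>Both \<open>y\<close> and its rotation are within
        \<open>\<delta> / 2\<close> of \<open>x\<close>, so the rotation factor is within
        \<open>\<delta>\<close> of 1 and must equal 1. Hence the frame in \<open>W\<close> is
        \<open>s y\<close> itself and not another member of its orbit.\<close>
      have "zeta q ^ j *s y \<in> ball x (\<delta> / 2)"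
        using u(1) G1[of j "s y"] s(3)[OF y1] by (auto simp: U_def j)
      then have "dist (zeta q ^ j *s y) y < \<delta>"
        using y(2) dist_triangle_half_r[of x "zeta q ^ j *s y" \<delta> y] by simp
      moreover have "zeta q ^ j *s y - y = (zeta q ^ j - 1) *s y"
        by (simp add: vec_eq_iff algebra_simps)
      ultimately have "norm ((zeta q ^ j - 1) *s y) < \<delta>"
        by (simp only: dist_norm)
      then have "norm (zeta q ^ j - 1) < \<delta>"
        by (simp only: norm_vector_smult y1)
      then have "zeta q ^ j = zeta q ^ 0"
        using \<delta>(2)[of j] q by simp
      then have "(?G ^^ l) v = s y"
        using frame_rot_funpow_eqI[OF s(1)[OF y1], of q j 0] j by simp
      then show "s y i \<in> W"
        using u(1) by (auto simp: U_def)
    qed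
  qed
  show ?thesis
    by (rule that[of s]) (use s(3) equiv inV cont in auto)
qed

section \<open>Orthonormal frames and attainment of the maximal frame length\<close>

lemma card_orthonormal_le:
  fixes v :: "nat \<Rightarrow> 'a::euclidean_space"
  assumes "finite I" "\<And>i j. i \<in> I \<Longrightarrow> j \<in> I \<Longrightarrow> v i \<bullet> v j = (if i = j then 1 else 0)"
  shows "card I \<le> DIM('a)" "inj_on v I" "independent (v ` I)"
proof -
  show inj: "inj_on v I"
  proof (rule inj_onI)
    fix i j assume *: "i \<in> I" "j \<in> I" "v i = v j"
    then have "v i \<bullet> v j = 1" using assms(2)[of i i] by simp
    then show "i = j" using assms(2)[of i j] * by (auto split: if_splits)
  qed
  show ind: "independent (v ` I)"
  proof (rule pairwise_orthogonal_independent)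
    show "pairwise orthogonal (v ` I)"
      using assms(2) by (auto simp: pairwise_def orthogonal_def split: if_splits)
    show "0 \<notin> v ` I"
      using assms(2) by (metis imageE inner_zero_left zero_neq_one)
  qed
  show "card I \<le> DIM('a)"
    using independent_bound[OF ind] card_image[OF inj] by simp
qed

lemma Re_hermitian: "Re (hermitian x y) = x \<bullet> y"
  by (simp add: hermitian_def inner_vec_def inner_complex_def)

lemma stiefel_complex_subset_real: "stiefel_complex k \<subseteq> stiefel_real k"
proof
  fix v :: "nat \<Rightarrow> complex^'t" assume v: "v \<in> stiefel_complex k"
  then have "v i \<bullet> v j = (if i = j then 1 else 0)" if "i \<in> {1..k}" "j \<in> {1..k}" for i j
    using that Re_hermitian[of "v i" "v j"] by (auto simp: stiefel_complex_def)
  with v show "v \<in> stiefel_real k"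
    by (auto simp: stiefel_real_def stiefel_complex_def)
qed

lemma hermitian_self: "hermitian x x = of_real ((norm x)\<^sup>2)"
proof -
  have "hermitian x x = (\<Sum>i\<in>UNIV. of_real ((norm (x $ i))\<^sup>2))"
    unfolding hermitian_def
    by (intro sum.cong refl) (metis complex_norm_square of_real_power)
  then show ?thesis
    by (simp add: norm_vec_def L2_set_def sum_nonneg real_sqrt_pow2)
qed

lemma orbit_eq_range: "Defs.orbit f x = range (\<lambda>j. (f ^^ j) x)"
  by (auto simp: Defs.orbit_def)

text \<open>The section is induced by the equivariant map from unit vectors to one-vector frames; it
  is continuous by the universal property of the quotient.\<close>

lemma admits_section_1:
  fixes V :: "(nat \<Rightarrow> complex^'t) set"
  assumes q: "2 \<le> q" and V: "V \<subseteq> {1..1} \<rightarrow>\<^sub>E UNIV"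
    and unit: "\<And>x. norm x = 1 \<Longrightarrow> (\<lambda>i\<in>{1..1}. x) \<in> V"
  shows "admits_section q r 1 V"
proof -
  let ?S = "top_of_set (sphere 0 1 :: (complex^'t) set)" and ?F = "frame_topology 1 V"
  let ?g = "\<lambda>x :: complex^'t. zeta q *s x" and ?G = "frame_rot q r 1"
  define e where "e x = (\<lambda>i\<in>{1..1::nat}. x)" for x :: "complex^'t"
  have e_rot: "e ((?g ^^ j) x) = (?G ^^ j) (e x)" for j x
  proof (rule extensionalityI[of _ "{1..1}"])
    fix i :: nat assume "i \<in> {1..1}"
    then show "e ((?g ^^ j) x) i = (?G ^^ j) (e x) i"
      using frame_rot_funpow[where k = 1 and i = 1 and q = q and r = r and j = j and v = "e x"]
      by (simp add: smult_funpow e_def)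
  next
    show "(?G ^^ j) (e x) \<in> extensional {1..1}"
      by (rule frame_rot_funpow_extensional) (simp add: e_def)
  qed (simp add: e_def)
  have e_orbit: "e ` Defs.orbit ?g x = Defs.orbit ?G (e x)" for x
    unfolding orbit_eq_range image_image e_rot ..
  have "continuous_map ?S ?F e"
    unfolding frame_topology_def continuous_map_in_subtopology
    using unit by (auto simp: continuous_map_componentwise e_def)
  then have "continuous_map ?S (orbit_space ?F ?G) (Defs.orbit ?G \<circ> e)"
    using quotient_imp_continuous_map[OF quotient_map_orbit_space] by (rule continuous_map_compose)
  moreover have "Defs.orbit ?G \<circ> e = (image e) \<circ> Defs.orbit ?g"
    using e_orbit by auto
  ultimately have "continuous_map (lens_space q) (orbit_space ?F ?G) (image e)"
    unfolding lens_space_def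
    using continuous_compose_quotient_map_eq[OF quotient_map_orbit_space] by metis
  moreover have "(\<lambda>v. v 1) ` (e ` y) = y" for y
    by (simp add: image_image e_def)
  ultimately show ?thesis
    unfolding admits_section_def by blast
qed

text \<open>The value 1 is always admissible, and a section for \<open>k\<close> exhibits a real
  orthonormal frame of \<open>k\<close> vectors, which bounds \<open>k\<close> by the real
  dimension. So the greatest value is attained. A general \<open>V\<close> serves the real and the
  Hermitian case.\<close>

lemma Greatest_section:
  fixes V :: "nat \<Rightarrow> (nat \<Rightarrow> complex^'t) set"
  assumes q: "2 \<le> q" and V: "\<And>k. V k \<subseteq> stiefel_real k"
    and unit: "\<And>x. norm x = 1 \<Longrightarrow> (\<lambda>i\<in>{1..1}. x) \<in> V 1"
  defines "K \<equiv> (GREATEST k. 1 \<le> k \<and> (\<exists>r. 1 \<le> r \<and> r < q \<and> coprime r q \<and> admits_section q r k (V k)))"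
  shows "1 \<le> K" "\<exists>r. 1 \<le> r \<and> r < q \<and> coprime r q \<and> admits_section q r K (V K)"
proof -
  let ?P = "\<lambda>k. 1 \<le> k \<and> (\<exists>r. 1 \<le> r \<and> r < q \<and> coprime r q \<and> admits_section q r k (V k))"
  have V_ext: "V k \<subseteq> {1..k} \<rightarrow>\<^sub>E UNIV" for k
    using V[of k] by (auto simp: stiefel_real_def)
  have "?P 1"
    using admits_section_1[OF q V_ext unit, of 1] q by (auto intro!: exI[of _ 1])
  moreover have "k \<le> DIM(complex^'t)" if P: "?P k" for k
  proof -
    obtain r where k: "1 \<le> k" and r: "admits_section q r k (V k)" using P by blast
    obtain x :: "complex^'t" where x: "norm x = 1" using vector_choose_size[of 1] by auto
    obtain s where "\<exists>j. s (zeta q ^ j *s x) \<in> V k"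
      using equivariant_frame_of_section[OF r k q V_ext] x by metis
    then obtain v where "v \<in> V k" by blast
    then show ?thesis
      using card_orthonormal_le(1)[of "{1..k}" v] V[of k] by (auto simp: stiefel_real_def)
  qed
  ultimately have "?P K"
    unfolding K_def by (intro GreatestI_nat[of ?P 1 "DIM(complex^'t)"]) auto
  then show "1 \<le> K" "\<exists>r. 1 \<le> r \<and> r < q \<and> coprime r q \<and> admits_section q r K (V K)" by auto
qed

lemma rho_real_attained:
  assumes "2 \<le> q"
  obtains r where "1 \<le> rho_real TYPE('t::finite) q" "1 \<le> r" "r < q" "coprime r q"
    "admits_section q r (rho_real TYPE('t) q) (stiefel_real (rho_real TYPE('t) q) :: (nat \<Rightarrow> complex^'t) set)"
proof -
  have "(\<lambda>i\<in>{1..1}. x) \<in> stiefel_real 1" if "norm x = 1" for x :: "complex^'t"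
    using that by (auto simp: stiefel_real_def norm_eq_1)
  from Greatest_section[OF assms order_refl this]
  have "1 \<le> rho_real TYPE('t) q" "\<exists>r. 1 \<le> r \<and> r < q \<and> coprime r q \<and>
      admits_section q r (rho_real TYPE('t) q) (stiefel_real (rho_real TYPE('t) q) :: (nat \<Rightarrow> complex^'t) set)"
    unfolding rho_real_def by simp_all
  then show ?thesis using that by blast
qed

lemma rho_complex_attained:
  assumes "2 \<le> q"
  obtains r where "1 \<le> rho_complex TYPE('t::finite) q" "1 \<le> r" "r < q" "coprime r q"
    "admits_section q r (rho_complex TYPE('t) q) (stiefel_complex (rho_complex TYPE('t) q) :: (nat \<Rightarrow> complex^'t) set)"
proof -
  have "(\<lambda>i\<in>{1..1}. x) \<in> stiefel_complex 1" if "norm x = 1" for x :: "complex^'t"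
    using that by (auto simp: stiefel_complex_def hermitian_self)
  from Greatest_section[OF assms stiefel_complex_subset_real this]
  have "1 \<le> rho_complex TYPE('t) q" "\<exists>r. 1 \<le> r \<and> r < q \<and> coprime r q \<and>
      admits_section q r (rho_complex TYPE('t) q) (stiefel_complex (rho_complex TYPE('t) q) :: (nat \<Rightarrow> complex^'t) set)"
    unfolding rho_complex_def by simp_all
  then show ?thesis using that by blast
qed

text \<open>The complex span of a maximal complex independent subset \<open>B\<close> is contained
  in the real span of \<open>B\<close> and its multiples by \<open>\<i>\<close>, hence has real
  dimension at most \<open>2 * card B\<close>; it contains \<open>k\<close> vectors that are
  independent over the reals.\<close>

lemma complex_independent_half:
  fixes v :: "nat \<Rightarrow> complex^'t"
  assumes orth: "\<And>i j. i < k \<Longrightarrow> j < k \<Longrightarrow> v i \<bullet> v j = (if i = j then 1 else 0)"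
  obtains J where "J \<subseteq> {..<k}" "k \<le> 2 * card J"
    "\<And>c. (\<Sum>j\<in>J. c j *s v j) = 0 \<Longrightarrow> \<forall>j\<in>J. c j = 0"
proof -
  note on = card_orthonormal_le[of "{..<k}" v]
  have inj: "inj_on v {..<k}" and ind: "independent (v ` {..<k})"
    using on(2,3) orth by auto
  obtain B where B: "B \<subseteq> v ` {..<k}" "vec.independent B" "v ` {..<k} \<subseteq> vec.span B"
    using vec.maximal_independent_subset[of "v ` {..<k}"] by blast
  have finB: "finite B" using B(1) finite_surj by blast
  define J where "J = {j. j < k \<and> v j \<in> B}"
  have J: "J \<subseteq> {..<k}" "v ` J = B" using B(1) by (auto simp: J_def)
  have cardJ: "card B = card J"
    using card_image[OF inj_on_subset[OF inj J(1)]] J(2) by simp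
  have "vec.span B \<subseteq> span (B \<union> (\<lambda>x. \<i> *s x) ` B)"
  proof
    fix x assume "x \<in> vec.span B"
    then obtain u where u: "x = (\<Sum>b\<in>B. u b *s b)"
      using vec.span_finite[OF finB] by auto
    have "u b *s b \<in> span (B \<union> (\<lambda>x. \<i> *s x) ` B)" if "b \<in> B" for b
    proof -
      have eq: "u b *s b = Re (u b) *\<^sub>R b + Im (u b) *\<^sub>R (\<i> *s b)"
        by (simp add: vec_eq_iff complex_eq_iff algebra_simps)
      show ?thesis
        unfolding eq by (intro span_add span_scale span_base) (use that in auto)
    qed
    then show "x \<in> span (B \<union> (\<lambda>x. \<i> *s x) ` B)"
      unfolding u by (intro span_sum)
  qed
  then have "v ` {..<k} \<subseteq> span (B \<union> (\<lambda>x. \<i> *s x) ` B)" using B(3) by blast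
  then have "card (v ` {..<k}) \<le> card (B \<union> (\<lambda>x. \<i> *s x) ` B)"
    using independent_span_bound[of "B \<union> (\<lambda>x. \<i> *s x) ` B" "v ` {..<k}"] ind finB by auto
  also have "\<dots> \<le> card B + card ((\<lambda>x. \<i> *s x) ` B)" by (rule card_Un_le)
  also have "\<dots> \<le> 2 * card B" using card_image_le[OF finB] by (simp add: mult_2)
  finally have "k \<le> 2 * card J"
    using card_image[OF inj] cardJ by simp
  moreover have "\<forall>j\<in>J. c j = 0" if "(\<Sum>j\<in>J. c j *s v j) = 0" for c
  proof -
    have injJ: "inj_on v J" using inj_on_subset[OF inj J(1)] .
    have "(\<Sum>b\<in>B. c (the_inv_into J v b) *s b) = (\<Sum>j\<in>J. c j *s v j)"
      unfolding J(2)[symmetric] by (simp add: sum.reindex[OF injJ] the_inv_into_f_f[OF injJ])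
    with that have "\<forall>b\<in>B. c (the_inv_into J v b) = 0"
      using B(2) finB vec.independentD[OF B(2) finB order_refl, of "\<lambda>b. c (the_inv_into J v b)"] by metis
    then show ?thesis
      using J(2) the_inv_into_f_f[OF injJ] by (metis imageI)
  qed
  ultimately show ?thesis
    using that J(1) by blast
qed

section \<open>Regular fans from complex lines\<close>

text \<open>The set is a translate of the orthogonal complement of the plane spanned by
  \<open>u\<close> and \<open>v\<close>.\<close>

lemma codimension_two_affine:
  fixes u v :: "'a::euclidean_space"
  assumes "norm u = 1" "norm v = 1" "orthogonal u v"
  shows "affine {z. z \<bullet> u = \<alpha> \<and> z \<bullet> v = \<beta>}" "aff_dim {z. z \<bullet> u = \<alpha> \<and> z \<bullet> v = \<beta>} = int DIM('a) - 2"
proof -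
  let ?S = "{z. z \<bullet> u = 0 \<and> z \<bullet> v = 0}"
  have uv: "u \<bullet> u = 1" "v \<bullet> v = 1" "u \<bullet> v = 0" "v \<bullet> u = 0"
    using assms by (auto simp: norm_eq_1 orthogonal_def inner_commute)
  have S: "subspace ?S"
    by (auto simp: subspace_def inner_add_left)
  define w where "w = \<alpha> *\<^sub>R u + \<beta> *\<^sub>R v"
  have w: "w \<bullet> u = \<alpha>" "w \<bullet> v = \<beta>" by (simp_all add: w_def inner_add_left uv)
  have eq: "{z. z \<bullet> u = \<alpha> \<and> z \<bullet> v = \<beta>} = (+) w ` ?S"
  proof (intro equalityI subsetI)
    fix z assume "z \<in> {z. z \<bullet> u = \<alpha> \<and> z \<bullet> v = \<beta>}"
    then show "z \<in> (+) w ` ?S"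
      using w by (intro image_eqI[of _ _ "z - w"]) (auto simp: inner_diff_left)
  qed (auto simp: inner_add_left w)
  show "affine {z. z \<bullet> u = \<alpha> \<and> z \<bullet> v = \<beta>}"
    unfolding eq using S by (simp add: affine_translation[symmetric] subspace_imp_affine)
  have "u \<noteq> v" using uv by auto
  have "independent {u, v}"
  proof (rule pairwise_orthogonal_independent)
    show "pairwise orthogonal {u, v}"
      using assms(3) by (auto simp: pairwise_def orthogonal_commute)
    show "0 \<notin> {u, v}" using assms by auto
  qed
  then have "dim (span {u, v}) = 2"
    using \<open>u \<noteq> v\<close> by (simp add: dim_eq_card_independent)
  moreover have "{y \<in> UNIV. \<forall>x\<in>span {u, v}. orthogonal x y} = ?S"
  proof (intro equalityI subsetI)
    fix z assume "z \<in> ?S"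
    then have "orthogonal z u" "orthogonal z v" by (auto simp: orthogonal_def)
    then show "z \<in> {y \<in> UNIV. \<forall>x\<in>span {u, v}. orthogonal x y}"
      using orthogonal_to_span[of _ "{u, v}" z] by (auto simp: orthogonal_commute)
  next
    fix z assume z: "z \<in> {y \<in> UNIV. \<forall>x\<in>span {u, v}. orthogonal x y}"
    have "u \<in> span {u, v}" "v \<in> span {u, v}" by (auto intro: span_base)
    with z show "z \<in> ?S" by (auto simp: orthogonal_def inner_commute)
  qed
  ultimately have "dim ?S + 2 = DIM('a)"
    using dim_subspace_orthogonal_to_vectors[of "span {u, v}" "UNIV :: 'a set"]
    by (simp add: subspace_span)
  then show "aff_dim {z. z \<bullet> u = \<alpha> \<and> z \<bullet> v = \<beta>} = int DIM('a) - 2"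
    unfolding eq using aff_dim_subspace[OF S] by (simp add: aff_dim_translation_eq)
qed

text \<open>The angle between the \<open>l\<close>-th and the next root of unity as an intersection
  of two closed half planes, which is correct for \<open>3 \<le> q\<close> as the angle is below pi.
  In this form closedness and stability under limits are sign conditions.\<close>

definition cone_sector :: "nat \<Rightarrow> nat \<Rightarrow> complex set" where
  "cone_sector q l = {w. 0 \<le> Im (w * cnj (zeta q ^ l)) \<and> Im (w * cnj (zeta q ^ Suc l)) \<le> 0}"

lemma cone_sector_iff:
  assumes q: "3 \<le> q"
  shows "w \<in> cone_sector q l \<longleftrightarrow> (\<exists>s\<ge>0. \<exists>t\<ge>0. w = of_real s * zeta q ^ l + of_real t * zeta q ^ Suc l)"
proof -
  let ?\<theta> = "2 * pi / real q"
  have sin: "0 < sin ?\<theta>"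
    using q by (intro sin_gt_zero) (auto simp: field_simps)
  have zz: "zeta q ^ j * cnj (zeta q ^ j) = 1" for j
    by (metis complex_norm_square norm_zeta norm_power power_one of_real_1)
  have Im1: "Im (w * cnj (zeta q ^ Suc l)) = Im (w * cnj (zeta q ^ l)) * cos ?\<theta> - Re (w * cnj (zeta q ^ l)) * sin ?\<theta>" for w
  proof -
    have "w * cnj (zeta q ^ Suc l) = (w * cnj (zeta q ^ l)) * cnj (zeta q)" by simp
    then show ?thesis by (simp only: times_complex.simps) (simp add: zeta_def)
  qed
  show ?thesis
  proof
    assume w: "w \<in> cone_sector q l"
    \<comment> \<open>After rotation by the inverse of \<open>zeta q ^ l\<close> the point reads s +
      t * zeta; the imaginary part determines \<open>t\<close>, then the real part determines
      \<open>s\<close>.\<close>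
    define t where "t = Im (w * cnj (zeta q ^ l)) / sin ?\<theta>"
    define s where "s = Re (w * cnj (zeta q ^ l)) - t * cos ?\<theta>"
    have "0 \<le> t" using w sin by (simp add: t_def cone_sector_def)
    moreover have "s * sin ?\<theta> = - Im (w * cnj (zeta q ^ Suc l))"
      unfolding Im1 using sin by (simp add: s_def t_def field_simps)
    then have "0 \<le> s"
      using w sin by (metis (mono_tags, lifting) cone_sector_def mem_Collect_eq neg_0_le_iff_le zero_le_mult_iff not_less)
    moreover have "w * cnj (zeta q ^ l) = of_real s + of_real t * zeta q"
      using sin by (simp add: complex_eq_iff s_def t_def zeta_def)
    then have "w * cnj (zeta q ^ l) * zeta q ^ l = (of_real s + of_real t * zeta q) * zeta q ^ l" by simp
    then have "w = of_real s * zeta q ^ l + of_real t * zeta q ^ Suc l"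
      using zz[of l] by (simp add: algebra_simps)
    ultimately show "\<exists>s\<ge>0. \<exists>t\<ge>0. w = of_real s * zeta q ^ l + of_real t * zeta q ^ Suc l" by blast
  next
    assume "\<exists>s\<ge>0. \<exists>t\<ge>0. w = of_real s * zeta q ^ l + of_real t * zeta q ^ Suc l"
    then obtain s t where st: "0 \<le> s" "0 \<le> t" "w = of_real s * zeta q ^ l + of_real t * zeta q ^ Suc l" by blast
    have p: "w * cnj (zeta q ^ l) = of_real s + of_real t * zeta q"
    proof -
      have "w * cnj (zeta q ^ l) = (of_real s + of_real t * zeta q) * (zeta q ^ l * cnj (zeta q ^ l))"
        unfolding st(3) by (simp add: algebra_simps)
      then show ?thesis unfolding zz by simp
    qed
    have "Im (w * cnj (zeta q ^ Suc l)) = - s * sin ?\<theta>"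
      unfolding Im1 p by (simp add: zeta_def algebra_simps)
    moreover have "Im (w * cnj (zeta q ^ l)) = t * sin ?\<theta>"
      unfolding p by (simp add: zeta_def)
    ultimately show "w \<in> cone_sector q l"
      unfolding cone_sector_def using st sin by simp
  qed
qed

text \<open>A real linear isometry carries complex lines to planes of the real space; these become
  the planes orthogonal to the boundaries of the fans.\<close>

locale complex_structure =
  fixes \<phi> :: "complex^'t \<Rightarrow> real^'N"
  assumes linear: "linear \<phi>" and norm_map: "\<And>x. norm (\<phi> x) = norm x"
begin

lemma inner_map: "\<phi> x \<bullet> \<phi> y = x \<bullet> y"
  by (simp add: dot_norm linear_add[OF linear, symmetric] norm_map)

lemma smult_split: "c *s x = Re c *\<^sub>R x + Im c *\<^sub>R (\<i> *s (x :: complex^'t))"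
  by (simp add: vec_eq_iff complex_eq_iff algebra_simps)

definition jmap :: "complex^'t \<Rightarrow> real^'N" where
  "jmap x = \<phi> (\<i> *s x)"

lemma map_smult: "\<phi> (c *s x) = Re c *\<^sub>R \<phi> x + Im c *\<^sub>R jmap x"
  by (subst smult_split) (simp add: linear_add[OF linear] linear_scale[OF linear] jmap_def)

lemma jmap_smult: "jmap (c *s x) = Re c *\<^sub>R jmap x - Im c *\<^sub>R \<phi> x"
  unfolding jmap_def[of "c *s x"] by (simp add: vector_smult_assoc map_smult)

text \<open>For a unit vector \<open>y\<close>, the complex coordinate of the orthogonal projection
  of \<open>z\<close> to the plane of the line through \<open>y\<close>, with
  \<open>\<phi> y\<close> as 1 and \<open>jmap y\<close> as the imaginary unit. It is conjugate
  linear in \<open>y\<close>; this is where the conjugates in the formulas for centres come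
  from.\<close>

definition proj :: "complex^'t \<Rightarrow> real^'N \<Rightarrow> complex" where
  "proj y z = Complex (z \<bullet> \<phi> y) (z \<bullet> jmap y)"

lemma proj_add: "proj y (z + z') = proj y z + proj y z'"
  by (simp add: proj_def complex_eq_iff inner_add_left)

lemma proj_diff: "proj y (z - z') = proj y z - proj y z'"
  by (simp add: proj_def complex_eq_iff inner_diff_left)

lemma proj_scale: "proj y (r *\<^sub>R z) = r * proj y z"
  by (simp add: proj_def complex_eq_iff)

lemma proj_smult: "proj (c *s y) z = cnj c * proj y z"
  by (simp add: proj_def map_smult jmap_smult complex_eq_iff inner_add_right inner_diff_right)

lemma inner_smult_self: "(c *s y) \<bullet> (y :: complex^'t) = Re c * (norm y)\<^sup>2"
  "(c *s y) \<bullet> (\<i> *s y) = Im c * (norm y)\<^sup>2"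
proof -
  have "Re (hermitian (c *s y) (d *s y)) = Re (c * cnj d * hermitian y y)" for d
    by (simp add: hermitian_def sum_distrib_left mult_ac)
  then have *: "(c *s y) \<bullet> (d *s y) = Re (c * cnj d) * (norm y)\<^sup>2" for d
    by (simp add: Re_hermitian hermitian_self)
  from *[of 1] *[of \<i>] show "(c *s y) \<bullet> y = Re c * (norm y)\<^sup>2" "(c *s y) \<bullet> (\<i> *s y) = Im c * (norm y)\<^sup>2"
    by simp_all
qed

lemma proj_map: "norm y = 1 \<Longrightarrow> proj y (\<phi> (c *s y)) = c"
  by (simp add: proj_def jmap_def inner_map inner_smult_self complex_eq_iff)

lemma norm_proj_le: "norm y = 1 \<Longrightarrow> norm (proj y z) \<le> 2 * norm z"
proof -
  assume y: "norm y = 1"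
  have "\<bar>z \<bullet> \<phi> y\<bar> \<le> norm z" "\<bar>z \<bullet> jmap y\<bar> \<le> norm z"
    using Cauchy_Schwarz_ineq2[of z "\<phi> y"] Cauchy_Schwarz_ineq2[of z "jmap y"] y
    by (simp_all add: norm_map jmap_def)
  then show ?thesis
    using cmod_le[of "proj y z"] by (simp add: proj_def)
qed

definition center :: "complex^'t \<Rightarrow> complex \<Rightarrow> (real^'N) set" where
  "center y \<beta> = {z. proj y z = \<beta>}"

definition direction :: "nat \<Rightarrow> complex^'t \<Rightarrow> nat \<Rightarrow> real^'N" where
  "direction q y i = \<phi> (zeta q ^ i *s y)"

lemma center_orthogonal:
  assumes "a \<in> center y \<beta>" "b \<in> center y \<beta>"
  shows "(a - b) \<bullet> \<phi> (c *s y) = 0"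
  using assms by (simp add: map_smult center_def proj_def inner_diff_left inner_add_right complex_eq_iff)

lemma regular_fan_center:
  assumes q: "3 \<le> q" and y: "norm y = 1"
  shows "regular_fan q (center y \<beta>) (direction q y)"
proof -
  let ?u = "\<phi> y" and ?v = "jmap y"
  have uv: "norm ?u = 1" "norm ?v = 1" "orthogonal ?u ?v"
    using y inner_smult_self(2)[of 1 y] by (simp_all add: norm_map orthogonal_def inner_map jmap_def)
  have "center y \<beta> = {z. z \<bullet> ?u = Re \<beta> \<and> z \<bullet> ?v = Im \<beta>}"
    by (auto simp: center_def proj_def complex_eq_iff)
  then have "affine (center y \<beta>)" "aff_dim (center y \<beta>) = int CARD('N) - 2"
    using codimension_two_affine[OF uv, of "Re \<beta>" "Im \<beta>"] by simp_all
  moreover have "orthogonal (a - b) ?u" "orthogonal (a - b) ?v" if "a \<in> center y \<beta>" "b \<in> center y \<beta>" for a b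
    using center_orthogonal[OF that, of 1] center_orthogonal[OF that, of \<i>]
    by (auto simp: orthogonal_def jmap_def)
  moreover have "direction q y i = cos (2 * pi * real i / real q) *\<^sub>R ?u + sin (2 * pi * real i / real q) *\<^sub>R ?v" for i
    by (simp add: direction_def map_smult zeta_power)
  ultimately show ?thesis
    unfolding regular_fan_def using q uv by blast
qed

text \<open>Subtract from a normal vector \<open>w\<close> its component in the plane of
  \<open>y\<close>. The rest \<open>w'\<close> is a difference of two points of the boundary, so it
  is orthogonal to \<open>w\<close> and to the subtracted component, hence to itself.\<close>

lemma fan_perp_center:
  assumes y: "norm y = 1"
  shows "fan_perp q (center y \<beta>) (direction q y) \<subseteq> range (\<lambda>c. \<phi> (c *s y))"
  unfolding fan_perp_def
proof (rule span_minimal)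
  have add: "\<phi> (c *s y) + \<phi> (d *s y) = \<phi> ((c + d) *s y)"
    and scale: "r *\<^sub>R \<phi> (c *s y) = \<phi> ((of_real r * c) *s y)" for c d r
    by (simp_all add: map_smult scaleR_left_distrib scaleR_right_distrib add_ac linear_add[OF linear])
  have zero: "0 = \<phi> (0 *s y)" using linear by (simp add: linear_0)
  show "subspace (range (\<lambda>c. \<phi> (c *s y)))"
  proof (rule subspaceI)
    show "0 \<in> range (\<lambda>c. \<phi> (c *s y))" 
      using zero by (rule range_eqI[of _ "\<lambda>c. \<phi> (c *s y)"])
    fix a assume "a \<in> range (\<lambda>c. \<phi> (c *s y))"
    then obtain c where a: "a = \<phi> (c *s y)" by (elim rangeE)
    show "r *\<^sub>R a \<in> range (\<lambda>c. \<phi> (c *s y))" for r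
      unfolding a scale by (rule rangeI)
    fix b assume "b \<in> range (\<lambda>c. \<phi> (c *s y))"
    then obtain d where b: "b = \<phi> (d *s y)" by (elim rangeE)
    show "a + b \<in> range (\<lambda>c. \<phi> (c *s y))"
      unfolding a b add by (rule rangeI)
  qed
  show "(\<Union>i<q. {w. \<forall>x\<in>half_hyperplane (center y \<beta>) (direction q y) i.
      \<forall>x'\<in>half_hyperplane (center y \<beta>) (direction q y) i. orthogonal w (x - x')}) \<subseteq> range (\<lambda>c. \<phi> (c *s y))"
  proof
    fix w assume "w \<in> (\<Union>i<q. {w. \<forall>x\<in>half_hyperplane (center y \<beta>) (direction q y) i.
      \<forall>x'\<in>half_hyperplane (center y \<beta>) (direction q y) i. orthogonal w (x - x')})"
    then obtain i where w: "\<And>x x'. x \<in> half_hyperplane (center y \<beta>) (direction q y) i \<Longrightarrow>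
        x' \<in> half_hyperplane (center y \<beta>) (direction q y) i \<Longrightarrow> orthogonal w (x - x')" by auto
    have sub: "a \<in> half_hyperplane (center y \<beta>) (direction q y) i" if "a \<in> center y \<beta>" for a
    proof -
      have "a = a + 0 *\<^sub>R direction q y i" by simp
      with that show ?thesis unfolding half_hyperplane_def by blast
    qed
    define w' where "w' = w - \<phi> (proj y w *s y)"
    have pw: "proj y w' = 0" by (simp add: w'_def proj_diff proj_map[OF y])
    define a where "a = \<phi> (\<beta> *s y)"
    have a: "a \<in> center y \<beta>" "a + w' \<in> center y \<beta>"
      by (simp_all add: center_def a_def proj_map[OF y] proj_add pw)
    have "w \<bullet> w' = 0"
      using w[OF sub[OF a(2)] sub[OF a(1)]] by (simp add: orthogonal_def)
    moreover have "\<phi> (proj y w *s y) \<bullet> w' = 0"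
      using center_orthogonal[OF a(2) a(1), of "proj y w"] by (simp add: inner_commute)
    ultimately have "w' \<bullet> w' = 0" by (subst w'_def) (simp add: inner_diff_left)
    then have "w' = 0" by simp
    then show "w \<in> range (\<lambda>c. \<phi> (c *s y))" unfolding w'_def by auto
  qed
qed

lemma regular_sector_center:
  assumes q: "3 \<le> q" and y: "norm y = 1"
  shows "regular_sector (center y \<beta>) (direction q y) l = {z. proj y z - \<beta> \<in> cone_sector q l}"
proof (intro equalityI subsetI)
  fix z assume "z \<in> regular_sector (center y \<beta>) (direction q y) l"
  then obtain a s t where a: "a \<in> center y \<beta>" "0 \<le> s" "0 \<le> t"
    "z = a + s *\<^sub>R direction q y l + t *\<^sub>R direction q y (Suc l)"
    by (auto simp: regular_sector_def)
  then have "proj y z - \<beta> = of_real s * zeta q ^ l + of_real t * zeta q ^ Suc l"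
    by (simp add: proj_add proj_scale direction_def proj_map[OF y] center_def del: power_Suc)
  then show "z \<in> {z. proj y z - \<beta> \<in> cone_sector q l}"
    using a(2,3) cone_sector_iff[OF q] by blast
next
  fix z assume "z \<in> {z. proj y z - \<beta> \<in> cone_sector q l}"
  then obtain s t where st: "0 \<le> s" "0 \<le> t" "proj y z - \<beta> = of_real s * zeta q ^ l + of_real t * zeta q ^ Suc l"
    using cone_sector_iff[OF q] by blast
  define a where "a = z - s *\<^sub>R direction q y l - t *\<^sub>R direction q y (Suc l)"
  have "proj y a = \<beta>"
  proof -
    have "proj y a = proj y z - of_real s * zeta q ^ l - of_real t * zeta q ^ Suc l"
      unfolding a_def direction_def by (simp only: proj_diff proj_scale proj_map[OF y])
    moreover have "p - A - B = \<beta>" if "p - \<beta> = A + B" for p A B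
      using that by (simp add: algebra_simps)
    ultimately show ?thesis using st(3) by metis
  qed
  then have "a \<in> center y \<beta>" by (simp add: center_def)
  moreover have "z = a + s *\<^sub>R direction q y l + t *\<^sub>R direction q y (Suc l)"
    by (simp add: a_def)
  ultimately show "z \<in> regular_sector (center y \<beta>) (direction q y) l"
    unfolding regular_sector_def using st by blast
qed

text \<open>Hermitian orthogonality survives complex rescaling of either vector, so it passes to
  whole complex lines. Real orthogonality would not do: \<open>y\<close> and
  \<open>\<i> *s y\<close> lie in one plane.\<close>

lemma orthogonal_fan_perps:
  assumes "norm y = 1" "norm y' = 1" "hermitian y y' = 0"
    "x \<in> fan_perp q (center y \<beta>) (direction q y)" "x' \<in> fan_perp q (center y' \<beta>') (direction q y')"
  shows "orthogonal x x'"
proof -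
  obtain c d where cd: "x = \<phi> (c *s y)" "x' = \<phi> (d *s y')"
    using fan_perp_center assms by blast
  have "hermitian (c *s y) (d *s y') = c * cnj d * hermitian y y'"
    by (simp add: hermitian_def sum_distrib_left mult_ac)
  then show ?thesis
    using assms(3) Re_hermitian[of "c *s y" "d *s y'"] by (simp add: cd orthogonal_def inner_map)
qed

text \<open>A vanishing sum of vectors from the planes is, by injectivity of \<open>\<phi>\<close>,
  a complex linear relation among the \<open>y i\<close>.\<close>

lemma independent_fan_perps:
  assumes y: "\<And>i. i < k \<Longrightarrow> norm (y i) = 1"
    and ind: "\<And>c. (\<Sum>i<k. c i *s y i) = 0 \<Longrightarrow> \<forall>i<k. c i = 0"
  shows "independent_subspaces k (\<lambda>i. fan_perp q (center (y i) (\<beta> i)) (direction q (y i)))"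
  unfolding independent_subspaces_def
proof (intro allI impI)
  fix w i assume w: "(\<forall>i<k. w i \<in> fan_perp q (center (y i) (\<beta> i)) (direction q (y i))) \<and> (\<Sum>i<k. w i) = 0"
    and i: "i < k"
  then have "\<forall>i. \<exists>c. i < k \<longrightarrow> w i = \<phi> (c *s y i)"
    using fan_perp_center[OF y] by blast
  then obtain c where c: "\<And>i. i < k \<Longrightarrow> w i = \<phi> (c i *s y i)" by metis
  have "\<phi> (\<Sum>i<k. c i *s y i) = (\<Sum>i<k. w i)"
    by (simp add: linear_sum[OF linear] c)
  then have "norm (\<Sum>i<k. c i *s y i) = 0"
    using w norm_map by (metis norm_zero)
  then have "c i = 0" using ind[of c] i by simp
  then show "w i = 0" using c[OF i] linear by (simp add: linear_0)
qed

end

text \<open>The second basis vector \<open>v\<close> is orthogonal to the boundary and to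
  \<open>d 0\<close>, hence normal to the first half-hyperplane. Together with the next lemma this
  bounds the number of independent fans, so that the maxima over \<open>k\<close> are
  meaningful.\<close>

lemma fan_perp_nonzero:
  assumes "regular_fan q A d"
  obtains v where "v \<in> fan_perp q A d" "v \<noteq> 0"
proof -
  from assms obtain u v where *: "norm u = 1 \<and> norm v = 1 \<and> orthogonal u v \<and>
      (\<forall>a\<in>A. \<forall>b\<in>A. orthogonal (a - b) u \<and> orthogonal (a - b) v) \<and>
      (\<forall>i. d i = cos (2 * pi * real i / real q) *\<^sub>R u + sin (2 * pi * real i / real q) *\<^sub>R v)"
    unfolding regular_fan_def by (elim conjE exE) (rule that, intro conjI; assumption)
  have uv: "norm v = 1" "v \<bullet> u = 0" and d: "d 0 = cos (2 * pi * real 0 / real q) *\<^sub>R u + sin (2 * pi * real 0 / real q) *\<^sub>R v"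
    using * by (auto simp only: orthogonal_def inner_commute)
  have A: "v \<bullet> a = v \<bullet> b" if "a \<in> A" "b \<in> A" for a b
  proof -
    have "orthogonal (a - b) v" using * that by blast
    then have "v \<bullet> (a - b) = 0" by (simp add: orthogonal_def inner_commute)
    then show ?thesis by (simp add: inner_diff_right)
  qed
  have q: "3 \<le> q" using assms by (simp add: regular_fan_def)
  have "v \<bullet> (x - y) = 0" if "x \<in> half_hyperplane A d 0" "y \<in> half_hyperplane A d 0" for x y
  proof -
    obtain a b r s where "a \<in> A" "b \<in> A" "x = a + r *\<^sub>R d 0" "y = b + s *\<^sub>R d 0"
      using \<open>x \<in> _\<close> \<open>y \<in> _\<close> by (auto simp: half_hyperplane_def)
    then show ?thesis
      using d uv(2) A[of a b] by (simp add: inner_diff_right inner_add_right)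
  qed
  then have "v \<in> {w. \<forall>x\<in>half_hyperplane A d 0. \<forall>y\<in>half_hyperplane A d 0. orthogonal w (x - y)}"
    by (simp add: orthogonal_def)
  then have "v \<in> fan_perp q A d"
    unfolding fan_perp_def using q by (intro span_base UN_I[of 0]) simp_all
  then show ?thesis using that uv(1) by force
qed

lemma independent_subspaces_le_dim:
  fixes W :: "nat \<Rightarrow> (real^'n) set"
  assumes ind: "independent_subspaces k W" and sub: "\<And>i. i < k \<Longrightarrow> subspace (W i)"
    and nz: "\<And>i. i < k \<Longrightarrow> \<exists>v\<in>W i. v \<noteq> 0"
  shows "k \<le> CARD('n)"
proof -
  obtain v where v: "\<And>i. i < k \<Longrightarrow> v i \<in> W i" "\<And>i. i < k \<Longrightarrow> v i \<noteq> 0"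
    using nz by metis
  have coeff: "c i = 0" if "(\<Sum>i<k. c i *\<^sub>R v i) = 0" "i < k" for c i
  proof -
    have "\<forall>i<k. c i *\<^sub>R v i = 0"
      using ind[unfolded independent_subspaces_def, rule_format, of "\<lambda>i. c i *\<^sub>R v i"] that(1) v(1) sub
      by (auto intro: subspace_scale)
    then show ?thesis using v(2)[OF that(2)] that(2) by auto
  qed
  have inj: "inj_on v {..<k}"
  proof (rule inj_onI, rule ccontr)
    fix i j assume ij: "i \<in> {..<k}" "j \<in> {..<k}" "v i = v j" "i \<noteq> j"
    have "(\<Sum>l<k. (if l = i then 1 else if l = j then -1 else 0) *\<^sub>R v l) =
        (\<Sum>l<k. (if l = i then v l else 0) + (if l = j then - v l else 0))"
      using ij by (intro sum.cong) auto
    also have "\<dots> = 0" using ij by (simp add: sum.distrib)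
    finally have "(\<Sum>l<k. (if l = i then 1 else if l = j then -1 else 0) *\<^sub>R v l) = 0" .
    from coeff[OF this, of i] ij show False by simp
  qed
  have "independent (v ` {..<k})"
  proof -
    have "u x = 0" if "(\<Sum>x\<in>v ` {..<k}. u x *\<^sub>R x) = 0" "x \<in> v ` {..<k}" for u x
      using coeff[of "\<lambda>i. u (v i)"] that by (auto simp: sum.reindex[OF inj])
    then show ?thesis
      unfolding dependent_finite[OF finite_imageI[OF finite_lessThan]] by blast
  qed
  then have "card (v ` {..<k}) \<le> DIM(real^'n)"
    using independent_bound by blast
  then show ?thesis using card_image[OF inj] by simp
qed

lemma orthogonal_imp_independent_subspaces:
  assumes "orthogonal_subspaces k W" shows "independent_subspaces k W"
  unfolding independent_subspaces_def
proof (intro allI impI)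
  fix w i assume w: "(\<forall>i<k. w i \<in> W i) \<and> (\<Sum>i<k. w i) = 0" and i: "i < k"
  have "w i \<bullet> (\<Sum>j<k. w j) = (\<Sum>j<k. if j = i then w i \<bullet> w i else 0)"
    unfolding inner_sum_right using assms w i
    by (intro sum.cong) (auto simp: orthogonal_subspaces_def orthogonal_def)
  then show "w i = 0" using w i by simp
qed

section \<open>Plane cones and Fourier coefficients\<close>

lemma cone_sector_cover:
  assumes "2 \<le> q" shows "\<exists>l<q. w \<in> cone_sector q l"
proof (cases "w = 0")
  case True
  then show ?thesis using assms by (auto simp: cone_sector_def intro!: exI[of _ 0])
next
  case False
  then obtain l \<phi> where l: "l < q" "0 \<le> \<phi>" "\<phi> < 2 * pi / q" "w = rcis (norm w) \<phi> * zeta q ^ l"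
    using polar_mod_zeta[of w q] assms by auto
  have q: "2 * pi / q \<le> pi" using assms by (simp add: field_simps)
  have zz: "zeta q ^ j * cnj (zeta q ^ j) = 1" for j
    by (metis complex_norm_square norm_zeta norm_power power_one of_real_1)
  have p: "w * cnj (zeta q ^ l) = rcis (norm w) \<phi>"
    using zz[of l] by (subst l(4)) (simp add: mult.assoc)
  have p': "w * cnj (zeta q ^ Suc l) = rcis (norm w) (\<phi> - 2 * pi / q)"
  proof -
    have "w * cnj (zeta q ^ Suc l) = (w * cnj (zeta q ^ l)) * cnj (zeta q)" by simp
    then show ?thesis unfolding p by (simp add: zeta_def rcis_def cis_cnj cis_mult mult.assoc)
  qed
  have "0 \<le> sin \<phi>" using l q by (intro sin_ge_zero) auto
  moreover have "sin (\<phi> - 2 * pi / q) \<le> 0"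
    using l q sin_ge_zero[of "2 * pi / q - \<phi>"] by (simp add: sin_diff mult.commute)
  ultimately have "w \<in> cone_sector q l"
    unfolding cone_sector_def mem_Collect_eq p p' by (simp add: mult_nonneg_nonpos)
  with l(1) show ?thesis by blast
qed

lemma half_planes_imp_open_sector:
  assumes "3 \<le> q" "0 < Im p" "Im (p * cnj (zeta q)) < 0"
  shows "p \<in> open_sector q"
proof -
  define \<psi> where "\<psi> = Arg2pi p"
  have \<psi>: "0 < \<psi>" "\<psi> < pi" using Arg2pi_lt_pi[of p] assms(2) by (auto simp: \<psi>_def)
  have q: "0 < 2 * pi / q" using assms(1) by (intro divide_pos_pos) auto
  have p: "p = rcis (norm p) \<psi>" using Arg2pi[of p] by (auto simp: \<psi>_def rcis_def cis_conv_exp is_Arg_def)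
  have "p * cnj (zeta q) = rcis (norm p) (\<psi> - 2 * pi / q)"
    by (subst p) (simp add: rcis_def zeta_def cis_cnj cis_mult mult.assoc)
  then have "norm p * sin (\<psi> - 2 * pi / q) < 0" using assms(3) by simp
  then have "sin (\<psi> - 2 * pi / q) < 0" by (simp add: mult_less_0_iff)
  moreover have "0 \<le> sin (\<psi> - 2 * pi / q)" if "2 * pi / q \<le> \<psi>"
    using that \<psi> q by (intro sin_ge_zero) linarith+
  ultimately have "\<psi> < 2 * pi / q" by linarith
  then show ?thesis using \<psi> by (simp add: open_sector_def \<psi>_def)
qed

text \<open>Off the bounding lines, membership in two cones would be membership in two distinct
  rotations of the open sector, and those are disjoint.\<close>

lemma cone_sector_overlap:
  assumes q: "3 \<le> q" and w: "w \<in> cone_sector q l" "w \<in> cone_sector q l'" and l: "l < l'" "l' < q"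
  shows "\<exists>j\<le>q. Im (w * cnj (zeta q ^ j)) = 0"
proof (rule ccontr)
  assume no: "\<not> ?thesis"
  have *: "w * cnj (zeta q ^ i) \<in> open_sector q" if "w \<in> cone_sector q i" "i < q" for i
  proof (rule half_planes_imp_open_sector[OF q])
    show "0 < Im (w * cnj (zeta q ^ i))"
      using that no unfolding cone_sector_def by (metis less_imp_le mem_Collect_eq order_less_le)
    have "Im (w * cnj (zeta q ^ Suc i)) < 0"
      using that no unfolding cone_sector_def by (metis Suc_leI mem_Collect_eq order_less_le)
    then show "Im (w * cnj (zeta q ^ i) * cnj (zeta q)) < 0" by (simp add: mult_ac)
  qed
  have "zeta q ^ (l' - l) * (w * cnj (zeta q ^ l')) = w * cnj (zeta q ^ l) * (zeta q ^ (l' - l) * cnj (zeta q ^ (l' - l)))"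
  proof -
    have "zeta q ^ l' = zeta q ^ l * zeta q ^ (l' - l)" using l by (simp flip: power_add)
    then show ?thesis by (simp add: mult_ac)
  qed
  also have "\<dots> = w * cnj (zeta q ^ l)"
    by (simp only: zeta_cnj_power mult_1_right)
  finally have eq: "zeta q ^ (l' - l) * (w * cnj (zeta q ^ l')) = w * cnj (zeta q ^ l)" .
  have "zeta q ^ (l' - l) * (w * cnj (zeta q ^ l')) \<notin> open_sector q"
    using l by (intro open_sector_rotate_disjoint *[OF w(2)]) auto
  then show False
    unfolding eq using *[OF w(1)] l by simp
qed

lemma cone_sector_unique:
  assumes q: "3 \<le> q" and off: "\<And>j. j \<le> q \<Longrightarrow> Im (w * cnj (zeta q ^ j)) \<noteq> 0"
  shows "\<exists>!l. l < q \<and> w \<in> cone_sector q l"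
proof -
  have "l = l'" if "l < q" "w \<in> cone_sector q l" "l' < q" "w \<in> cone_sector q l'" for l l'
    using cone_sector_overlap[OF q, of w l l'] cone_sector_overlap[OF q, of w l' l] off that
    by (meson linorder_neqE_nat)
  moreover have "\<exists>l<q. w \<in> cone_sector q l"
    using q by (intro cone_sector_cover) simp
  ultimately show ?thesis by blast
qed

lemma cone_sector_rotate:
  "cnj (zeta q ^ r) * w \<in> cone_sector q l \<longleftrightarrow> w \<in> cone_sector q (l + r)"
proof -
  have "cnj (zeta q ^ r) * w * cnj (zeta q ^ i) = w * cnj (zeta q ^ (i + r))" for i
    by (simp add: power_add mult_ac)
  from this[of l] this[of "Suc l"] show ?thesis
    unfolding cone_sector_def mem_Collect_eq add_Suc by (simp only:)
qed

lemma cone_sector_periodic: "0 < q \<Longrightarrow> cone_sector q (l + q) = cone_sector q l"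
  by (simp add: cone_sector_def power_add)

lemma closed_cone_sector: "closed (cone_sector q l)"
  unfolding cone_sector_def by (intro closed_Collect_conj closed_Collect_le continuous_intros)

text \<open>A point of the cone makes an angle of at most pi / q with the bisector; the factor 1/2
  is the cosine of pi / 3.\<close>

lemma Re_midpoint_cone_sector:
  assumes q: "3 \<le> q" and w: "w \<in> cone_sector q l"
  shows "norm w / 2 \<le> Re (w * cnj (cis (pi / q) * zeta q ^ l))"
proof -
  obtain s t where st: "0 \<le> s" "0 \<le> t" "w = of_real s * zeta q ^ l + of_real t * zeta q ^ Suc l"
    using cone_sector_iff[OF q] w by blast
  have zz: "zeta q ^ l * cnj (zeta q ^ l) = 1"
    by (metis complex_norm_square norm_zeta norm_power power_one of_real_1)
  have "w * cnj (cis (pi / q) * zeta q ^ l) =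
      (of_real s * cnj (cis (pi / q)) + of_real t * (zeta q * cnj (cis (pi / q)))) * (zeta q ^ l * cnj (zeta q ^ l))"
    unfolding st(3) by (simp add: algebra_simps)
  also have "zeta q * cnj (cis (pi / q)) = cis (pi / q)"
    by (simp add: zeta_def cis_cnj cis_mult)
  finally have "Re (w * cnj (cis (pi / q) * zeta q ^ l)) = (s + t) * cos (pi / q)"
    unfolding zz by (simp add: algebra_simps)
  moreover have "cos (pi / 3) \<le> cos (pi / q)"
    using q by (intro cos_monotone_0_pi_le) (auto simp: field_simps)
  then have "1 / 2 \<le> cos (pi / q)" by (simp add: cos_60)
  then have "(s + t) * (1 / 2) \<le> (s + t) * cos (pi / q)"
    using st by (intro mult_left_mono) auto
  moreover have "norm w \<le> s + t"
  proof -
    have "norm w \<le> norm (of_real s * zeta q ^ l) + norm (of_real t * zeta q ^ Suc l)"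
      unfolding st(3) by (rule norm_triangle_ineq)
    also have "\<dots> = s + t"
      using st(1,2) by (simp add: norm_mult norm_power del: power_Suc)
    finally show ?thesis .
  qed
  ultimately show ?thesis by simp
qed

lemma sum_lessThan_periodic:
  fixes g :: "nat \<Rightarrow> 'a::ab_group_add"
  assumes "\<And>l. g (l + q) = g l"
  shows "(\<Sum>l<q. g (l + r)) = (\<Sum>l<q. g l)"
proof (induction r)
  case (Suc r)
  have "(\<Sum>l<Suc q. g (l + r)) = (\<Sum>l<q. g (l + r)) + g r"
    using assms[of r] by (simp add: add.commute)
  moreover have "(\<Sum>l<Suc q. g (l + r)) = g r + (\<Sum>l<q. g (l + Suc r))"
    by (subst sum.lessThan_Suc_shift) simp
  ultimately show ?case using Suc by (simp add: add.commute)
qed simp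

lemma zeta_power_eq_1_iff:
  assumes "0 < j" "j < q" shows "zeta q ^ j \<noteq> 1"
proof
  assume "zeta q ^ j = 1"
  moreover have "rcis 1 (pi / q) \<in> open_sector q"
    using assms by (intro rcis_in_open_sector) (auto simp: field_simps)
  ultimately show False
    using open_sector_rotate_disjoint[OF _ assms] by force
qed

text \<open>A geometric sum whose ratio is a \<open>q\<close>-th root of unity other than 1.\<close>

lemma zeta_orthogonality:
  assumes "l < q" "l' < q" "l \<noteq> l'"
  shows "(\<Sum>p<q. zeta q ^ (p * l) * cnj (zeta q ^ (p * l'))) = 0"
proof -
  define x where "x = zeta q ^ l * cnj (zeta q ^ l')"
  have "x \<noteq> 1"
  proof
    assume "x = 1"
    then have "x * zeta q ^ l' = zeta q ^ l'" by simp
    moreover have "x * zeta q ^ l' = zeta q ^ l * (zeta q ^ l' * cnj (zeta q ^ l'))"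
      by (simp only: x_def mult_ac)
    ultimately have eq: "zeta q ^ l = zeta q ^ l'"
      by (simp only: zeta_cnj_power mult_1_right)
    have nz: "zeta q \<noteq> 0" by (metis norm_zero norm_zeta zero_neq_one)
    from assms(3) consider "l < l'" | "l' < l" by linarith
    then show False
    proof cases
      case 1
      then have "zeta q ^ l' = zeta q ^ l * zeta q ^ (l' - l)" by (simp flip: power_add)
      with eq nz have "zeta q ^ (l' - l) = 1" by simp
      then show False using zeta_power_eq_1_iff[of "l' - l" q] 1 assms by simp
    next
      case 2
      then have "zeta q ^ l = zeta q ^ l' * zeta q ^ (l - l')" by (simp flip: power_add)
      with eq nz have "zeta q ^ (l - l') = 1" by simp
      then show False using zeta_power_eq_1_iff[of "l - l'" q] 2 assms by simp
    qed
  qed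
  have q: "0 < q" using assms by simp
  have "x ^ q = 1"
    using q by (simp add: x_def power_mult_distrib power_mult[symmetric] mult.commute[of _ q] flip: complex_cnj_power)
       (simp add: power_mult)
  then have "(x - 1) * (\<Sum>p<q. x ^ p) = 0"
    by (simp add: power_diff_1_eq[symmetric])
  then have "(\<Sum>p<q. x ^ p) = 0" using \<open>x \<noteq> 1\<close> by simp
  moreover have "x ^ p = zeta q ^ (p * l) * cnj (zeta q ^ (p * l'))" for p
    by (simp add: x_def power_mult_distrib power_mult[symmetric] mult.commute[of p] )
  ultimately show ?thesis by simp
qed

text \<open>Half of the Fourier coefficients suffice: as \<open>c\<close> is real, the coefficient of index \<open>q - p\<close> is
  the conjugate of the one of index \<open>p\<close>.\<close>

lemma constant_if_fourier_zero:
  fixes c :: "nat \<Rightarrow> real"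
  assumes q: "odd q" and zero: "\<And>p. 1 \<le> p \<Longrightarrow> p \<le> (q - 1) div 2 \<Longrightarrow>
      (\<Sum>l<q. cnj (zeta q ^ (p * l)) * of_real (c l)) = 0"
    and l: "l < q"
  shows "c l = (\<Sum>l<q. c l) / q"
proof -
  define F where "F p = (\<Sum>l<q. cnj (zeta q ^ (p * l)) * of_real (c l))" for p
  have q0: "0 < q" using l by simp
  have "F p = 0" if p: "0 < p" "p < q" for p
  proof (cases "p \<le> (q - 1) div 2")
    case True
    then show ?thesis using zero[of p] p by (simp add: F_def)
  next
    case False
    \<comment> \<open>As \<open>q\<close> is odd, one of \<open>p\<close> and \<open>q - p\<close>
      is in the range covered by the hypothesis.\<close>
    have *: "1 \<le> q - p" "q - p \<le> (q - 1) div 2" using False p q by presburger+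
    have conj: "cnj (zeta q ^ (p * i)) = zeta q ^ ((q - p) * i)" for i
    proof -
      have "(q - p) * i + p * i = q * i" using p by (simp flip: add_mult_distrib)
      then have "zeta q ^ ((q - p) * i) * zeta q ^ (p * i) = (zeta q ^ q) ^ i"
        by (simp flip: power_add power_mult)
      then have "zeta q ^ ((q - p) * i) * zeta q ^ (p * i) = 1" using q0 by simp
      then have "zeta q ^ ((q - p) * i) * (zeta q ^ (p * i) * cnj (zeta q ^ (p * i))) = cnj (zeta q ^ (p * i))"
        by (simp only: mult.assoc[symmetric] mult_1_left)
      then show ?thesis by (simp only: zeta_cnj_power mult_1_right)
    qed
    have "F p = cnj (F (q - p))"
      unfolding F_def cnj_sum complex_cnj_mult complex_cnj_cnj conj complex_cnj_complex_of_real ..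
    also have "F (q - p) = 0" using zero[OF *] by (simp add: F_def)
    finally show ?thesis by simp
  qed
  \<comment> \<open>Fourier inversion: only the term \<open>p = 0\<close> survives, while the double
    sum evaluates to \<open>q * c l\<close>.\<close>
  then have "(\<Sum>p<q. zeta q ^ (p * l) * F p) = (\<Sum>p<q. if p = 0 then F 0 else 0)"
    by (intro sum.cong) auto
  also have "\<dots> = of_real (\<Sum>l<q. c l)" using q0 by (simp add: F_def)
  also have "(\<Sum>p<q. zeta q ^ (p * l) * F p) =
      (\<Sum>p<q. \<Sum>l'<q. of_real (c l') * (zeta q ^ (p * l) * cnj (zeta q ^ (p * l'))))"
    unfolding F_def sum_distrib_left by (intro sum.cong refl) (simp only: mult_ac)
  also have "\<dots> = (\<Sum>l'<q. of_real (c l') * (\<Sum>p<q. zeta q ^ (p * l) * cnj (zeta q ^ (p * l'))))"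
    by (subst sum.swap) (simp only: sum_distrib_left)
  also have "\<dots> = (\<Sum>l'<q. if l' = l then of_real (c l) * of_nat q else 0)"
    using zeta_orthogonality[OF l] zeta_cnj_power by (intro sum.cong) auto
  also have "\<dots> = of_real (c l * q)" using l by simp
  finally have "c l * q = (\<Sum>l<q. c l)" by (simp only: of_real_eq_iff)
  then show ?thesis using q0 by (simp add: field_simps)
qed

section \<open>Masses of sectors\<close>

context complex_structure
begin

lemma linear_proj_right: "linear (proj y)"
proof (rule linearI)
  show "proj y (r *\<^sub>R z) = r *\<^sub>R proj y z" for r z
    unfolding proj_scale by (simp add: scaleR_conv_of_real)
qed (rule proj_add)

lemma linear_proj_left: "linear (\<lambda>y. proj y z)"
proof (rule linearI)
  show "proj (y + y') z = proj y z + proj y' z" for y y'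
    by (simp add: proj_def jmap_def linear_add[OF linear] inner_add_right complex_eq_iff vector_add_ldistrib)
  show "proj (r *\<^sub>R y) z = r *\<^sub>R proj y z" for r y
  proof -
    have "r *\<^sub>R y = of_real r *s y" by (simp add: vec_eq_iff complex_eq_iff)
    then show ?thesis by (simp only: proj_smult scaleR_conv_of_real complex_cnj_complex_of_real)
  qed
qed

lemma closed_sector: "closed {z. proj y z - \<beta> \<in> cone_sector q l}"
proof -
  have "continuous_on UNIV (\<lambda>z. proj y z - \<beta>)"
    using linear_proj_right[of y] by (intro continuous_intros linear_continuous_on) (simp add: linear_conv_bounded_linear)
  from closed_vimage[OF closed_cone_sector this] show ?thesis by (simp add: vimage_def)
qed

text \<open>Each condition avoids one hyperplane, which is a null set by absolute continuity. The
  index \<open>q\<close> repeats the line of index 0, because it is the upper bound of the last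
  cone.\<close>

lemma AE_off_rays:
  assumes M: "mass_distribution M" and y: "y \<noteq> 0"
  shows "AE z in M. \<forall>j\<le>q. Im ((proj y z - \<beta>) * cnj (zeta q ^ j)) \<noteq> 0"
proof -
  have "AE z in M. \<forall>j\<in>{..q}. Im ((proj y z - \<beta>) * cnj (zeta q ^ j)) \<noteq> 0"
  proof (rule AE_finite_allI)
    fix j
    let ?a = "jmap (zeta q ^ j *s y)" and ?b = "Im (\<beta> * cnj (zeta q ^ j))"
    have eq: "Im ((proj y z - \<beta>) * cnj (zeta q ^ j)) = ?a \<bullet> z - ?b" for z
    proof -
      have "(proj y z - \<beta>) * cnj (zeta q ^ j) = proj (zeta q ^ j *s y) z - \<beta> * cnj (zeta q ^ j)"
        by (simp only: proj_smult left_diff_distrib) (simp only: mult.commute)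
      then show ?thesis by (simp only: minus_complex.sel) (simp add: proj_def inner_commute)
    qed
    have "norm ?a = norm y" by (simp add: jmap_def norm_map norm_power norm_mult)
    then have "?a \<noteq> 0" using y by auto
    then have "negligible {z. ?a \<bullet> z = ?b}" by (intro negligible_hyperplane) auto
    moreover have "closed {z. ?a \<bullet> z = ?b}" by (rule closed_hyperplane)
    ultimately have "{z. ?a \<bullet> z = ?b} \<in> null_sets lborel"
      by (simp add: negligible_iff_null_sets null_sets_completion_iff)
    then have "{z. ?a \<bullet> z = ?b} \<in> null_sets M"
      using M by (auto simp: mass_distribution_def absolutely_continuous_def)
    then have "AE z in M. z \<notin> {z. ?a \<bullet> z = ?b}" by (rule AE_not_in)
    then show "AE z in M. Im ((proj y z - \<beta>) * cnj (zeta q ^ j)) \<noteq> 0"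
      unfolding eq by simp
  qed simp
  then show ?thesis by (simp only: atMost_iff Ball_def)
qed

definition sector_mass :: "(real^'N) measure \<Rightarrow> nat \<Rightarrow> complex^'t \<Rightarrow> complex \<Rightarrow> nat \<Rightarrow> real" where
  "sector_mass M q y \<beta> l = measure M {z. proj y z - \<beta> \<in> cone_sector q l}"

lemma sector_in_sets: "mass_distribution M \<Longrightarrow> {z. proj y z - \<beta> \<in> cone_sector q l} \<in> sets M"
  using closed_sector by (simp add: mass_distribution_def)

lemma space_mass: "mass_distribution M \<Longrightarrow> space M = UNIV"
  unfolding mass_distribution_def by (metis sets_eq_imp_space_eq space_borel)

lemma sector_mass_integral:
  assumes "mass_distribution M"
  shows "sector_mass M q y \<beta> l = (\<integral>z. indicator {z. proj y z - \<beta> \<in> cone_sector q l} z \<partial>M)"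
  using sector_in_sets[OF assms] space_mass[OF assms] by (simp add: sector_mass_def)

text \<open>The sectors cover the space and overlap only in a null set. The constant
  \<open>g\<close> gives the total mass; a general \<open>g\<close> serves the estimate for far
  centres.\<close>

lemma sum_integral_sectors:
  fixes g :: "real^'N \<Rightarrow> real"
  assumes M: "mass_distribution M" and q: "3 \<le> q" and y: "y \<noteq> 0" and g: "integrable M g"
  shows "(\<Sum>l<q. \<integral>z. indicator {z. proj y z - \<beta> \<in> cone_sector q l} z * g z \<partial>M) = integral\<^sup>L M g"
proof -
  let ?S = "\<lambda>l. {z. proj y z - \<beta> \<in> cone_sector q l}"
  have int: "integrable M (\<lambda>z. indicator (?S l) z * g z)" for l
    using integrable_mult_indicator[OF sector_in_sets[OF M] g] by simp
  have "(\<Sum>l<q. \<integral>z. indicator (?S l) z * g z \<partial>M) = (\<integral>z. (\<Sum>l<q. indicator (?S l) z * g z) \<partial>M)"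
    by (rule Bochner_Integration.integral_sum[symmetric]) (rule int)
  also have "\<dots> = integral\<^sup>L M g"
  proof (rule integral_cong_AE)
    show "(\<lambda>z. \<Sum>l<q. indicator (?S l) z * g z) \<in> borel_measurable M"
      using int by (intro borel_measurable_sum) auto
    show "AE z in M. (\<Sum>l<q. indicator (?S l) z * g z) = g z"
      using AE_off_rays[OF M y, of q \<beta>]
    proof eventually_elim
      case (elim z)
      obtain l where l: "l < q" "proj y z - \<beta> \<in> cone_sector q l"
        and uniq: "\<And>l'. l' < q \<Longrightarrow> proj y z - \<beta> \<in> cone_sector q l' \<Longrightarrow> l' = l"
        using cone_sector_unique[OF q, of "proj y z - \<beta>"] elim by blast
      have "(\<Sum>l'<q. indicator (?S l') z * g z) = (\<Sum>l'<q. if l' = l then g z else 0)"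
      proof (intro sum.cong refl)
        fix l' assume "l' \<in> {..<q}"
        then have "proj y z - \<beta> \<in> cone_sector q l' \<longleftrightarrow> l' = l" using l uniq by blast
        then show "indicator (?S l') z * g z = (if l' = l then g z else 0)" by (simp add: indicator_def)
      qed
      then show ?case using l(1) by simp
    qed
  qed (use g in auto)
  finally show ?thesis .
qed

lemma finite_measure_mass: "mass_distribution M \<Longrightarrow> finite_measure M"
  by (simp add: mass_distribution_def)

lemma sum_sector_mass:
  assumes M: "mass_distribution M" and "3 \<le> q" "y \<noteq> 0"
  shows "(\<Sum>l<q. sector_mass M q y \<beta> l) = measure M UNIV"
proof -
  interpret finite_measure M using M by (rule finite_measure_mass)
  show ?thesis
    using sum_integral_sectors[OF assms, of "\<lambda>_. 1" \<beta>] space_mass[OF M]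
    by (simp add: sector_mass_integral[OF M])
qed

text \<open>Dominated convergence: for almost every \<open>z\<close> the sign conditions are strict
  in the limit, so the indicators are eventually constant along the sequence.\<close>

lemma continuous_on_sector_mass:
  assumes M: "mass_distribution M" and S: "\<And>y \<beta>. (y, \<beta>) \<in> S \<Longrightarrow> y \<noteq> 0" and l: "l < q"
  shows "continuous_on S (\<lambda>(y, \<beta>). sector_mass M q y \<beta> l)"
  unfolding continuous_on_sequentially
proof (intro allI ballI impI)
  fix u :: "nat \<Rightarrow> (complex^'t) \<times> complex" and a
  assume a: "a \<in> S" and u: "(\<forall>n. u n \<in> S) \<and> u \<longlonglongrightarrow> a"
  interpret finite_measure M using M by (rule finite_measure_mass)
  obtain y \<beta> where y: "a = (y, \<beta>)" by (cases a)
  have "y \<noteq> 0" using S a y by blast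
  let ?S = "\<lambda>y \<beta>. {z. proj y z - \<beta> \<in> cone_sector q l}"
  have "(\<lambda>n. \<integral>z. indicator (?S (fst (u n)) (snd (u n))) z \<partial>M) \<longlonglongrightarrow> (\<integral>z. indicator (?S y \<beta>) z \<partial>M :: real)"
  proof (rule integral_dominated_convergence[where w = "\<lambda>_. 1"])
    show "AE z in M. (\<lambda>n. indicator (?S (fst (u n)) (snd (u n))) z) \<longlonglongrightarrow> (indicator (?S y \<beta>) z :: real)"
      using AE_off_rays[OF M \<open>y \<noteq> 0\<close>, of q \<beta>]
    proof eventually_elim
      case (elim z)
      define w where "w n = proj (fst (u n)) z - snd (u n)" for n
      have "(\<lambda>n. fst (u n)) \<longlonglongrightarrow> y" "(\<lambda>n. snd (u n)) \<longlonglongrightarrow> \<beta>"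
        using u y tendsto_fst tendsto_snd by force+
      then have w: "w \<longlonglongrightarrow> proj y z - \<beta>"
        unfolding w_def using linear_proj_left[of z]
        by (intro tendsto_diff bounded_linear.tendsto[of "\<lambda>y. proj y z"]) (simp_all add: linear_conv_bounded_linear)
      have sign: "\<forall>\<^sub>F n in sequentially. (0 \<le> Im (w n * cnj (zeta q ^ j)) \<longleftrightarrow> 0 \<le> Im ((proj y z - \<beta>) * cnj (zeta q ^ j))) \<and>
          (Im (w n * cnj (zeta q ^ j)) \<le> 0 \<longleftrightarrow> Im ((proj y z - \<beta>) * cnj (zeta q ^ j)) \<le> 0)" if "j \<le> q" for j
      proof -
        let ?c = "Im ((proj y z - \<beta>) * cnj (zeta q ^ j))"
        have lim: "(\<lambda>n. Im (w n * cnj (zeta q ^ j))) \<longlonglongrightarrow> ?c"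
          by (intro tendsto_intros w)
        have "?c \<noteq> 0" using elim that by blast
        then consider "0 < ?c" | "?c < 0" by linarith
        then show ?thesis
        proof cases
          case 1
          from order_tendstoD(1)[OF lim 1] show ?thesis
            by eventually_elim (use 1 in linarith)
        next
          case 2
          from order_tendstoD(2)[OF lim 2] show ?thesis
            by eventually_elim (use 2 in linarith)
        qed
      qed
      have "\<forall>\<^sub>F n in sequentially. (w n \<in> cone_sector q l) = (proj y z - \<beta> \<in> cone_sector q l)"
        using eventually_conj[OF sign[of l] sign[of "Suc l"]] l
        unfolding cone_sector_def by (auto elim!: eventually_mono simp del: power_Suc times_complex.sel)
      then have "\<forall>\<^sub>F n in sequentially. indicator (?S (fst (u n)) (snd (u n))) z = (indicator (?S y \<beta>) z :: real)"
        by eventually_elim (simp add: w_def indicator_def)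
      then show ?case by (rule tendsto_eventually)
    qed
    show "indicator (?S y \<beta>) \<in> borel_measurable M"
      "(\<lambda>z. indicator (?S (fst (u n)) (snd (u n))) z) \<in> borel_measurable M" for n
      by (intro borel_measurable_indicator sector_in_sets M)+
  qed (simp_all add: indicator_def)
  then show "((\<lambda>(y, \<beta>). sector_mass M q y \<beta> l) \<circ> u) \<longlonglongrightarrow> (\<lambda>(y, \<beta>). sector_mass M q y \<beta> l) a"
    by (simp add: y o_def case_prod_beta sector_mass_integral[OF M])
qed

definition fourier :: "(real^'N) measure \<Rightarrow> nat \<Rightarrow> nat \<Rightarrow> complex^'t \<Rightarrow> complex \<Rightarrow> complex" where
  "fourier M q p y \<beta> = (\<Sum>l<q. cnj (zeta q ^ (p * l)) * of_real (sector_mass M q y \<beta> l))"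

lemma continuous_on_fourier:
  assumes "mass_distribution M" "\<And>y \<beta>. (y, \<beta>) \<in> S \<Longrightarrow> y \<noteq> 0"
  shows "continuous_on S (\<lambda>(y, \<beta>). fourier M q p y \<beta>)"
proof -
  have "continuous_on S (\<lambda>x. cnj (zeta q ^ (p * l)) * of_real (sector_mass M q (fst x) (snd x) l))" if "l < q" for l
    using continuous_on_sector_mass[OF assms that]
    by (intro continuous_intros) (simp_all add: case_prod_beta)
  then show ?thesis
    unfolding fourier_def case_prod_beta by (intro continuous_on_sum) auto
qed

lemma norm_fourier_le:
  assumes "mass_distribution M" "3 \<le> q" "y \<noteq> 0"
  shows "norm (fourier M q p y \<beta>) \<le> measure M UNIV"
proof -
  have "norm (fourier M q p y \<beta>) \<le> (\<Sum>l<q. norm (cnj (zeta q ^ (p * l)) * of_real (sector_mass M q y \<beta> l)))"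
    unfolding fourier_def by (rule norm_sum)
  also have "\<dots> = (\<Sum>l<q. sector_mass M q y \<beta> l)"
    by (simp add: norm_mult norm_power sector_mass_def)
  finally show ?thesis using sum_sector_mass[OF assms] by simp
qed

text \<open>Rotating \<open>y\<close> shifts the sectors cyclically by \<open>r\<close>, and a shift
  multiplies a Fourier coefficient by a character value. The centre rotates conjugately because
  \<open>proj\<close> is conjugate linear in \<open>y\<close>.\<close>

lemma fourier_rotate:
  assumes "0 < q"
  shows "fourier M q p (zeta q ^ r *s y) (cnj (zeta q ^ r) * \<beta>) = zeta q ^ (p * r) * fourier M q p y \<beta>"
proof -
  have mass: "sector_mass M q (zeta q ^ r *s y) (cnj (zeta q ^ r) * \<beta>) l = sector_mass M q y \<beta> (l + r)" for l
  proof -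
    have "proj (zeta q ^ r *s y) z - cnj (zeta q ^ r) * \<beta> = cnj (zeta q ^ r) * (proj y z - \<beta>)" for z
      by (simp only: proj_smult right_diff_distrib)
    then show ?thesis unfolding sector_mass_def by (simp only: cone_sector_rotate)
  qed
  define g where "g l = cnj (zeta q ^ (p * l)) * of_real (sector_mass M q y \<beta> l)" for l
  have g: "g (l + q) = g l" for l
  proof -
    have "zeta q ^ (p * (l + q)) = zeta q ^ (p * l) * (zeta q ^ q) ^ p"
      by (simp add: distrib_left power_add power_mult[symmetric] mult.commute)
    then show ?thesis
      using assms by (simp add: g_def sector_mass_def cone_sector_periodic)
  qed
  have "cnj (zeta q ^ (p * l)) * of_real (sector_mass M q y \<beta> (l + r)) = zeta q ^ (p * r) * g (l + r)" for l
  proof -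
    have "zeta q ^ (p * r) * g (l + r) = (zeta q ^ (p * r) * cnj (zeta q ^ (p * r))) *
        (cnj (zeta q ^ (p * l)) * of_real (sector_mass M q y \<beta> (l + r)))"
      by (simp add: g_def distrib_left power_add mult_ac)
    then show ?thesis by (simp only: zeta_cnj_power mult_1_left)
  qed
  then have "fourier M q p (zeta q ^ r *s y) (cnj (zeta q ^ r) * \<beta>) = zeta q ^ (p * r) * (\<Sum>l<q. g (l + r))"
    unfolding fourier_def mass by (simp only: sum_distrib_left)
  then show ?thesis
    unfolding sum_lessThan_periodic[of g, OF g] by (simp add: fourier_def g_def)
qed

lemma fourier_zero_imp_equipartition:
  assumes M: "mass_distribution M" and q: "3 \<le> q" "odd q" and y: "norm y = 1"
    and zero: "\<And>p. 1 \<le> p \<Longrightarrow> p \<le> (q - 1) div 2 \<Longrightarrow> fourier M q p y \<beta> = 0"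
  shows "equipartitions q (center y \<beta>) (direction q y) M"
  unfolding equipartitions_def
proof (intro allI impI)
  fix l assume l: "l < q"
  have "sector_mass M q y \<beta> l = (\<Sum>l<q. sector_mass M q y \<beta> l) / q"
    using zero by (intro constant_if_fourier_zero[OF q(2) _ l]) (simp add: fourier_def)
  moreover have "y \<noteq> 0" using y by auto
  ultimately show "measure M (regular_sector (center y \<beta>) (direction q y) l) = measure M UNIV / q"
    unfolding regular_sector_center[OF q(1) y] sector_mass_def[symmetric] using sum_sector_mass[OF M q(1)] by simp
qed

text \<open>Far away centres see almost the whole mass in the sector pointing back to the origin, so
  the first Fourier coefficient follows the direction of the centre.\<close>

lemma fourier_far_center:
  assumes M: "mass_distribution M" and q: "3 \<le> q" and pos: "0 < measure M UNIV"
  obtains R where "0 < R" "\<And>y b. norm y = 1 \<Longrightarrow> R \<le> norm b \<Longrightarrow>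
      0 < Re (cnj (- cis (pi / q) * b) * fourier M q 1 y (cnj b))"
proof -
  interpret finite_measure M using M by (rule finite_measure_mass)
  \<comment> \<open>A lower bound, valid in whichever sector contains \<open>z\<close>, for Re (-
    \<beta> * cnj (e l)) divided by the norm of \<open>\<beta>\<close>. The 1/2 comes from the
    bisector estimate, the 3 is 3/2 times the constant in \<open>norm_proj_le\<close>, and the
    cutoff - 1 holds since \<open>e l\<close> has norm 1.\<close>
  define g where "g R z = max (1 / 2 - 3 * norm z / R) (- 1)" for R :: real and z :: "real^'N"
  have bM: "borel_measurable M = borel_measurable borel"
  proof -
    have "sets M = sets borel" using M by (simp add: mass_distribution_def)
    then show ?thesis by (rule measurable_cong_sets[OF _ refl])
  qed
  have gm: "g R \<in> borel_measurable M" for R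
    unfolding g_def bM by measurable
  have gb: "norm (g R z) \<le> 1" if "0 \<le> R" for R z
  proof -
    have "0 \<le> 3 * norm z / R" using that by simp
    then show ?thesis by (auto simp: g_def max_def)
  qed
  have gi: "integrable M (g R)" if "0 \<le> R" for R
    using gm gb[OF that] by (intro integrable_const_bound[of _ 1]) auto
  \<comment> \<open>As the radius grows, the bound tends to 1/2 pointwise, so its integral becomes
    positive; this determines \<open>R\<close>.\<close>
  have "(\<lambda>n. integral\<^sup>L M (g (real n))) \<longlonglongrightarrow> (\<integral>z. 1 / 2 \<partial>M)"
  proof (rule integral_dominated_convergence[where w = "\<lambda>_. 1"])
    have "(\<lambda>n. g (real n) z) \<longlonglongrightarrow> max (1 / 2 - 0) (- 1)" for z
      unfolding g_def by (intro tendsto_intros tendsto_max lim_const_over_n)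
    then show "AE z in M. (\<lambda>n. g (real n) z) \<longlonglongrightarrow> 1 / 2" by simp
  qed (use gm gb in auto)
  then have "(\<lambda>n. integral\<^sup>L M (g (real n))) \<longlonglongrightarrow> measure M UNIV / 2"
    using space_mass[OF M] by simp
  from order_tendstoD(1)[OF this, of 0] pos have "\<forall>\<^sub>F n in sequentially. 0 < integral\<^sup>L M (g (real n))" by simp
  then obtain n0 where n0: "\<And>n. n0 \<le> n \<Longrightarrow> 0 < integral\<^sup>L M (g (real n))"
    unfolding eventually_sequentially by blast
  define R where "R = real (Suc n0)"
  have R: "0 < R" "0 < integral\<^sup>L M (g R)" using n0[of "Suc n0"] by (simp_all add: R_def)
  show thesis
  proof (rule that[OF R(1)])
    fix y :: "complex^'t" and b :: complex assume y: "norm y = 1" and b: "R \<le> norm b"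
    define \<beta> where "\<beta> = cnj b"
    define e where "e l = cis (pi / q) * zeta q ^ l" for l
    let ?S = "\<lambda>l. {z. proj y z - \<beta> \<in> cone_sector q l}"
    have ne: "norm (e l) = 1" for l by (simp add: e_def norm_mult norm_power)
    have n\<beta>: "norm \<beta> = norm b" "R \<le> norm \<beta>" "0 < norm \<beta>"
      using b R(1) by (auto simp: \<beta>_def)
    have y0: "y \<noteq> 0" using y by auto
    have lower: "norm \<beta> * g R z \<le> Re (- \<beta> * cnj (e l))" if z: "z \<in> ?S l" for z l
    proof -
      define w where "w = proj y z - \<beta>"
      have "norm w / 2 \<le> Re (w * cnj (e l))"
        using Re_midpoint_cone_sector[OF q, of "proj y z - \<beta>" l] z
        unfolding w_def e_def by (simp only: mem_Collect_eq)
      moreover have "Re (w * cnj (e l)) = Re (- \<beta> * cnj (e l)) + Re (proj y z * cnj (e l))"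
        by (simp add: w_def algebra_simps)
      moreover have "Re (proj y z * cnj (e l)) \<le> norm (proj y z)"
      proof -
        have "norm (proj y z * cnj (e l)) = norm (proj y z)" by (simp add: norm_mult ne)
        then show ?thesis using complex_Re_le_cmod by metis
      qed
      moreover have "norm \<beta> \<le> norm w + norm (proj y z)"
        using norm_triangle_ineq4[of "proj y z" w] by (simp add: w_def)
      moreover note norm_proj_le[OF y, of z]
      ultimately have 1: "norm \<beta> / 2 - 3 * norm z \<le> Re (- \<beta> * cnj (e l))" by linarith
      have "norm z \<le> norm \<beta> * (norm z / R)"
        using n\<beta> R(1) mult_right_mono[OF n\<beta>(2), of "norm z"] by (simp add: field_simps)
      moreover have "norm \<beta> * (1 / 2 - 3 * norm z / R) = norm \<beta> / 2 - 3 * (norm \<beta> * (norm z / R))"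
        by (simp add: right_diff_distrib)
      ultimately have "norm \<beta> * (1 / 2 - 3 * norm z / R) \<le> norm \<beta> / 2 - 3 * norm z"
        by linarith
      with 1 have 2: "norm \<beta> * (1 / 2 - 3 * norm z / R) \<le> Re (- \<beta> * cnj (e l))" by linarith
      have "\<bar>Re (- \<beta> * cnj (e l))\<bar> \<le> norm \<beta>"
      proof -
        have "norm (- \<beta> * cnj (e l)) = norm \<beta>" by (simp add: norm_mult ne)
        then show ?thesis using abs_Re_le_cmod by metis
      qed
      then have "norm \<beta> * (- 1) \<le> Re (- \<beta> * cnj (e l))" by linarith
      with 2 show ?thesis by (simp add: g_def max_def)
    qed
    have Re_mult: "Re (x * of_real r) = Re x * r" for x r by simp
    \<comment> \<open>The real part is thus a sum of sector masses weighted by the component of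
      \<open>- \<beta>\<close> along the bisector of each sector.\<close>
    have "cnj (- cis (pi / q) * b) * fourier M q 1 y (cnj b) =
        (\<Sum>l<q. (- \<beta> * cnj (e l)) * of_real (sector_mass M q y \<beta> l))"
      unfolding fourier_def sum_distrib_left by (intro sum.cong refl) (simp add: e_def \<beta>_def mult_ac)
    then have "Re (cnj (- cis (pi / q) * b) * fourier M q 1 y (cnj b)) =
        (\<Sum>l<q. Re (- \<beta> * cnj (e l)) * sector_mass M q y \<beta> l)"
      by (simp only: Re_sum Re_mult)
    also have "\<dots> \<ge> (\<Sum>l<q. \<integral>z. indicator (?S l) z * (norm \<beta> * g R z) \<partial>M)"
    proof (rule sum_mono)
      fix l assume "l \<in> {..<q}"
      have iS: "integrable M (indicator (?S l) :: _ \<Rightarrow> real)"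
        using sector_in_sets[OF M] by (simp add: emeasure_finite less_top[symmetric])
      have "(\<integral>z. indicator (?S l) z * (norm \<beta> * g R z) \<partial>M) \<le> (\<integral>z. Re (- \<beta> * cnj (e l)) * indicator (?S l) z \<partial>M)"
      proof (rule integral_mono)
        show "integrable M (\<lambda>z. indicator (?S l) z * (norm \<beta> * g R z))"
          using integrable_mult_indicator[OF sector_in_sets[OF M], of "\<lambda>z. norm \<beta> * g R z" y \<beta> q l] gi[of R] R(1) by simp
        show "integrable M (\<lambda>z. Re (- \<beta> * cnj (e l)) * indicator (?S l) z)"
          using iS by simp
        show "indicator (?S l) z * (norm \<beta> * g R z) \<le> Re (- \<beta> * cnj (e l)) * indicator (?S l) z" for z
          using lower[of z l] by (cases "z \<in> ?S l") (auto simp del: times_complex.sel)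
      qed
      then show "(\<integral>z. indicator (?S l) z * (norm \<beta> * g R z) \<partial>M) \<le> Re (- \<beta> * cnj (e l)) * sector_mass M q y \<beta> l"
        by (simp add: sector_mass_integral[OF M] del: times_complex.sel)
    qed
    also have "(\<Sum>l<q. \<integral>z. indicator (?S l) z * (norm \<beta> * g R z) \<partial>M) = norm \<beta> * integral\<^sup>L M (g R)"
      using sum_integral_sectors[OF M q y0, of "\<lambda>z. norm \<beta> * g R z" \<beta>] gi[of R] R(1) by simp
    finally show "0 < Re (cnj (- cis (pi / q) * b) * fourier M q 1 y (cnj b))"
      using R(2) n\<beta>(3) by (meson less_le_trans mult_pos_pos)
  qed
qed

end

section \<open>Equipartitions\<close>

lemma continuous_map_nsphere_iff:
  "continuous_map (nsphere n) euclidean f \<longleftrightarrow> continuous_on (topspace (nsphere n)) f"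
proof -
  have "nsphere n = top_of_set (topspace (nsphere n))"
    unfolding nsphere euclidean_product_topology by simp
  then show ?thesis by (metis continuous_map_iff_continuous)
qed

lemma sgn_smult: "norm c = 1 \<Longrightarrow> sgn (c *s (z :: complex^'n)) = c *s sgn z"
  by (simp add: sgn_div_norm vec_eq_iff)

text \<open>A stand-in for masses that vanish identically: the estimate for far centres requires
  positive total mass.\<close>

lemma mass_distribution_uniform_ball: "mass_distribution (density lborel (indicator (cball (0 :: real^'n) 1)))"
  and measure_uniform_ball_pos: "0 < measure (density lborel (indicator (cball (0 :: real^'n) 1))) UNIV"
proof -
  let ?M = "density lborel (indicator (cball (0 :: real^'n) 1))"
  have M: "emeasure ?M UNIV = emeasure lborel (cball (0 :: real^'n) 1)"
    by (subst emeasure_density) (auto intro!: borel_measurable_indicator)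
  have fin: "emeasure lborel (cball (0 :: real^'n) 1) < \<infinity>"
    by (intro emeasure_bounded_finite bounded_cball)
  have "finite_measure ?M"
    by (rule finite_measureI) (use fin M in auto)
  then show "mass_distribution ?M"
    unfolding mass_distribution_def
    by (intro conjI absolutely_continuousI_density borel_measurable_indicator) simp_all
  have "measure ?M UNIV = measure lborel (cball (0 :: real^'n) 1)"
    unfolding measure_def M ..
  then show "0 < measure ?M UNIV"
    using content_cball_pos[of 1 "0 :: real^'n"] by simp
qed

context complex_structure
begin

lemma equipartitions_of_null_mass:
  assumes "mass_distribution M" "measure M UNIV = 0"
  shows "equipartitions q A d M"
proof -
  interpret finite_measure M using assms(1) by (rule finite_measure_mass)
  have "measure M S = 0" for S
    using bounded_measure[of S] assms(2) space_mass[OF assms(1)] by (simp add: measure_le_0_iff)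
  then show ?thesis by (simp add: equipartitions_def)
qed

text \<open>The exponent of \<open>zeta q\<close> with which \<open>frame_rot\<close> turns the
  \<open>i\<close>-th vector of a frame.\<close>

definition weight :: "nat \<Rightarrow> nat \<Rightarrow> nat" where
  "weight r i = (if i = 1 then 1 else r)"

text \<open>The first fan has centre \<open>cnj b\<close> after rescaling \<open>(z, b)\<close> to \<open>norm z = 1\<close>, the other fans
  pass through the origin.  At \<open>z = 0\<close> the factor \<open>norm z\<close> hides the junk values of \<open>sgn\<close> and of
  the division.\<close>

definition cone_fourier ::
    "(complex^'t \<Rightarrow> nat \<Rightarrow> complex^'t) \<Rightarrow> (real^'N) measure \<Rightarrow> nat \<Rightarrow> nat \<Rightarrow> nat \<Rightarrow> complex^'t \<Rightarrow> complex \<Rightarrow> complex" where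
  "cone_fourier s M q i p z b = of_real (norm z) *
     fourier M q p (s (sgn z) i) (if i = 1 then cnj b / of_real (norm z) else 0)"

text \<open>Where \<open>z\<close> is nonzero this is a composition of continuous maps. At
  \<open>z = 0\<close> the factor \<open>norm z\<close> tends to 0 while the Fourier coefficient
  stays bounded by the total mass.\<close>

lemma continuous_on_cone_fourier:
  assumes M: "mass_distribution M" and q: "3 \<le> q"
    and cont: "continuous_on (sphere 0 1) (\<lambda>x. s x i)" and s: "\<And>x. norm x = 1 \<Longrightarrow> norm (s x i) = 1"
  shows "continuous_on UNIV (\<lambda>(z, b). cone_fourier s M q i p z b)"
proof -
  let ?F = "\<lambda>(z, b). cone_fourier s M q i p z b" and ?D = "{(z, b). z \<noteq> 0} :: ((complex^'t) \<times> complex) set"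
  have D: "open ?D"
  proof -
    have "?D = (- {0}) \<times> UNIV" by auto
    moreover have "open ((- {0 :: complex^'t}) \<times> (UNIV :: complex set))"
      by (intro open_Times open_Compl closed_singleton open_UNIV)
    ultimately show ?thesis by metis
  qed
  have cD: "continuous_on ?D ?F"
  proof -
    let ?\<beta> = "\<lambda>x. if i = 1 then cnj (snd x) / of_real (norm (fst x)) else 0"
    have fst0: "fst x \<noteq> 0" if "x \<in> ?D" for x :: "(complex^'t) \<times> complex"
      using that by (simp add: case_prod_beta)
    then have nsgn: "norm (sgn (fst x)) = 1" if "x \<in> ?D" for x :: "(complex^'t) \<times> complex"
      using that by (simp add: norm_sgn)
    have 1: "continuous_on ?D (\<lambda>x. s (sgn (fst x)) i)"
    proof (rule continuous_on_compose2[OF cont])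
      show "continuous_on ?D (\<lambda>x. sgn (fst x))"
        using fst0 by (intro continuous_on_sgn continuous_on_fst continuous_on_id ballI) blast
      show "(\<lambda>x. sgn (fst x)) ` ?D \<subseteq> sphere 0 1"
        using nsgn by (intro image_subsetI) simp
    qed
    have 2: "continuous_on ?D ?\<beta>"
    proof (cases "i = 1")
      case True
      have "continuous_on ?D (\<lambda>x. cnj (snd x) / of_real (norm (fst x)))"
        using fst0 by (intro continuous_intros ballI) (simp only: of_real_eq_0_iff norm_eq_zero not_False_eq_True)
      with True show ?thesis by (simp only: if_True simp_thms)
    qed simp
    have 3: "y \<noteq> 0" if "(y, \<beta>) \<in> (\<lambda>x. (s (sgn (fst x)) i, ?\<beta> x)) ` ?D" for y \<beta>
    proof -
      from that obtain x where "x \<in> ?D" "(y, \<beta>) = (s (sgn (fst x)) i, ?\<beta> x)" by (rule imageE)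
      then have "norm y = 1" using s[OF nsgn] by (simp only: prod.inject)
      then show ?thesis by auto
    qed
    have 4: "continuous_on ?D (\<lambda>x. fourier M q p (s (sgn (fst x)) i) (?\<beta> x))"
      using continuous_on_compose2[OF continuous_on_fourier[where q = q and p = p, OF M 3] continuous_on_Pair[OF 1 2] order_refl]
      by (simp only: prod.case)
    have "continuous_on ?D (\<lambda>x. complex_of_real (norm (fst x)))"
      by (intro continuous_intros)
    from continuous_on_mult[OF this 4] show ?thesis
      by (simp only: cone_fourier_def case_prod_unfold)
  qed
  have off: "isCont ?F x" if "x \<in> ?D" for x
    by (rule continuous_on_eq_continuous_at[OF D, THEN iffD1, OF cD, rule_format, OF that])
  have bound: "norm (?F x) \<le> norm (fst x) * measure M UNIV" for x
  proof (cases "fst x = 0")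
    case False
    then have "norm (s (sgn (fst x)) i) = 1" by (intro s) (simp add: norm_sgn)
    then have "s (sgn (fst x)) i \<noteq> 0" by (metis norm_zero zero_neq_one)
    from norm_fourier_le[OF M q this] show ?thesis
      unfolding case_prod_unfold cone_fourier_def norm_mult norm_of_real abs_norm_cancel
      by (rule mult_left_mono) simp
  qed (simp add: cone_fourier_def case_prod_beta)
  have on: "isCont ?F x" if "x \<notin> ?D" for x
  proof -
    have x: "fst x = 0" using that by (auto simp: case_prod_beta)
    have "((\<lambda>x. norm (fst x) * measure M UNIV) \<longlongrightarrow> norm (fst x) * measure M UNIV) (at x)"
      by (intro tendsto_intros)
    then have "((\<lambda>x. norm (fst x) * measure M UNIV) \<longlongrightarrow> 0) (at x)" using x by simp
    then have "(?F \<longlongrightarrow> 0) (at x)"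
      by (rule Lim_null_comparison[rotated]) (intro always_eventually allI bound)
    moreover have "?F x = 0" using x by (simp add: cone_fourier_def case_prod_beta)
    ultimately show ?thesis unfolding isCont_def by simp
  qed
  show ?thesis
  proof (intro continuous_at_imp_continuous_on ballI)
    show "isCont ?F x" for x by (cases "x \<in> ?D") (rule off, assumption, rule on)
  qed
qed

lemma cone_fourier_rotate:
  assumes q: "0 < q"
    and s: "\<And>x j. norm x = 1 \<Longrightarrow> s (zeta q *s x) i = zeta q ^ weight r i *s s x i"
  shows "cone_fourier s M q i p (zeta q *s z) (zeta q * b) = zeta q ^ (p * weight r i) * cone_fourier s M q i p z b"
proof (cases "z = 0")
  case False
  then have n: "norm (sgn z) = 1" by (simp add: norm_sgn)
  define \<beta> where "\<beta> = (if i = 1 then cnj b / of_real (norm z) else 0)"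
  have "(if i = 1 then cnj (zeta q * b) / of_real (norm (zeta q *s z)) else 0) = cnj (zeta q ^ weight r i) * \<beta>"
    by (auto simp: \<beta>_def weight_def)
  moreover have "s (sgn (zeta q *s z)) i = zeta q ^ weight r i *s s (sgn z) i"
    using s[OF n] by (simp add: sgn_smult)
  ultimately have "fourier M q p (s (sgn (zeta q *s z)) i) (if i = 1 then cnj (zeta q * b) / of_real (norm (zeta q *s z)) else 0)
      = zeta q ^ (p * weight r i) * fourier M q p (s (sgn z) i) \<beta>"
    using fourier_rotate[OF q, of M p "weight r i" "s (sgn z) i" \<beta>] by simp
  then show ?thesis
    unfolding cone_fourier_def by (simp add: \<beta>_def)
qed (simp add: cone_fourier_def)

text \<open>Only the coefficient with fan 1, mass 0 and index 1 is corrected, so positivity is asked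
  of \<open>\<mu> 0\<close> alone. The other coefficients vanish as soon as the correction
  does.\<close>

lemma common_zero_of_fourier_coefficients:
  fixes \<mu> :: "nat \<Rightarrow> (real^'N) measure"
  assumes q: "prime q" "3 \<le> q" and m: "1 \<le> m" and k: "1 \<le> k" and r: "coprime r q"
    and count: "k * m * ((q - 1) div 2) \<le> CARD('t)"
    and s1: "\<And>x. norm x = 1 \<Longrightarrow> s x 1 = x"
    and s_rot: "\<And>x i. norm x = 1 \<Longrightarrow> i \<in> {1..k} \<Longrightarrow> s (zeta q *s x) i = zeta q ^ weight r i *s s x i"
    and s_norm: "\<And>x i. norm x = 1 \<Longrightarrow> i \<in> {1..k} \<Longrightarrow> norm (s x i) = 1"
    and s_cont: "\<And>i. i \<in> {1..k} \<Longrightarrow> continuous_on (sphere 0 1) (\<lambda>x. s x i)"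
    and \<mu>: "\<And>j. j < m \<Longrightarrow> mass_distribution (\<mu> j)" and pos: "0 < measure (\<mu> 0) UNIV"
  obtains x \<beta> where "norm x = 1"
    "\<And>i j p. i \<in> {1..k} \<Longrightarrow> j < m \<Longrightarrow> p \<in> {1..(q - 1) div 2} \<Longrightarrow> fourier (\<mu> j) q p (s x i) (\<beta> i) = 0"
proof -
  define T where "T = CARD('t)"
  obtain idx :: "'t \<Rightarrow> nat" where idx: "bij_betw idx UNIV {..<T}"
    using ex_bij_betw_finite_nat[OF finite_class.finite_UNIV[where 'a = 't]] by (auto simp: T_def lessThan_atLeast0)
  let ?X = "nsphere (Suc (2 * T))"
  define zv where "zv x = (\<chi> i. complex_coord x (idx i))" for x
  define bv where "bv x = complex_coord x T" for x
  have sphere: "(norm (zv x))\<^sup>2 + (norm (bv x))\<^sup>2 = 1" if "x \<in> topspace ?X" for x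
  proof -
    have "(norm (zv x))\<^sup>2 = (\<Sum>i\<in>UNIV. (norm (complex_coord x (idx i)))\<^sup>2)"
      by (simp add: zv_def norm_vec_def L2_set_def sum_nonneg real_sqrt_pow2)
    also have "\<dots> = (\<Sum>l<T. (norm (complex_coord x l))\<^sup>2)"
      by (rule sum.reindex_bij_betw[OF idx])
    finally show ?thesis
      using that unfolding topspace_odd_nsphere by (simp add: bv_def lessThan_Suc_atMost[symmetric])
  qed
  obtain R where R: "0 < R" "\<And>y b. norm y = 1 \<Longrightarrow> R \<le> norm b \<Longrightarrow>
      0 < Re (cnj (- cis (pi / q) * b) * fourier (\<mu> 0) q 1 y (cnj b))"
    using fourier_far_center[OF \<mu>[of 0] q(2) pos] m by auto
  \<comment> \<open>The direction, relative to \<open>b\<close>, around which the first coefficient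
    of a far centre is confined to an open half plane.\<close>
  define \<kappa> where "\<kappa> = - cis (pi / real q)"
  define I where "I = {1..k} \<times> {..<m} \<times> {1..(q - 1) div 2}"
  have cardI: "finite I" "card I \<le> T"
    using count by (simp_all add: I_def T_def mult.assoc)
  \<comment> \<open>As \<open>p\<close> is at most \<open>(q - 1) div 2\<close> and \<open>q\<close>
    is prime, \<open>p\<close> is a unit modulo \<open>q\<close>; so is the weight, which is 1 or
    \<open>r\<close>. The inverse exponent normalizes the action to weight one.\<close>
  have ex_e: "\<exists>e. p * weight r i * e mod q = 1" if "(i, j, p) \<in> I" for i j p
  proof -
    have p: "1 \<le> p" "p \<le> (q - 1) div 2" using that by (auto simp: I_def)
    then have "p < q" using q(2) by linarith
    with p have "\<not> q dvd p" using nat_dvd_not_less by simp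
    then have "coprime p q"
      using q(1) prime_imp_coprime coprime_commute by blast
    then have cop: "gcd (p * weight r i) q = 1" using r by (simp add: weight_def)
    then have "p * weight r i \<noteq> 0" using q(2) by (intro notI) simp
    then obtain e l where "p * weight r i * e = q * l + 1"
      using bezout_nat[of "p * weight r i" q] cop by auto
    then have "p * weight r i * e mod q = (1 + q * l) mod q" by simp
    also have "\<dots> = 1 mod q" by (rule mod_mult_self2)
    finally show ?thesis using q(2) by auto
  qed
  define e where "e c = (case c of (i, j :: nat, p) \<Rightarrow> SOME e. p * weight r i * e mod q = 1)" for c
  have e: "p * weight r i * e (i, j, p) mod q = 1" if "(i, j, p) \<in> I" for i j p
    using someI_ex[OF ex_e[OF that]] by (simp add: e_def)
  txt \<open>The correction \<open>corr\<close> excludes zeros whose first centre is farther than \<open>R\<close> from the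
    origin, in particular those with \<open>z = 0\<close>.\<close>
  define corr where "corr z b = of_real (max 0 (norm b - R * norm z)) * (\<kappa> * b)" for z :: "complex^'t" and b
  define H where "H = (\<lambda>(i, j, p) z b. cone_fourier s (\<mu> j) q i p z b + (if (i, j, p) = (1, 0, 1) then corr z b else 0))"
  define h where "h c x = H c (zv x) (bv x) ^ e c" for c x
  have contH: "continuous_on UNIV (\<lambda>(z, b). H c z b)" if c: "c \<in> I" for c
  proof -
    obtain i j p where ijp: "c = (i, j, p)" "i \<in> {1..k}" "j < m" using c by (auto simp: I_def)
    have 1: "continuous_on UNIV (\<lambda>x. cone_fourier s (\<mu> j) q i p (fst x) (snd x))"
      using continuous_on_cone_fourier[where s = s and i = i and p = p,
          OF \<mu>[OF ijp(3)] q(2) s_cont[OF ijp(2)] s_norm[OF _ ijp(2)]]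
      by (simp add: case_prod_beta)
    have 2: "continuous_on UNIV (\<lambda>x. if c = (1, 0, 1) then corr (fst x) (snd x) else 0)"
      unfolding corr_def by (cases "c = (1, 0, 1)") (auto intro!: continuous_intros)
    show ?thesis
      using continuous_on_add[OF 1 2] unfolding H_def ijp(1) case_prod_beta by (simp only: fst_conv snd_conv)
  qed
  have cont: "continuous_map ?X euclidean (h c)" if c: "c \<in> I" for c
  proof -
    have coord: "continuous_on (topspace ?X) (\<lambda>x. complex_coord x l)" for l
      using continuous_map_complex_coord[of "Suc (2 * T)" l] by (simp add: continuous_map_nsphere_iff)
    have "continuous_on (topspace ?X) (\<lambda>x. (\<lambda>(z, b). H c z b) (zv x, bv x))"
      unfolding zv_def bv_def
      by (rule continuous_on_compose2[OF contH[OF c]]) (auto intro!: continuous_intros coord)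
    then show ?thesis
      unfolding continuous_map_nsphere_iff h_def by (intro continuous_intros) simp
  qed
  have zv_rot: "zv (sphere_rot q x) = zeta q *s zv x" and bv_rot: "bv (sphere_rot q x) = zeta q * bv x" for x
    by (simp_all add: zv_def bv_def vec_eq_iff)
  have equiv: "h c (sphere_rot q x) = zeta q * h c x" if c: "c \<in> I" for c x
  proof -
    obtain i j p where ijp: "c = (i, j, p)" "i \<in> {1..k}" using c by (auto simp: I_def)
    have "H c (zeta q *s z) (zeta q * b) = zeta q ^ (p * weight r i) * H c z b" for z b
    proof -
      have cf: "cone_fourier s (\<mu> j) q i p (zeta q *s z) (zeta q * b) =
          zeta q ^ (p * weight r i) * cone_fourier s (\<mu> j) q i p z b"
        using s_rot[OF _ ijp(2)] q(2) by (intro cone_fourier_rotate) auto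
      have corr: "corr (zeta q *s z) (zeta q * b) = zeta q * corr z b"
        by (simp add: corr_def norm_mult)
      show ?thesis
      proof (cases "(i, j, p) = (1, 0, 1)")
        case True
        then have "zeta q ^ (p * weight r i) = zeta q" by (simp add: weight_def)
        with True cf corr show ?thesis
          unfolding H_def ijp(1) prod.case by (simp only: simp_thms if_True distrib_left)
      next
        case False
        with cf show ?thesis
          unfolding H_def ijp(1) prod.case by (simp only: if_False add_0_right)
      qed
    qed
    then have "h c (sphere_rot q x) = zeta q ^ (p * weight r i * e c) * h c x"
      by (simp add: h_def zv_rot bv_rot power_mult_distrib power_mult)
    moreover have "zeta q ^ (p * weight r i * e c) = zeta q"
      using e[of i j p] c q(2) zeta_power_mod[of q "p * weight r i * e c"] zeta_power_mod[of q 1]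
      by (simp add: ijp(1))
    ultimately show ?thesis by simp
  qed
  have "\<exists>x\<in>topspace ?X. \<forall>c\<in>I. h c x = 0"
    using q(2) cont equiv by (intro common_zero_of_equivariant_functions[where q = q, OF _ cardI]) auto
  then obtain x where x: "x \<in> topspace ?X" "\<And>c. c \<in> I \<Longrightarrow> h c x = 0"
    by blast
  define z where "z = zv x"
  define b where "b = bv x"
  have H0: "H c z b = 0" if "c \<in> I" for c
    using x(2)[OF that] by (simp add: h_def z_def b_def)
  have c0: "(1, 0, 1) \<in> I" using k m q(2) by (auto simp: I_def)
  have H1: "cone_fourier s (\<mu> 0) q 1 1 z b + corr z b = 0"
    using H0[OF c0] by (simp add: H_def)
  \<comment> \<open>At \<open>z = 0\<close> the vector \<open>b\<close> has norm 1 and the corrected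
    coefficient reduces to \<open>\<kappa> * b\<close>, which is not zero.\<close>
  have "z \<noteq> 0"
  proof
    assume "z = 0"
    then have "(norm b)\<^sup>2 = 1\<^sup>2" using sphere[OF x(1)] by (simp add: z_def b_def)
    then have "norm b = 1" by (rule power2_eq_imp_eq) simp_all
    moreover have "corr z b = 0" using H1 \<open>z = 0\<close> by (simp add: cone_fourier_def)
    ultimately show False using \<open>z = 0\<close> by (auto simp: corr_def \<kappa>_def)
  qed
  define y where "y = sgn z"
  have y: "norm y = 1" using \<open>z \<noteq> 0\<close> by (simp add: y_def norm_sgn)
  have nz: "0 < norm z" using \<open>z \<noteq> 0\<close> by simp
  \<comment> \<open>Otherwise the centre is far. Pairing the vanishing sum with
    \<open>\<kappa> * b'\<close> then gives a positive real part from the Fourier coefficient and a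
    nonnegative one from the correction.\<close>
  have "norm b \<le> R * norm z"
  proof (rule ccontr)
    assume far: "\<not> norm b \<le> R * norm z"
    define b' where "b' = b / of_real (norm z)"
    have b: "b = of_real (norm z) * b'" using \<open>z \<noteq> 0\<close> by (simp add: b'_def)
    have "R \<le> norm b'" using far nz by (simp add: b'_def norm_divide field_simps)
    then have Re_pos: "0 < Re (cnj (\<kappa> * b') * fourier (\<mu> 0) q 1 y (cnj b'))"
      using R(2)[OF y] by (simp add: \<kappa>_def)
    define a where "a = norm b - R * norm z"
    have "corr z b = of_real a * (\<kappa> * b)" using far by (simp add: corr_def a_def)
    moreover have "cone_fourier s (\<mu> 0) q 1 1 z b = of_real (norm z) * fourier (\<mu> 0) q 1 y (cnj b')"
      using s1[OF y] by (simp add: cone_fourier_def y_def b'_def)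
    ultimately have "cnj (\<kappa> * b') * (of_real (norm z) * fourier (\<mu> 0) q 1 y (cnj b') + of_real a * (\<kappa> * b)) = 0"
      using H1 by simp
    then have "of_real (norm z) * (cnj (\<kappa> * b') * fourier (\<mu> 0) q 1 y (cnj b')) +
        of_real (a * norm z) * (\<kappa> * b' * cnj (\<kappa> * b')) = 0"
      by (subst (asm) b) (simp add: algebra_simps)
    moreover have "\<kappa> * b' * cnj (\<kappa> * b') = of_real ((norm (\<kappa> * b'))\<^sup>2)"
      by (metis complex_norm_square of_real_power)
    ultimately have eq: "of_real (norm z) * (cnj (\<kappa> * b') * fourier (\<mu> 0) q 1 y (cnj b')) +
        of_real (a * norm z * (norm (\<kappa> * b'))\<^sup>2) = 0" by (simp only: of_real_mult)
    have Re_split: "c * Re X + d = 0" if "of_real c * X + of_real d = 0" for c d X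
      using arg_cong[OF that, of Re] by simp
    have "norm z * Re (cnj (\<kappa> * b') * fourier (\<mu> 0) q 1 y (cnj b')) + a * norm z * (norm (\<kappa> * b'))\<^sup>2 = 0"
      by (rule Re_split[OF eq])
    moreover have "0 < norm z * Re (cnj (\<kappa> * b') * fourier (\<mu> 0) q 1 y (cnj b'))"
      using Re_pos nz by simp
    moreover have "0 \<le> a * norm z * (norm (\<kappa> * b'))\<^sup>2"
      using far by (simp add: a_def)
    ultimately show False by linarith
  qed
  then have corr0: "corr z b = 0" by (simp add: corr_def)
  show thesis
  proof (rule that[OF y])
    fix i j p assume "i \<in> {1..k}" "j < m" "p \<in> {1..(q - 1) div 2}"
    then have "(i, j, p) \<in> I" by (simp add: I_def)
    from H0[OF this] have "cone_fourier s (\<mu> j) q i p z b = 0"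
      by (simp only: H_def prod.case corr0 if_cancel add_0_right)
    then show "fourier (\<mu> j) q p (s y i) (if i = 1 then cnj b / of_real (norm z) else 0) = 0"
      using \<open>z \<noteq> 0\<close> by (simp only: cone_fourier_def y_def mult_eq_0_iff of_real_eq_0_iff norm_eq_zero simp_thms)
  qed
qed

text \<open>The section has \<open>K\<close> vectors, of which the first \<open>k\<close> must carry
  fans; \<open>k\<close> is cut down to what the number of coefficients permits.\<close>

lemma equipartitioning_frame:
  fixes \<mu> :: "nat \<Rightarrow> (real^'N) measure" and V :: "(nat \<Rightarrow> complex^'t) set"
  assumes q: "prime q" "odd q" and m: "1 \<le> m" and k: "1 \<le> k" "k \<le> K" "k * m \<le> n"
    and t: "CARD('t) = (q - 1) * n div 2"
    and sec: "admits_section q r K V" and r: "coprime r q" and V: "V \<subseteq> stiefel_real K"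
    and \<mu>: "\<And>j. j < m \<Longrightarrow> mass_distribution (\<mu> j)"
  obtains v \<beta> where "v \<in> V"
    "\<And>i j. i \<in> {1..k} \<Longrightarrow> j < m \<Longrightarrow> equipartitions q (center (v i) (\<beta> i)) (direction q (v i)) (\<mu> j)"
proof -
  have q3: "3 \<le> q"
    using q prime_ge_2_nat[of q] by (cases "q = 2") auto
  have V_ext: "V \<subseteq> {1..K} \<rightarrow>\<^sub>E UNIV" using V by (auto simp: stiefel_real_def)
  obtain s where s1: "\<And>x. norm x = 1 \<Longrightarrow> s x 1 = x"
    and s_rot: "\<And>x j. norm x = 1 \<Longrightarrow> s (zeta q ^ j *s x) = (frame_rot q r K ^^ j) (s x)"
    and sV: "\<And>x. norm x = 1 \<Longrightarrow> \<exists>j. s (zeta q ^ j *s x) \<in> V"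
    and s_cont: "\<And>i. i \<in> {1..K} \<Longrightarrow> continuous_on (sphere 0 1) (\<lambda>x. s x i)"
    using equivariant_frame_of_section[OF sec _ _ V_ext] k q3 by auto
  have rot: "s (zeta q ^ j *s x) i = zeta q ^ (weight r i * j) *s s x i" if "norm x = 1" "i \<in> {1..K}" for x i j
    using frame_rot_funpow[OF that(2), where q = q and r = r and j = j and v = "s x"] by (simp add: s_rot[OF that(1)] weight_def)
  have s_norm: "norm (s x i) = 1" if x: "norm x = 1" "i \<in> {1..K}" for x i
  proof -
    obtain j where "s (zeta q ^ j *s x) \<in> V" using sV[OF x(1)] by blast
    then have "norm (s (zeta q ^ j *s x) i) = 1"
      using V x(2) by (auto simp: stiefel_real_def norm_eq_1)
    then show ?thesis using rot[OF x] by (simp add: norm_power)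
  qed
  \<comment> \<open>Null masses are equipartitioned by every fan, so they may be replaced by a
    positive mass before zeros are sought.\<close>
  define \<nu> where "\<nu> j = (if measure (\<mu> j) UNIV = 0 then density lborel (indicator (cball 0 1)) else \<mu> j)" for j
  have \<nu>: "mass_distribution (\<nu> j)" if "j < m" for j
    using \<mu>[OF that] by (simp add: \<nu>_def mass_distribution_uniform_ball)
  have pos: "0 < measure (\<nu> 0) UNIV"
    using measure_uniform_ball_pos[where 'n = 'N] by (simp add: \<nu>_def zero_less_measure_iff)
  have count: "k * m * ((q - 1) div 2) \<le> CARD('t)"
  proof -
    have "even (q - 1)" using q q3 by simp
    then have "n * ((q - 1) div 2) = CARD('t)" unfolding t by (metis div_mult_swap mult.commute)
    then show ?thesis using mult_le_mono1[OF k(3)] by metis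
  qed
  obtain x \<beta> where x: "norm x = 1" and zero: "\<And>i j p. i \<in> {1..k} \<Longrightarrow> j < m \<Longrightarrow> p \<in> {1..(q - 1) div 2} \<Longrightarrow>
      fourier (\<nu> j) q p (s x i) (\<beta> i) = 0"
  proof (rule common_zero_of_fourier_coefficients[OF q(1) q3 m k(1) r count, of s \<nu>])
    show "s (zeta q *s x) i = zeta q ^ weight r i *s s x i" if "norm x = 1" "i \<in> {1..k}" for x i
      using rot[of x i 1] that k(2) by simp
  qed (use s1 s_norm s_cont \<nu> pos k(2) in auto)
  \<comment> \<open>Only some rotation of the frame at \<open>x\<close> lies in \<open>V\<close>.
    Rotating vectors and centres together multiplies each coefficient by a root of unity, so the
    zeros persist.\<close>
  obtain l where l: "s (zeta q ^ l *s x) \<in> V" using sV[OF x] by blast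
  define v where "v = s (zeta q ^ l *s x)"
  show thesis
  proof (rule that[of v "\<lambda>i. cnj (zeta q ^ (weight r i * l)) * \<beta> i"])
    show "v \<in> V" using l by (simp add: v_def)
    fix i j assume i: "i \<in> {1..k}" and j: "j < m"
    then have iK: "i \<in> {1..K}" using k(2) by auto
    have vi: "v i = zeta q ^ (weight r i * l) *s s x i" using rot[OF x iK] by (simp add: v_def)
    have nv: "norm (v i) = 1" using s_norm[OF x iK] by (simp add: vi norm_power)
    show "equipartitions q (center (v i) (cnj (zeta q ^ (weight r i * l)) * \<beta> i)) (direction q (v i)) (\<mu> j)"
    proof (cases "measure (\<mu> j) UNIV = 0")
      case True
      then show ?thesis using equipartitions_of_null_mass[OF \<mu>[OF j]] by blast
    next
      case False
      have "fourier (\<nu> j) q p (v i) (cnj (zeta q ^ (weight r i * l)) * \<beta> i) = 0"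
        if "1 \<le> p" "p \<le> (q - 1) div 2" for p
        using fourier_rotate[of q "\<nu> j" p "weight r i * l" "s x i" "\<beta> i"] zero[OF i j, of p] that q3
        by (simp add: vi)
      then have "equipartitions q (center (v i) (cnj (zeta q ^ (weight r i * l)) * \<beta> i)) (direction q (v i)) (\<nu> j)"
        by (rule fourier_zero_imp_equipartition[OF \<nu>[OF j] q3 q(2) nv])
      then show ?thesis using False by (simp add: \<nu>_def)
    qed
  qed
qed

end

section \<open>From equipartitioning frames to the two lower bounds\<close>

lemma complex_structure_exists:
  assumes "CARD('N::finite) = 2 * CARD('t::finite)"
  obtains \<phi> :: "complex^'t \<Rightarrow> real^'N" where "complex_structure \<phi>"
proof -
  have "DIM(complex^'t) = DIM(real^'N)" using assms by simp
  then obtain f :: "complex^'t \<Rightarrow> real^'N" and g where "linear f" "\<And>x. norm (f x) = norm x"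
    by (rule isomorphisms_UNIV_UNIV) blast
  then show ?thesis by (intro that[of f]) (simp add: complex_structure_def)
qed

lemma fans_independent_le_dim:
  fixes A :: "nat \<Rightarrow> (real^'n) set"
  assumes "\<And>i. i < k \<Longrightarrow> regular_fan q (A i) (d i)" "independent_subspaces k (\<lambda>i. fan_perp q (A i) (d i))"
  shows "k \<le> CARD('n)"
proof (rule independent_subspaces_le_dim[OF assms(2)])
  show "subspace (fan_perp q (A i) (d i))" for i by (simp add: fan_perp_def)
  show "\<exists>v\<in>fan_perp q (A i) (d i). v \<noteq> 0" if "i < k" for i
    using fan_perp_nonzero[OF assms(1)[OF that]] by blast
qed

lemma mass_distribution_null: "mass_distribution (null_measure borel)"
  by (auto simp: mass_distribution_def absolutely_continuous_def null_sets_def intro!: finite_measureI)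

text \<open>Testing an admissible \<open>k\<close> on null measures already yields \<open>k\<close>
  independent fans, which bounds \<open>k\<close> by the dimension. So the greatest element exists
  and dominates every admissible \<open>k\<close>.\<close>

lemma le_Omega:
  assumes "\<And>\<mu> :: nat \<Rightarrow> (real^'n) measure. (\<forall>j<m. mass_distribution (\<mu> j)) \<Longrightarrow>
       \<exists>A d. (\<forall>i<k. regular_fan q (A i) (d i)) \<and> independent_subspaces k (\<lambda>i. fan_perp q (A i) (d i)) \<and>
              (\<forall>i<k. \<forall>j<m. equipartitions q (A i) (d i) (\<mu> j))"
  shows "k \<le> Omega TYPE('n::finite) q m"
  unfolding Omega_def
proof (rule Greatest_le_nat[where b = "CARD('n)"])
  fix k assume *: "\<forall>\<mu> :: nat \<Rightarrow> (real^'n) measure. (\<forall>j<m. mass_distribution (\<mu> j)) \<longrightarrow>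
       (\<exists>A d. (\<forall>i<k. regular_fan q (A i) (d i)) \<and> independent_subspaces k (\<lambda>i. fan_perp q (A i) (d i)) \<and>
              (\<forall>i<k. \<forall>j<m. equipartitions q (A i) (d i) (\<mu> j)))"
  then obtain A d where "\<forall>i<k. regular_fan q (A i :: (real^'n) set) (d i)" "independent_subspaces k (\<lambda>i. fan_perp q (A i) (d i))"
    using *[rule_format, of "\<lambda>_. null_measure borel"] mass_distribution_null by blast
  then show "k \<le> CARD('n)" using fans_independent_le_dim by blast
qed (use assms in blast)

lemma le_Omega_perp:
  assumes "\<And>\<mu> :: nat \<Rightarrow> (real^'n) measure. (\<forall>j<m. mass_distribution (\<mu> j)) \<Longrightarrow>
       \<exists>A d. (\<forall>i<k. regular_fan q (A i) (d i)) \<and> orthogonal_subspaces k (\<lambda>i. fan_perp q (A i) (d i)) \<and>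
              (\<forall>i<k. \<forall>j<m. equipartitions q (A i) (d i) (\<mu> j))"
  shows "k \<le> Omega_perp TYPE('n::finite) q m"
  unfolding Omega_perp_def
proof (rule Greatest_le_nat[where b = "CARD('n)"])
  fix k assume *: "\<forall>\<mu> :: nat \<Rightarrow> (real^'n) measure. (\<forall>j<m. mass_distribution (\<mu> j)) \<longrightarrow>
       (\<exists>A d. (\<forall>i<k. regular_fan q (A i) (d i)) \<and> orthogonal_subspaces k (\<lambda>i. fan_perp q (A i) (d i)) \<and>
              (\<forall>i<k. \<forall>j<m. equipartitions q (A i) (d i) (\<mu> j)))"
  then obtain A d where "\<forall>i<k. regular_fan q (A i :: (real^'n) set) (d i)" "orthogonal_subspaces k (\<lambda>i. fan_perp q (A i) (d i))"
    using *[rule_format, of "\<lambda>_. null_measure borel"] mass_distribution_null by blast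
  then show "k \<le> CARD('n)" using fans_independent_le_dim orthogonal_imp_independent_subspaces by blast
qed (use assms in blast)

theorem theorem2p2:
  fixes q m n :: nat
  assumes "prime q" and "odd q" and "1 \<le> m" and "1 \<le> n"
    and "CARD('N::finite) = (q - 1) * n"
    and "CARD('t::finite) = (q - 1) * n div 2"
  shows "Omega_perp TYPE('N) q m \<ge> min (rho_complex TYPE('t) q) (n div m) \<and>
    int (Omega TYPE('N) q m) \<ge> \<lceil>1 / 2 * real (min (rho_real TYPE('t) q) (n div m))\<rceil>"
proof
  have q2: "2 \<le> q" using assms(1) by (rule prime_ge_2_nat)
  then have q3: "3 \<le> q" using assms(2) by (cases "q = 2") auto
  have "even (q - 1)" using assms(2) q3 by simp
  then have "CARD('N) = 2 * CARD('t)" unfolding assms(5,6) by auto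
  then obtain \<phi> :: "complex^'t \<Rightarrow> real^'N" where "complex_structure \<phi>"
    by (rule complex_structure_exists)
  then interpret complex_structure \<phi> .
  have km: "k * m \<le> n" if "k \<le> n div m" for k
    using mult_le_mono1[OF that, of m] div_times_less_eq_dividend[of n m] by linarith
  show "min (rho_complex TYPE('t) q) (n div m) \<le> Omega_perp TYPE('N) q m"
  proof (cases "n div m = 0")
    case False
    obtain r where r: "1 \<le> rho_complex TYPE('t) q" "coprime r q"
      "admits_section q r (rho_complex TYPE('t) q) (stiefel_complex (rho_complex TYPE('t) q) :: (nat \<Rightarrow> complex^'t) set)"
      using rho_complex_attained[OF q2, where 't = 't] by blast
    define k where "k = min (rho_complex TYPE('t) q) (n div m)"
    have k: "1 \<le> k" "k \<le> rho_complex TYPE('t) q" "k * m \<le> n"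
      using False r(1) km by (auto simp: k_def)
    show ?thesis
      unfolding k_def[symmetric]
    proof (rule le_Omega_perp)
      fix \<mu> :: "nat \<Rightarrow> (real^'N) measure" assume \<mu>: "\<forall>j<m. mass_distribution (\<mu> j)"
      obtain v \<beta> where v: "v \<in> stiefel_complex (rho_complex TYPE('t) q)"
        "\<And>i j. i \<in> {1..k} \<Longrightarrow> j < m \<Longrightarrow> equipartitions q (center (v i) (\<beta> i)) (direction q (v i)) (\<mu> j)"
        using equipartitioning_frame[OF assms(1-3) k assms(6) r(3,2) stiefel_complex_subset_real] \<mu> by metis
      have herm: "hermitian (v i) (v j) = (if i = j then 1 else 0)" if "i \<in> {1..k}" "j \<in> {1..k}" for i j
        using v(1) that k(2) by (auto simp: stiefel_complex_def)
      have norm: "norm (v i) = 1" if "i \<in> {1..k}" for i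
        using herm[OF that that] Re_hermitian[of "v i" "v i"] by (simp add: norm_eq_1)
      show "\<exists>A d. (\<forall>i<k. regular_fan q (A i) (d i)) \<and> orthogonal_subspaces k (\<lambda>i. fan_perp q (A i) (d i)) \<and>
              (\<forall>i<k. \<forall>j<m. equipartitions q (A i) (d i) (\<mu> j))"
      \<comment> \<open>Frames are indexed from 1, fans from 0.\<close>
      proof (intro exI[of _ "\<lambda>i. center (v (Suc i)) (\<beta> (Suc i))"] exI[of _ "\<lambda>i. direction q (v (Suc i))"] conjI allI impI)
        show "orthogonal_subspaces k (\<lambda>i. fan_perp q (center (v (Suc i)) (\<beta> (Suc i))) (direction q (v (Suc i))))"
          unfolding orthogonal_subspaces_def
          by (intro allI impI ballI, rule orthogonal_fan_perps) (auto simp: norm herm)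
      qed (auto simp: v(2) norm regular_fan_center[OF q3])
    qed
  qed simp
  show "\<lceil>1 / 2 * real (min (rho_real TYPE('t) q) (n div m))\<rceil> \<le> int (Omega TYPE('N) q m)"
  proof (cases "n div m = 0")
    case False
    obtain r where r: "1 \<le> rho_real TYPE('t) q" "coprime r q"
      "admits_section q r (rho_real TYPE('t) q) (stiefel_real (rho_real TYPE('t) q) :: (nat \<Rightarrow> complex^'t) set)"
      using rho_real_attained[OF q2, where 't = 't] by blast
    define K where "K = min (rho_real TYPE('t) q) (n div m)"
    have K: "1 \<le> K" "K \<le> rho_real TYPE('t) q" "K * m \<le> n"
      using False r(1) km by (auto simp: K_def)
    \<comment> \<open>This is \<open>K / 2\<close> rounded up, the number of complex independent
      vectors that \<open>K\<close> real orthonormal ones are certain to contain.\<close>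
    define k where "k = (K + 1) div 2"
    have "k \<le> Omega TYPE('N) q m"
    proof (rule le_Omega)
      fix \<mu> :: "nat \<Rightarrow> (real^'N) measure" assume \<mu>: "\<forall>j<m. mass_distribution (\<mu> j)"
      obtain v \<beta> where v: "v \<in> stiefel_real (rho_real TYPE('t) q)"
        "\<And>i j. i \<in> {1..K} \<Longrightarrow> j < m \<Longrightarrow> equipartitions q (center (v i) (\<beta> i)) (direction q (v i)) (\<mu> j)"
        using equipartitioning_frame[OF assms(1-3) K assms(6) r(3,2) order_refl] \<mu> by metis
      have orth: "v (Suc i) \<bullet> v (Suc j) = (if i = j then 1 else 0)" if "i < K" "j < K" for i j
        using v(1) that K(2) by (auto simp: stiefel_real_def)
      obtain J where J: "J \<subseteq> {..<K}" "K \<le> 2 * card J"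
        "\<And>c. (\<Sum>j\<in>J. c j *s v (Suc j)) = 0 \<Longrightarrow> \<forall>j\<in>J. c j = 0"
        using complex_independent_half[of K "\<lambda>i. v (Suc i)"] orth by blast
      have "k \<le> card J" using J(2) by (simp add: k_def)
      then obtain J' where J': "J' \<subseteq> J" "card J' = k" "finite J'"
        by (rule obtain_subset_with_card_n)
      have finJ: "finite J" using J(1) finite_subset by blast
      obtain g where g: "bij_betw g {..<k} J'"
        using ex_bij_betw_nat_finite[OF J'(3)] J'(2) by (auto simp: lessThan_atLeast0)
      have gK: "g i < K" if "i < k" for i
        using g that J' J(1) by (auto simp: bij_betw_def)
      define w where "w i = v (Suc (g i))" for i
      have norm: "norm (w i) = 1" if "i < k" for i
        using orth[OF gK[OF that] gK[OF that]] by (simp add: w_def norm_eq_1)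
      have ind: "\<forall>i<k. c i = 0" if "(\<Sum>i<k. c i *s w i) = 0" for c
      proof -
        \<comment> \<open>A relation among the chosen vectors is extended by zero to the whole
          independent family \<open>J\<close>.\<close>
        define c' where "c' j = (if j \<in> J' then c (the_inv_into {..<k} g j) else 0)" for j
        have inj: "inj_on g {..<k}" using g by (simp add: bij_betw_def)
        have c': "c' (g i) = c i" if "i < k" for i
          using that g the_inv_into_f_f[OF inj] by (auto simp: c'_def bij_betw_def)
        have "(\<Sum>j\<in>J. c' j *s v (Suc j)) = (\<Sum>j\<in>J'. c' j *s v (Suc j))"
          using J'(1) finJ by (intro sum.mono_neutral_right) (auto simp: c'_def)
        also have "\<dots> = (\<Sum>i<k. c' (g i) *s v (Suc (g i)))"
          by (rule sum.reindex_bij_betw[OF g, symmetric])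
        also have "\<dots> = (\<Sum>i<k. c i *s w i)"
          by (simp add: c' w_def)
        finally have "\<forall>j\<in>J. c' j = 0" using J(3) that by metis
        then show ?thesis using c' g J'(1) by (metis bij_betwE lessThan_iff subsetD)
      qed
      show "\<exists>A d. (\<forall>i<k. regular_fan q (A i) (d i)) \<and> independent_subspaces k (\<lambda>i. fan_perp q (A i) (d i)) \<and>
              (\<forall>i<k. \<forall>j<m. equipartitions q (A i) (d i) (\<mu> j))"
      proof (intro exI[of _ "\<lambda>i. center (w i) (\<beta> (Suc (g i)))"] exI[of _ "\<lambda>i. direction q (w i)"] conjI allI impI)
        show "independent_subspaces k (\<lambda>i. fan_perp q (center (w i) (\<beta> (Suc (g i)))) (direction q (w i)))"
          by (rule independent_fan_perps[OF norm ind])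
        show "equipartitions q (center (w i) (\<beta> (Suc (g i)))) (direction q (w i)) (\<mu> j)" if "i < k" "j < m" for i j
          using v(2)[of "Suc (g i)" j] gK[OF that(1)] that(2) by (simp add: w_def)
      qed (auto simp: norm regular_fan_center[OF q3])
    qed
    moreover have "\<lceil>1 / 2 * real K\<rceil> \<le> int k"
      unfolding k_def by linarith
    ultimately show ?thesis unfolding K_def[symmetric] by linarith
  qed simp
qed

end
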